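(* Let $\mathfrak g$ be an object of the braided monoidal category $(\mathcal V,\otimes,\Psi)$, with morphisms $\sigma:\mathfrak g\otimes\mathfrak g\to\mathfrak g\otimes\mathfrak g$, $[\,,]:\mathfrak g\otimes\mathfrak g\to\mathfrak g$, $\delta:\mathfrak g\to\mathfrak g\otimes\mathfrak g$. Then $(\mathfrak g,\sigma,[\,,],\delta)$ is a good quantum Lie algebra if and only if its extension $(\tilde{\mathfrak g},\tilde\sigma,\tilde\delta,\tilde\varepsilon)$ is a good braided Lie algebra (with canonical braiding $\tilde\sigma$ and unit $1\mapsto\gamma$), with braided Lie bracket $(\mathrm{id}\otimes\tilde\varepsilon)\circ\tilde\sigma$.
   Context: $k$ is a field. $(\mathcal V,\otimes,\Psi)$ is a braided monoidal category (invertible braiding) of modules, comodules or crossed modules (left or right) over a bialgebra or Hopf algebra; objects are $k$-vector spaces with extra structure, the unit object has underlying space $k$; all structure maps are morphisms in $\mathcal V$. Good quantum Lie algebra: $(\mathfrak g,\sigma,[\,,],\delta)$ with $\delta$ coassociative and (with $\Psi=\Psi_{\mathfrak g,\mathfrak g}$) (L1') $[\,,](\mathrm{id}\otimes[\,,])=[\,,]([\,,]\otimes\mathrm{id})+[\,,](\mathrm{id}\otimes[\,,])(\sigma\otimes\mathrm{id})$; (L2'-a) $\sigma=\Psi+([\,,]\otimes\mathrm{id})(\mathrm{id}\otimes\Psi)(\delta\otimes\mathrm{id})$; (L2'-b) $\sigma=\Psi^{-1}+\Psi^{-1}(\mathrm{id}\otimes[\,,])(\delta\otimes\mathrm{id})$;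 (L3') $\delta\circ[\,,]=([\,,]\otimes\mathrm{id})(\mathrm{id}\otimes\delta)+(\mathrm{id}\otimes[\,,])(\Psi\otimes\mathrm{id})(\mathrm{id}\otimes\delta)+([\,,]\otimes[\,,])(\mathrm{id}\otimes\Psi\otimes\mathrm{id})(\delta\otimes\delta)$; and $\ker(\mathrm{id}^{\otimes2}-\sigma)\subset\ker[\,,]$. Extension: $\tilde{\mathfrak g}=k\gamma\oplus\mathfrak g$ ($k\gamma$ the unit object), $\tilde\sigma(\gamma\otimes z)=z\otimes\gamma$, $\tilde\sigma(z\otimes\gamma)=\gamma\otimes z$, $\tilde\sigma(x\otimes y)=\sigma(x\otimes y)+[x,y]\otimes\gamma$; $\tilde\delta(\gamma)=\gamma\otimes\gamma$, $\tilde\delta(x)=x\otimes\gamma+\gamma\otimes x+\delta(x)$; $\tilde\varepsilon(\gamma)=1$, $\tilde\varepsilon(x)=0$ ($z\in\tilde{\mathfrak g}$; $x,y\in\mathfrak g$). Braided Lie algebra in $\mathcal V$: a coalgebra $(L,\Delta,\varepsilon)$ in $\mathcal V$ with a morphism $[\,,]:L\otimes L\to L$ such that, with canonical braiding $\Upsilon=([\,,]\otimes\mathrm{id})(\mathrm{id}\otimes\Psi)(\Delta\otimes\mathrm{id})$: (L1) $[\,,](\mathrm{id}\otimes[\,,])=[\,,]([\,,]\otimes[\,,])(\mathrm{id}\otimes\Psi\otimes\mathrm{id})(\Delta\otimes\mathrm{id}\otimes\mathrm{id})$; (L2) $\Psi\Upsilon=(\mathrm{id}\otimes[\,,])(\Delta\otimes\mathrm{id})$;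 (L3) $\Delta[\,,]=([\,,]\otimes[\,,])(\mathrm{id}\otimes\Psi\otimes\mathrm{id})(\Delta\otimes\Delta)$ and $\varepsilon[\,,]=\varepsilon\otimes\varepsilon$. It is unital if there is a morphism of braided Lie algebras $\eta:k\to L$ with $[\eta(1),z]=z$ and $[z,\eta(1)]=\varepsilon(z)\eta(1)$ for all $z\in L$. For unital $L$, put $\gamma=\eta(1)$, $\mathfrak g=\ker\varepsilon$, and let $\sigma:\mathfrak g^{\otimes2}\to\mathfrak g^{\otimes2}$ be determined by $\Upsilon(x\otimes y)=\sigma(x\otimes y)+[x,y]\otimes\gamma$; $L$ is good if $\ker(\mathrm{id}_{\mathfrak g\otimes\mathfrak g}-\sigma)\subset\ker([\,,]_{|\mathfrak g\otimes\mathfrak g})$. *)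

theory Defs
  imports Complex_Main "HOL-Library.Poly_Mapping"
begin

section \<open>Vector spaces over a field and their tensor products\<close>

text \<open>
  The statement quantifies over categories of vector spaces that are closed under tensor
  products and direct sums, so all spaces live in one universe: the space \<open>('b, 'k) vec\<close> with
  basis the type \<open>'b label\<close>.  A vector space is an arbitrary subspace of the universe (no basis
  of it is chosen); every vector space of dimension at most the cardinality of \<open>'b\<close> is
  isomorphic to such a subspace, and \<open>'b\<close> is arbitrary.  The labels are closed under
  pairing, which makes the tensor product of two subspaces again a subspace (the span of the pure
  tensors), and under two injections, which does the same for direct sums.  The unit object is
  the line spanned by \<open>one\<close>.
\<close>

datatype 'b label = Unit | Atom 'b | Prod "'b label" "'b label" | InL "'b label" | InR "'b label"

type_synonym ('b, 'k) vec = "'b label \<Rightarrow>\<^sub>0 'k"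

definition scale :: "'k::field \<Rightarrow> ('b, 'k) vec \<Rightarrow> ('b, 'k) vec" where
  "scale c u = Poly_Mapping.map ((*) c) u"

lemma lookup_scale [simp]: "Poly_Mapping.lookup (scale c u) t = c * Poly_Mapping.lookup u t"
  unfolding scale_def by transfer (simp add: when_def)

global_interpretation vec: vector_space "scale :: 'k::field \<Rightarrow> ('b, 'k) vec \<Rightarrow> ('b, 'k) vec"
  by unfold_locales (auto intro!: poly_mapping_eqI simp: lookup_add algebra_simps)

text \<open>
  A linear map between subspaces \<open>A\<close> and \<open>B\<close> is represented by a linear endomap of the universe
  sending \<open>A\<close> into \<open>B\<close> (every linear map on \<open>A\<close> extends to one); only its values on \<open>A\<close> matter,
  and equations between maps are only ever required on their source.
\<close>

abbreviation linear_map :: "(('b, 'k::field) vec \<Rightarrow> ('b, 'k) vec) \<Rightarrow> bool" where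
  "linear_map f \<equiv> Vector_Spaces.linear scale scale f"

definition basis :: "'b label \<Rightarrow> ('b, 'k::field) vec" where
  "basis t = Poly_Mapping.single t 1"

text \<open>The linear map with prescribed values on the basis of the universe.\<close>

definition extend :: "('b label \<Rightarrow> ('b, 'k::field) vec) \<Rightarrow> ('b, 'k) vec \<Rightarrow> ('b, 'k) vec" where
  "extend \<phi> u = (\<Sum>t\<in>Poly_Mapping.keys u. scale (Poly_Mapping.lookup u t) (\<phi> t))"

lemma extend_superset:
  assumes "finite S" "Poly_Mapping.keys u \<subseteq> S"
  shows "extend \<phi> u = (\<Sum>t\<in>S. scale (Poly_Mapping.lookup u t) (\<phi> t))"
  unfolding extend_def using assms
  by (intro sum.mono_neutral_left) (auto simp: in_keys_iff)

lemma linear_extend: "linear_map (extend \<phi>)"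
proof -
  have "extend \<phi> (u + v) = extend \<phi> u + extend \<phi> v" for u v
    using extend_superset[of "Poly_Mapping.keys u \<union> Poly_Mapping.keys v" u \<phi>]
      extend_superset[of "Poly_Mapping.keys u \<union> Poly_Mapping.keys v" v \<phi>]
      extend_superset[of "Poly_Mapping.keys u \<union> Poly_Mapping.keys v" "u + v" \<phi>]
      Poly_Mapping.keys_add[of u v]
    by (simp add: lookup_add vec.scale_left_distrib sum.distrib)
  moreover have "extend \<phi> (scale c u) = scale c (extend \<phi> u)" for c u
  proof -
    have "Poly_Mapping.keys (scale c u) \<subseteq> Poly_Mapping.keys u"
      by (auto simp: in_keys_iff)
    then show ?thesis
      using extend_superset[of "Poly_Mapping.keys u" u \<phi>]
        extend_superset[of "Poly_Mapping.keys u" "scale c u" \<phi>]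
      by (simp add: vec.scale_sum_right)
  qed
  ultimately show ?thesis
    by (simp add: Vector_Spaces.linear_iff vec.vector_space_axioms)
qed

lemma extend_basis [simp]: "extend \<phi> (basis t) = \<phi> t"
  by (simp add: extend_def basis_def)

lemma extend_basis_id: "extend basis u = u"
  unfolding extend_def
  by (rule poly_mapping_eqI)
    (auto simp: lookup_sum basis_def lookup_single when_def in_keys_iff if_distrib cong: if_cong)

lemma linear_add': "linear_map f \<Longrightarrow> f (u + v) = f u + f v"
  by (simp add: Vector_Spaces.linear_iff)

lemma linear_scale': "linear_map f \<Longrightarrow> f (scale c u) = scale c (f u)"
  by (simp add: Vector_Spaces.linear_iff)

lemma linear_zero': "linear_map f \<Longrightarrow> f 0 = 0"
  using linear_scale'[of f 0 0] by simp

lemma linear_mapI: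
  "(\<And>u v. f (u + v) = f u + f v) \<Longrightarrow> (\<And>c u. f (scale c u) = scale c (f u)) \<Longrightarrow> linear_map f"
  by (simp add: Vector_Spaces.linear_iff vec.vector_space_axioms)

lemma linear_map_comp: "linear_map f \<Longrightarrow> linear_map g \<Longrightarrow> linear_map (\<lambda>u. f (g u))"
  by (simp add: Vector_Spaces.linear_iff)

lemma linear_map_id: "linear_map id" "linear_map (\<lambda>u. u)"
  by (auto intro: linear_mapI)

lemma linear_map_sum: "linear_map f \<Longrightarrow> f (\<Sum>t\<in>S. g t) = (\<Sum>t\<in>S. f (g t))"
  by (induction S rule: infinite_finite_induct) (simp_all add: linear_add' linear_zero')

lemma extend_eq_linear:
  assumes "linear_map f" shows "extend (\<lambda>t. f (basis t)) u = f u"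
proof -
  have "f (extend basis u) = extend (\<lambda>t. f (basis t)) u"
    by (simp add: extend_def linear_map_sum[OF assms] linear_scale'[OF assms])
  then show ?thesis
    by (simp add: extend_basis_id)
qed

lemma linear_eq_basis:
  assumes "linear_map f" "linear_map g" "\<And>t. f (basis t) = g (basis t)"
  shows "f u = g u"
  using extend_eq_linear[OF assms(1), of u] extend_eq_linear[OF assms(2), of u] assms(3) by simp

lemma extend_extend: "extend \<phi> (extend \<psi> u) = extend (\<lambda>t. extend \<phi> (\<psi> t)) u"
  by (rule linear_eq_basis[OF linear_map_comp[OF linear_extend linear_extend] linear_extend]) simp

definition tensor :: "('b, 'k::field) vec \<Rightarrow> ('b, 'k) vec \<Rightarrow> ('b, 'k) vec"
    (infixr "\<otimes>" 75) where
  "u \<otimes> v = extend (\<lambda>s. extend (\<lambda>t. basis (Prod s t)) v) u"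

lemma extend_add_fun: "extend (\<lambda>t. \<phi> t + \<psi> t) u = extend \<phi> u + extend \<psi> u"
  by (simp add: extend_def vec.scale_right_distrib sum.distrib)

lemma extend_scale_fun: "extend (\<lambda>t. scale c (\<phi> t)) u = scale c (extend \<phi> u)"
  by (simp add: extend_def vec.scale_sum_right mult.commute)

lemma tensor_add_left: "(u + v) \<otimes> w = u \<otimes> w + v \<otimes> w"
  by (simp add: tensor_def linear_add' linear_extend)

lemma tensor_scale_left: "scale c u \<otimes> w = scale c (u \<otimes> w)"
  by (simp add: tensor_def linear_scale' linear_extend)

lemma tensor_add_right: "w \<otimes> (u + v) = w \<otimes> u + w \<otimes> v"
  by (simp add: tensor_def linear_add' linear_extend extend_add_fun)

lemma tensor_scale_right: "w \<otimes> scale c u = scale c (w \<otimes> u)"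
  by (simp add: tensor_def linear_scale' linear_extend extend_scale_fun)

lemmas tensor_simps = tensor_add_left tensor_scale_left tensor_add_right tensor_scale_right

lemma linear_tensor: "linear_map (\<lambda>u. u \<otimes> w)" "linear_map (\<lambda>u. w \<otimes> u)"
  by (rule linear_mapI; simp add: tensor_simps)+

lemma tensor_zero [simp]: "0 \<otimes> w = 0" "w \<otimes> 0 = 0"
  using linear_zero'[OF linear_tensor(1)] linear_zero'[OF linear_tensor(2)] by auto

definition tensor_space :: "('b, 'k::field) vec set \<Rightarrow> ('b, 'k) vec set \<Rightarrow> ('b, 'k) vec set"
    (infixr "\<otimes>\<^sub>S" 75) where
  "A \<otimes>\<^sub>S B = vec.span {a \<otimes> b | a b. a \<in> A \<and> b \<in> B}"

text \<open>The linear map on tensors induced by a bilinear map \<open>F\<close>; see \<open>lin2_tensor\<close> below.\<close>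

definition lin2 :: "(('b, 'k::field) vec \<Rightarrow> ('b, 'k) vec \<Rightarrow> ('b, 'k) vec) \<Rightarrow>
    ('b, 'k) vec \<Rightarrow> ('b, 'k) vec" where
  "lin2 F = extend (\<lambda>p. case p of Prod s t \<Rightarrow> F (basis s) (basis t) | _ \<Rightarrow> 0)"

lemma linear_lin2: "linear_map (lin2 F)"
  unfolding lin2_def by (rule linear_extend)

lemma lin2_tensor:
  assumes "\<And>v. linear_map (\<lambda>u. F u v)" "\<And>u. linear_map (F u)"
  shows "lin2 F (u \<otimes> v) = F u v"
proof -
  have "lin2 F (u \<otimes> v) = extend (\<lambda>s. extend (\<lambda>t. F (basis s) (basis t)) v) u"
    by (simp add: lin2_def tensor_def extend_extend)
  also have "\<dots> = F u v"
    using extend_eq_linear[OF assms(2)] extend_eq_linear[OF assms(1)] by simp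
  finally show ?thesis .
qed

definition tensor_map :: "(('b, 'k::field) vec \<Rightarrow> ('b, 'k) vec) \<Rightarrow>
    (('b, 'k) vec \<Rightarrow> ('b, 'k) vec) \<Rightarrow> ('b, 'k) vec \<Rightarrow> ('b, 'k) vec"
    (infixr "\<otimes>\<^sub>m" 75) where
  "f \<otimes>\<^sub>m g = lin2 (\<lambda>u v. f u \<otimes> g v)"

definition flip :: "('b, 'k::field) vec \<Rightarrow> ('b, 'k) vec" where
  "flip = lin2 (\<lambda>u v. v \<otimes> u)"

text \<open>The associators \<open>(A \<otimes> B) \<otimes> C \<rightarrow> A \<otimes> (B \<otimes> C)\<close> and back.\<close>

definition assocr :: "('b, 'k::field) vec \<Rightarrow> ('b, 'k) vec" where
  "assocr = lin2 (\<lambda>u w. lin2 (\<lambda>a b. a \<otimes> (b \<otimes> w)) u)"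

definition assocl :: "('b, 'k::field) vec \<Rightarrow> ('b, 'k) vec" where
  "assocl = lin2 (\<lambda>a w. lin2 (\<lambda>b c. (a \<otimes> b) \<otimes> c) w)"

text \<open>
  \<open>middle f\<close> is \<open>id \<otimes> f \<otimes> id\<close> on a fourfold tensor product bracketed as
  \<open>(A \<otimes> B) \<otimes> (C \<otimes> D)\<close>.
\<close>

definition middle :: "(('b, 'k::field) vec \<Rightarrow> ('b, 'k) vec) \<Rightarrow> ('b, 'k) vec \<Rightarrow> ('b, 'k) vec"
  where
  "middle f = assocl \<circ> (id \<otimes>\<^sub>m (assocr \<circ> (f \<otimes>\<^sub>m id) \<circ> assocl)) \<circ> assocr"

definition one :: "('b, 'k::field) vec" where
  "one = basis Unit"

text \<open>The scalar \<open>c\<close> such that a vector of the unit object is \<open>scale c one\<close>.\<close>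

definition scalar :: "('b, 'k::field) vec \<Rightarrow> 'k" where
  "scalar u = Poly_Mapping.lookup u Unit"

definition unit_space :: "('b, 'k::field) vec set" where
  "unit_space = vec.span {one}"

definition unitl :: "('b, 'k::field) vec \<Rightarrow> ('b, 'k) vec" where
  "unitl = lin2 (\<lambda>c v. scale (scalar c) v)"

definition unitr :: "('b, 'k::field) vec \<Rightarrow> ('b, 'k) vec" where
  "unitr = lin2 (\<lambda>v c. scale (scalar c) v)"

definition inl :: "('b, 'k::field) vec \<Rightarrow> ('b, 'k) vec" where
  "inl = extend (\<lambda>t. basis (InL t))"

definition inr :: "('b, 'k::field) vec \<Rightarrow> ('b, 'k) vec" where
  "inr = extend (\<lambda>t. basis (InR t))"

definition prl :: "('b, 'k::field) vec \<Rightarrow> ('b, 'k) vec" where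
  "prl = extend (\<lambda>p. case p of InL t \<Rightarrow> basis t | _ \<Rightarrow> 0)"

definition prr :: "('b, 'k::field) vec \<Rightarrow> ('b, 'k) vec" where
  "prr = extend (\<lambda>p. case p of InR t \<Rightarrow> basis t | _ \<Rightarrow> 0)"

lemma linear_maps [intro]:
  "linear_map (f \<otimes>\<^sub>m g)" "linear_map flip" "linear_map assocr" "linear_map assocl"
  "linear_map unitl" "linear_map unitr" "linear_map inl" "linear_map inr"
  "linear_map prl" "linear_map prr"
  unfolding tensor_map_def flip_def assocr_def assocl_def unitl_def unitr_def inl_def inr_def
    prl_def prr_def
  by (rule linear_lin2 linear_extend)+

lemma tensor_map_tensor:
  "linear_map f \<Longrightarrow> linear_map g \<Longrightarrow> (f \<otimes>\<^sub>m g) (u \<otimes> v) = f u \<otimes> g v"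
  unfolding tensor_map_def
  by (rule lin2_tensor) (auto intro!: linear_mapI simp: linear_add' linear_scale' tensor_simps)

lemma flip_tensor: "flip (u \<otimes> v) = v \<otimes> u"
  unfolding flip_def by (rule lin2_tensor) (auto intro!: linear_mapI simp: tensor_simps)

lemma lin2_fun_add: "lin2 (\<lambda>u v. F u v + G u v) x = lin2 F x + lin2 G x"
  unfolding lin2_def extend_add_fun[symmetric]
  by (rule arg_cong[of _ _ "\<lambda>f. extend f x"]) (auto simp: fun_eq_iff split: label.split)

lemma lin2_fun_scale: "lin2 (\<lambda>u v. scale c (F u v)) x = scale c (lin2 F x)"
  unfolding lin2_def extend_scale_fun[symmetric]
  by (rule arg_cong[of _ _ "\<lambda>f. extend f x"]) (auto simp: fun_eq_iff split: label.split)

lemma assocr_tensor: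
  fixes u v w :: "('b, 'k::field) vec"
  shows "assocr ((u \<otimes> v) \<otimes> w) = u \<otimes> (v \<otimes> w)"
proof -
  have "lin2 (\<lambda>a b. a \<otimes> (b \<otimes> (w + w'))) x =
      lin2 (\<lambda>a b. a \<otimes> (b \<otimes> w)) x + lin2 (\<lambda>a b. a \<otimes> (b \<otimes> w')) x"
    for w w' x :: "('b, 'k::field) vec"
    by (simp add: tensor_simps lin2_fun_add)
  moreover have "lin2 (\<lambda>a b. a \<otimes> (b \<otimes> scale c w)) x = scale c (lin2 (\<lambda>a b. a \<otimes> (b \<otimes> w)) x)"
    for c and w x :: "('b, 'k::field) vec"
    by (simp add: tensor_simps lin2_fun_scale)
  ultimately have "assocr ((u \<otimes> v) \<otimes> w) = lin2 (\<lambda>a b. a \<otimes> (b \<otimes> w)) (u \<otimes> v)"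
    unfolding assocr_def by (intro lin2_tensor linear_lin2 linear_mapI)
  also have "\<dots> = u \<otimes> (v \<otimes> w)"
    by (rule lin2_tensor) (auto intro!: linear_mapI simp: tensor_simps)
  finally show ?thesis .
qed

lemma assocl_tensor:
  fixes u v w :: "('b, 'k::field) vec"
  shows "assocl (u \<otimes> (v \<otimes> w)) = (u \<otimes> v) \<otimes> w"
proof -
  have "lin2 (\<lambda>b c. ((u + u') \<otimes> b) \<otimes> c) x =
      lin2 (\<lambda>b c. (u \<otimes> b) \<otimes> c) x + lin2 (\<lambda>b c. (u' \<otimes> b) \<otimes> c) x"
    for u u' x :: "('b, 'k::field) vec"
    unfolding lin2_fun_add[symmetric]
    by (rule arg_cong[of _ _ "\<lambda>F. lin2 F x"]) (simp add: fun_eq_iff tensor_simps)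
  moreover have "lin2 (\<lambda>b d. (scale c u \<otimes> b) \<otimes> d) x = scale c (lin2 (\<lambda>b d. (u \<otimes> b) \<otimes> d) x)"
    for c and u x :: "('b, 'k::field) vec"
    unfolding lin2_fun_scale[symmetric]
    by (rule arg_cong[of _ _ "\<lambda>F. lin2 F x"]) (simp add: fun_eq_iff tensor_simps)
  ultimately have "assocl (u \<otimes> (v \<otimes> w)) = lin2 (\<lambda>b c. (u \<otimes> b) \<otimes> c) (v \<otimes> w)"
    unfolding assocl_def by (intro lin2_tensor linear_lin2 linear_mapI)
  also have "\<dots> = (u \<otimes> v) \<otimes> w"
    by (rule lin2_tensor) (auto intro!: linear_mapI simp: tensor_simps)
  finally show ?thesis .
qed

lemma scalar_simps [simp]:
  "scalar one = 1" "scalar (u + v) = scalar u + scalar v" "scalar (scale c u) = c * scalar u"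
  "scalar 0 = 0"
  by (simp_all add: scalar_def one_def basis_def lookup_add)

lemma unit_tensor: "unitl (c \<otimes> v) = scale (scalar c) v" "unitr (v \<otimes> c) = scale (scalar c) v"
  unfolding unitl_def unitr_def
  by (subst lin2_tensor; auto intro!: linear_mapI simp: vec.scale_left_distrib
      vec.scale_right_distrib mult.commute)+

lemma linear_zero_map: "linear_map (\<lambda>u. 0)"
  by (rule linear_mapI) auto

lemma prl_inl [simp]: "prl (inl u) = u"
  by (rule linear_eq_basis[OF linear_map_comp[OF linear_maps(9,7)] linear_map_id(2)])
    (simp add: prl_def inl_def)

lemma prl_inr [simp]: "prl (inr u) = 0"
  by (rule linear_eq_basis[OF linear_map_comp[OF linear_maps(9,8)] linear_zero_map])
    (simp add: prl_def inr_def)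

lemma prr_inl [simp]: "prr (inl u) = 0"
  by (rule linear_eq_basis[OF linear_map_comp[OF linear_maps(10,7)] linear_zero_map])
    (simp add: prr_def inl_def)

lemma prr_inr [simp]: "prr (inr u) = u"
  by (rule linear_eq_basis[OF linear_map_comp[OF linear_maps(10,8)] linear_map_id(2)])
    (simp add: prr_def inr_def)

definition sum_space :: "('b, 'k::field) vec set \<Rightarrow> ('b, 'k) vec set \<Rightarrow> ('b, 'k) vec set" where
  "sum_space A B = {inl a + inr b | a b. a \<in> A \<and> b \<in> B}"

definition kernel_on :: "('b, 'k::field) vec set \<Rightarrow> (('b, 'k) vec \<Rightarrow> ('b, 'k) vec) \<Rightarrow>
    ('b, 'k) vec set" where
  "kernel_on A f = {x \<in> A. f x = 0}"


section \<open>Bialgebras, modules, comodules and crossed modules\<close>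

definition coalgebra :: "('b, 'k::field) vec set \<Rightarrow> (('b, 'k) vec \<Rightarrow> ('b, 'k) vec) \<Rightarrow>
    (('b, 'k) vec \<Rightarrow> ('b, 'k) vec) \<Rightarrow> bool" where
  "coalgebra C \<Delta> \<epsilon> \<longleftrightarrow>
     vec.subspace C \<and>
     linear_map \<Delta> \<and> \<Delta> ` C \<subseteq> C \<otimes>\<^sub>S C \<and>
     linear_map \<epsilon> \<and> \<epsilon> ` C \<subseteq> unit_space \<and>
     (\<forall>x\<in>C. assocr ((\<Delta> \<otimes>\<^sub>m id) (\<Delta> x)) = (id \<otimes>\<^sub>m \<Delta>) (\<Delta> x)) \<and>
     (\<forall>x\<in>C. unitl ((\<epsilon> \<otimes>\<^sub>m id) (\<Delta> x)) = x) \<and>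
     (\<forall>x\<in>C. unitr ((id \<otimes>\<^sub>m \<epsilon>) (\<Delta> x)) = x)"

text \<open>\<open>algebra A m e\<close>: the multiplication is a linear map on \<open>A \<otimes> A\<close>, the unit element is \<open>e\<close>.\<close>

definition algebra :: "('b, 'k::field) vec set \<Rightarrow> (('b, 'k) vec \<Rightarrow> ('b, 'k) vec) \<Rightarrow>
    ('b, 'k) vec \<Rightarrow> bool" where
  "algebra A m e \<longleftrightarrow>
     vec.subspace A \<and>
     linear_map m \<and> m ` (A \<otimes>\<^sub>S A) \<subseteq> A \<and> e \<in> A \<and>
     (\<forall>x\<in>(A \<otimes>\<^sub>S A) \<otimes>\<^sub>S A. m ((m \<otimes>\<^sub>m id) x) = m ((id \<otimes>\<^sub>m m) (assocr x))) \<and>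
     (\<forall>x\<in>A. m (e \<otimes> x) = x) \<and>
     (\<forall>x\<in>A. m (x \<otimes> e) = x)"

record (overloaded) ('b, 'k::zero) bialg =
  hspace :: "('b, 'k) vec set"
  mult :: "('b, 'k) vec \<Rightarrow> ('b, 'k) vec"
  unit :: "('b, 'k) vec"
  comult :: "('b, 'k) vec \<Rightarrow> ('b, 'k) vec"
  counit :: "('b, 'k) vec \<Rightarrow> ('b, 'k) vec"

definition bialgebra :: "('b, 'k::field) bialg \<Rightarrow> bool" where
  "bialgebra H \<longleftrightarrow>
     algebra (hspace H) (mult H) (unit H) \<and>
     coalgebra (hspace H) (comult H) (counit H) \<and>
     (\<forall>x\<in>hspace H \<otimes>\<^sub>S hspace H.
        comult H (mult H x) =
          (mult H \<otimes>\<^sub>m mult H) (middle flip ((comult H \<otimes>\<^sub>m comult H) x))) \<and>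
     (\<forall>x\<in>hspace H \<otimes>\<^sub>S hspace H.
        counit H (mult H x) = unitl ((counit H \<otimes>\<^sub>m counit H) x)) \<and>
     comult H (unit H) = unit H \<otimes> unit H \<and>
     counit H (unit H) = one"

datatype side = Left | Right

datatype sort = Module | Comodule | Crossed

text \<open>
  An object carries an action (a linear map from \<open>H \<otimes> V\<close> or \<open>V \<otimes> H\<close> to \<open>V\<close>) and a coaction
  (from \<open>V\<close> to \<open>H \<otimes> V\<close> or \<open>V \<otimes> H\<close>).  For modules the coaction field is ignored, for comodules
  the action field.
\<close>

record (overloaded) ('b, 'k::zero) object =
  space :: "('b, 'k) vec set"
  act :: "('b, 'k) vec \<Rightarrow> ('b, 'k) vec"
  coact :: "('b, 'k) vec \<Rightarrow> ('b, 'k) vec"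

fun with_H :: "side \<Rightarrow> ('b, 'k::field) bialg \<Rightarrow> ('b, 'k) vec set \<Rightarrow> ('b, 'k) vec set" where
  "with_H Left H A = hspace H \<otimes>\<^sub>S A"
| "with_H Right H A = A \<otimes>\<^sub>S hspace H"

fun on_side :: "side \<Rightarrow> (('b, 'k::field) vec \<Rightarrow> ('b, 'k) vec) \<Rightarrow> ('b, 'k) vec \<Rightarrow> ('b, 'k) vec"
  where
  "on_side Left f = id \<otimes>\<^sub>m f"
| "on_side Right f = f \<otimes>\<^sub>m id"

fun is_module :: "side \<Rightarrow> ('b, 'k::field) bialg \<Rightarrow> ('b, 'k) object \<Rightarrow> bool" where
  "is_module Left H A \<longleftrightarrow>
     vec.subspace (space A) \<and> linear_map (act A) \<and>
     act A ` (hspace H \<otimes>\<^sub>S space A) \<subseteq> space A \<and>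
     (\<forall>x\<in>(hspace H \<otimes>\<^sub>S hspace H) \<otimes>\<^sub>S space A.
        act A ((mult H \<otimes>\<^sub>m id) x) = act A ((id \<otimes>\<^sub>m act A) (assocr x))) \<and>
     (\<forall>v\<in>space A. act A (unit H \<otimes> v) = v)"
| "is_module Right H A \<longleftrightarrow>
     vec.subspace (space A) \<and> linear_map (act A) \<and>
     act A ` (space A \<otimes>\<^sub>S hspace H) \<subseteq> space A \<and>
     (\<forall>x\<in>space A \<otimes>\<^sub>S (hspace H \<otimes>\<^sub>S hspace H).
        act A ((id \<otimes>\<^sub>m mult H) x) = act A ((act A \<otimes>\<^sub>m id) (assocl x))) \<and>
     (\<forall>v\<in>space A. act A (v \<otimes> unit H) = v)"

fun is_comodule :: "side \<Rightarrow> ('b, 'k::field) bialg \<Rightarrow> ('b, 'k) object \<Rightarrow> bool" where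
  "is_comodule Left H A \<longleftrightarrow>
     vec.subspace (space A) \<and> linear_map (coact A) \<and>
     coact A ` space A \<subseteq> hspace H \<otimes>\<^sub>S space A \<and>
     (\<forall>v\<in>space A. assocr ((comult H \<otimes>\<^sub>m id) (coact A v)) = (id \<otimes>\<^sub>m coact A) (coact A v)) \<and>
     (\<forall>v\<in>space A. unitl ((counit H \<otimes>\<^sub>m id) (coact A v)) = v)"
| "is_comodule Right H A \<longleftrightarrow>
     vec.subspace (space A) \<and> linear_map (coact A) \<and>
     coact A ` space A \<subseteq> space A \<otimes>\<^sub>S hspace H \<and>
     (\<forall>v\<in>space A. assocl ((id \<otimes>\<^sub>m comult H) (coact A v)) = (coact A \<otimes>\<^sub>m id) (coact A v)) \<and>
     (\<forall>v\<in>space A. unitr ((id \<otimes>\<^sub>m counit H) (coact A v)) = v)"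

text \<open>
  Compatibility of action and coaction in a crossed (Yetter-Drinfeld) module.  In Sweedler
  notation, on the left:
  \<open>h\<^sub>1 v\<^sup>(\<^sup>-\<^sup>1\<^sup>) \<otimes> h\<^sub>2.v\<^sup>(\<^sup>0\<^sup>) = (h\<^sub>1.v)\<^sup>(\<^sup>-\<^sup>1\<^sup>) h\<^sub>2 \<otimes> (h\<^sub>1.v)\<^sup>(\<^sup>0\<^sup>)\<close>;
  on the right:
  \<open>v\<^sup>(\<^sup>0\<^sup>).h\<^sub>1 \<otimes> v\<^sup>(\<^sup>1\<^sup>) h\<^sub>2 = (v.h\<^sub>2)\<^sup>(\<^sup>0\<^sup>) \<otimes> h\<^sub>1 (v.h\<^sub>2)\<^sup>(\<^sup>1\<^sup>)\<close>.
\<close>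

fun crossed_condition :: "side \<Rightarrow> ('b, 'k::field) bialg \<Rightarrow> ('b, 'k) object \<Rightarrow> bool" where
  "crossed_condition Left H A \<longleftrightarrow>
     (\<forall>x\<in>hspace H \<otimes>\<^sub>S space A.
        ((mult H \<otimes>\<^sub>m act A) \<circ> middle flip \<circ> (comult H \<otimes>\<^sub>m coact A)) x =
        ((mult H \<otimes>\<^sub>m id) \<circ> assocl \<circ> (id \<otimes>\<^sub>m flip) \<circ> assocr \<circ> (coact A \<otimes>\<^sub>m id) \<circ>
         (act A \<otimes>\<^sub>m id) \<circ> assocl \<circ> (id \<otimes>\<^sub>m flip) \<circ> assocr \<circ> (comult H \<otimes>\<^sub>m id)) x)"
| "crossed_condition Right H A \<longleftrightarrow>
     (\<forall>x\<in>space A \<otimes>\<^sub>S hspace H.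
        ((act A \<otimes>\<^sub>m mult H) \<circ> middle flip \<circ> (coact A \<otimes>\<^sub>m comult H)) x =
        ((id \<otimes>\<^sub>m mult H) \<circ> assocr \<circ> (flip \<otimes>\<^sub>m id) \<circ> assocl \<circ> (id \<otimes>\<^sub>m coact A) \<circ>
         (id \<otimes>\<^sub>m act A) \<circ> assocr \<circ> (flip \<otimes>\<^sub>m id) \<circ> assocl \<circ> (id \<otimes>\<^sub>m comult H)) x)"

fun is_object :: "sort \<Rightarrow> side \<Rightarrow> ('b, 'k::field) bialg \<Rightarrow> ('b, 'k) object \<Rightarrow> bool" where
  "is_object Module s H A \<longleftrightarrow> is_module s H A"
| "is_object Comodule s H A \<longleftrightarrow> is_comodule s H A"
| "is_object Crossed s H A \<longleftrightarrow> is_module s H A \<and> is_comodule s H A \<and> crossed_condition s H A"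

definition commutes_act :: "side \<Rightarrow> ('b, 'k::field) bialg \<Rightarrow> ('b, 'k) object \<Rightarrow> ('b, 'k) object \<Rightarrow>
    (('b, 'k) vec \<Rightarrow> ('b, 'k) vec) \<Rightarrow> bool" where
  "commutes_act s H A B f \<longleftrightarrow>
     (\<forall>x\<in>with_H s H (space A). f (act A x) = act B (on_side s f x))"

definition commutes_coact :: "side \<Rightarrow> ('b, 'k::field) object \<Rightarrow> ('b, 'k) object \<Rightarrow>
    (('b, 'k) vec \<Rightarrow> ('b, 'k) vec) \<Rightarrow> bool" where
  "commutes_coact s A B f \<longleftrightarrow> (\<forall>v\<in>space A. on_side s f (coact A v) = coact B (f v))"

fun unit_object :: "side \<Rightarrow> ('b, 'k::field) bialg \<Rightarrow> ('b, 'k) object" where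
  "unit_object Left H =
     \<lparr>space = unit_space,
      act = unitl \<circ> (counit H \<otimes>\<^sub>m id),
      coact = (\<lambda>c. scale (scalar c) (unit H \<otimes> one))\<rparr>"
| "unit_object Right H =
     \<lparr>space = unit_space,
      act = unitr \<circ> (id \<otimes>\<^sub>m counit H),
      coact = (\<lambda>c. scale (scalar c) (one \<otimes> unit H))\<rparr>"

fun tensor_object :: "side \<Rightarrow> ('b, 'k::field) bialg \<Rightarrow> ('b, 'k) object \<Rightarrow> ('b, 'k) object \<Rightarrow>
    ('b, 'k) object" where
  "tensor_object Left H A B =
     \<lparr>space = space A \<otimes>\<^sub>S space B,
      act = (act A \<otimes>\<^sub>m act B) \<circ> middle flip \<circ> (comult H \<otimes>\<^sub>m id),
      coact = (mult H \<otimes>\<^sub>m id) \<circ> middle flip \<circ> (coact A \<otimes>\<^sub>m coact B)\<rparr>"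
| "tensor_object Right H A B =
     \<lparr>space = space A \<otimes>\<^sub>S space B,
      act = (act A \<otimes>\<^sub>m act B) \<circ> middle flip \<circ> (id \<otimes>\<^sub>m comult H),
      coact = (id \<otimes>\<^sub>m mult H) \<circ> middle flip \<circ> (coact A \<otimes>\<^sub>m coact B)\<rparr>"

definition sum_object :: "side \<Rightarrow> ('b, 'k::field) object \<Rightarrow> ('b, 'k) object \<Rightarrow> ('b, 'k) object"
  where
  "sum_object s A B =
     \<lparr>space = sum_space (space A) (space B),
      act = (\<lambda>x. inl (act A (on_side s prl x)) + inr (act B (on_side s prr x))),
      coact = (\<lambda>v. on_side s inl (coact A (prl v)) + on_side s inr (coact B (prr v)))\<rparr>"


section \<open>Braided monoidal categories of (co)modules\<close>

text \<open>
  \<open>Obj V\<close> is a class of modules, comodules or crossed modules over the bialgebra \<open>over V\<close>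
  (a Hopf algebra is in particular a bialgebra) containing the unit object and closed under
  tensor products and finite direct sums.  It may be the class of all of them, which has these
  closure properties, or a smaller one: for many quantum groups the braiding exists only on a
  full subcategory, such as that of the finite-dimensional modules.  The braiding is an
  arbitrary one; it need not come from a universal R-matrix.
\<close>

record (overloaded) ('b, 'k::zero) category =
  over :: "('b, 'k) bialg"
  sort_of :: sort
  side_of :: side
  Obj :: "('b, 'k) object set"
  Psi :: "('b, 'k) object \<Rightarrow> ('b, 'k) object \<Rightarrow> ('b, 'k) vec \<Rightarrow> ('b, 'k) vec"

definition Hom :: "('b, 'k::field) category \<Rightarrow> ('b, 'k) object \<Rightarrow> ('b, 'k) object \<Rightarrow>
    (('b, 'k) vec \<Rightarrow> ('b, 'k) vec) set" where
  "Hom V A B = {f. linear_map f \<and> f ` space A \<subseteq> space B \<and>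
     (sort_of V \<in> {Module, Crossed} \<longrightarrow> commutes_act (side_of V) (over V) A B f) \<and>
     (sort_of V \<in> {Comodule, Crossed} \<longrightarrow> commutes_coact (side_of V) A B f)}"

abbreviation unit_ob :: "('b, 'k::field) category \<Rightarrow> ('b, 'k) object" ("\<I>\<index>") where
  "\<I>\<^bsub>V\<^esub> \<equiv> unit_object (side_of V) (over V)"

abbreviation tensor_ob :: "('b, 'k::field) category \<Rightarrow> ('b, 'k) object \<Rightarrow> ('b, 'k) object \<Rightarrow>
    ('b, 'k) object" ("_ \<odot>\<index> _" [76, 75] 75) where
  "A \<odot>\<^bsub>V\<^esub> B \<equiv> tensor_object (side_of V) (over V) A B"

abbreviation sum_ob :: "('b, 'k::field) category \<Rightarrow> ('b, 'k) object \<Rightarrow> ('b, 'k) object \<Rightarrow>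
    ('b, 'k) object" ("_ \<oplus>\<index> _" [66, 65] 65) where
  "A \<oplus>\<^bsub>V\<^esub> B \<equiv> sum_object (side_of V) A B"

definition closed_class :: "sort \<Rightarrow> side \<Rightarrow> ('b, 'k::field) bialg \<Rightarrow> ('b, 'k) object set \<Rightarrow> bool"
  where
  "closed_class t s H X \<longleftrightarrow>
     (\<forall>A\<in>X. is_object t s H A) \<and>
     unit_object s H \<in> X \<and>
     (\<forall>A\<in>X. \<forall>B\<in>X. tensor_object s H A B \<in> X \<and> sum_object s A B \<in> X)"

definition braided_monoidal_category :: "('b, 'k::field) category \<Rightarrow> bool" where
  "braided_monoidal_category V \<longleftrightarrow>
     bialgebra (over V) \<and>
     closed_class (sort_of V) (side_of V) (over V) (Obj V) \<and>
     \<comment> \<open>each component of the braiding is an isomorphism\<close>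
     (\<forall>A\<in>Obj V. \<forall>B\<in>Obj V.
        Psi V A B \<in> Hom V (A \<odot>\<^bsub>V\<^esub> B) (B \<odot>\<^bsub>V\<^esub> A) \<and>
        (\<exists>\<Phi>\<in>Hom V (B \<odot>\<^bsub>V\<^esub> A) (A \<odot>\<^bsub>V\<^esub> B).
           (\<forall>x\<in>space (A \<odot>\<^bsub>V\<^esub> B). \<Phi> (Psi V A B x) = x) \<and>
           (\<forall>y\<in>space (B \<odot>\<^bsub>V\<^esub> A). Psi V A B (\<Phi> y) = y))) \<and>
     \<comment> \<open>naturality\<close>
     (\<forall>A\<in>Obj V. \<forall>A'\<in>Obj V. \<forall>B\<in>Obj V. \<forall>B'\<in>Obj V.
        \<forall>f\<in>Hom V A A'. \<forall>g\<in>Hom V B B'. \<forall>x\<in>space (A \<odot>\<^bsub>V\<^esub> B).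
          Psi V A' B' ((f \<otimes>\<^sub>m g) x) = (g \<otimes>\<^sub>m f) (Psi V A B x)) \<and>
     \<comment> \<open>the two hexagon identities\<close>
     (\<forall>A\<in>Obj V. \<forall>B\<in>Obj V. \<forall>C\<in>Obj V. \<forall>x\<in>space ((A \<odot>\<^bsub>V\<^esub> B) \<odot>\<^bsub>V\<^esub> C).
        Psi V (A \<odot>\<^bsub>V\<^esub> B) C x =
          (assocr \<circ> (Psi V A C \<otimes>\<^sub>m id) \<circ> assocl \<circ> (id \<otimes>\<^sub>m Psi V B C) \<circ> assocr) x) \<and>
     (\<forall>A\<in>Obj V. \<forall>B\<in>Obj V. \<forall>C\<in>Obj V. \<forall>x\<in>space (A \<odot>\<^bsub>V\<^esub> (B \<odot>\<^bsub>V\<^esub> C)).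
        Psi V A (B \<odot>\<^bsub>V\<^esub> C) x =
          (assocl \<circ> (id \<otimes>\<^sub>m Psi V A C) \<circ> assocr \<circ> (Psi V A B \<otimes>\<^sub>m id) \<circ> assocl) x)"


section \<open>Good quantum Lie algebras\<close>

text \<open>
  The inverse \<open>\<Psi>'\<close> is that of the restriction of \<open>\<Psi>\<close> to a bijection of \<open>g \<otimes> g\<close>; the braided
  Jacobi identity, the two expressions for \<open>\<sigma>\<close> and the formula for \<open>\<delta> \<circ> [,]\<close> follow in this order.
\<close>

definition good_quantum_Lie_algebra :: "('b, 'k::field) category \<Rightarrow> ('b, 'k) object \<Rightarrow>
    (('b, 'k) vec \<Rightarrow> ('b, 'k) vec) \<Rightarrow> (('b, 'k) vec \<Rightarrow> ('b, 'k) vec) \<Rightarrow>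
    (('b, 'k) vec \<Rightarrow> ('b, 'k) vec) \<Rightarrow> bool" where
  "good_quantum_Lie_algebra V g \<sigma> br \<delta> \<longleftrightarrow>
     (let \<Psi> = Psi V g g; \<Psi>' = inv_into (space g \<otimes>\<^sub>S space g) \<Psi> in
     g \<in> Obj V \<and>
     \<sigma> \<in> Hom V (g \<odot>\<^bsub>V\<^esub> g) (g \<odot>\<^bsub>V\<^esub> g) \<and>
     br \<in> Hom V (g \<odot>\<^bsub>V\<^esub> g) g \<and>
     \<delta> \<in> Hom V g (g \<odot>\<^bsub>V\<^esub> g) \<and>
     (\<forall>x\<in>space g. assocr ((\<delta> \<otimes>\<^sub>m id) (\<delta> x)) = (id \<otimes>\<^sub>m \<delta>) (\<delta> x)) \<and>
     (\<forall>x\<in>space g \<otimes>\<^sub>S (space g \<otimes>\<^sub>S space g).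
        (br \<circ> (id \<otimes>\<^sub>m br)) x =
        (br \<circ> (br \<otimes>\<^sub>m id) \<circ> assocl) x +
        (br \<circ> (id \<otimes>\<^sub>m br) \<circ> assocr \<circ> (\<sigma> \<otimes>\<^sub>m id) \<circ> assocl) x) \<and>
     (\<forall>x\<in>space g \<otimes>\<^sub>S space g.
        \<sigma> x = \<Psi> x +
          ((br \<otimes>\<^sub>m id) \<circ> assocl \<circ> (id \<otimes>\<^sub>m \<Psi>) \<circ> assocr \<circ> (\<delta> \<otimes>\<^sub>m id)) x) \<and>
     (\<forall>x\<in>space g \<otimes>\<^sub>S space g.
        \<sigma> x = \<Psi>' x + (\<Psi>' \<circ> (id \<otimes>\<^sub>m br) \<circ> assocr \<circ> (\<delta> \<otimes>\<^sub>m id)) x) \<and>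
     (\<forall>x\<in>space g \<otimes>\<^sub>S space g.
        \<delta> (br x) =
          ((br \<otimes>\<^sub>m id) \<circ> assocl \<circ> (id \<otimes>\<^sub>m \<delta>)) x +
          ((id \<otimes>\<^sub>m br) \<circ> assocr \<circ> (\<Psi> \<otimes>\<^sub>m id) \<circ> assocl \<circ> (id \<otimes>\<^sub>m \<delta>)) x +
          ((br \<otimes>\<^sub>m br) \<circ> middle \<Psi> \<circ> (\<delta> \<otimes>\<^sub>m \<delta>)) x) \<and>
     kernel_on (space g \<otimes>\<^sub>S space g) (\<lambda>x. x - \<sigma> x) \<subseteq> kernel_on (space g \<otimes>\<^sub>S space g) br)"


section \<open>Good braided Lie algebras\<close>

definition canonical_braiding :: "('b, 'k::field) category \<Rightarrow> ('b, 'k) object \<Rightarrow>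
    (('b, 'k) vec \<Rightarrow> ('b, 'k) vec) \<Rightarrow> (('b, 'k) vec \<Rightarrow> ('b, 'k) vec) \<Rightarrow>
    ('b, 'k) vec \<Rightarrow> ('b, 'k) vec" where
  "canonical_braiding V L \<Delta> br =
     (br \<otimes>\<^sub>m id) \<circ> assocl \<circ> (id \<otimes>\<^sub>m Psi V L L) \<circ> assocr \<circ> (\<Delta> \<otimes>\<^sub>m id)"

definition braided_Lie_algebra :: "('b, 'k::field) category \<Rightarrow> ('b, 'k) object \<Rightarrow>
    (('b, 'k) vec \<Rightarrow> ('b, 'k) vec) \<Rightarrow> (('b, 'k) vec \<Rightarrow> ('b, 'k) vec) \<Rightarrow>
    (('b, 'k) vec \<Rightarrow> ('b, 'k) vec) \<Rightarrow> bool" where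
  "braided_Lie_algebra V L \<Delta> \<epsilon> br \<longleftrightarrow>
     (let \<Psi> = Psi V L L; \<Upsilon> = canonical_braiding V L \<Delta> br in
     L \<in> Obj V \<and>
     \<Delta> \<in> Hom V L (L \<odot>\<^bsub>V\<^esub> L) \<and> \<epsilon> \<in> Hom V L \<I>\<^bsub>V\<^esub> \<and> coalgebra (space L) \<Delta> \<epsilon> \<and>
     br \<in> Hom V (L \<odot>\<^bsub>V\<^esub> L) L \<and>
     (\<forall>x\<in>space L \<otimes>\<^sub>S (space L \<otimes>\<^sub>S space L).
        (br \<circ> (id \<otimes>\<^sub>m br)) x = (br \<circ> (br \<otimes>\<^sub>m br) \<circ> middle \<Psi> \<circ> (\<Delta> \<otimes>\<^sub>m id)) x) \<and>
     (\<forall>x\<in>space L \<otimes>\<^sub>S space L. \<Psi> (\<Upsilon> x) = ((id \<otimes>\<^sub>m br) \<circ> assocr \<circ> (\<Delta> \<otimes>\<^sub>m id)) x) \<and>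
     (\<forall>x\<in>space L \<otimes>\<^sub>S space L. \<Delta> (br x) = ((br \<otimes>\<^sub>m br) \<circ> middle \<Psi> \<circ> (\<Delta> \<otimes>\<^sub>m \<Delta>)) x) \<and>
     (\<forall>x\<in>space L \<otimes>\<^sub>S space L. \<epsilon> (br x) = unitl ((\<epsilon> \<otimes>\<^sub>m \<epsilon>) x)))"

definition braided_Lie_hom :: "('b, 'k::field) category \<Rightarrow>
    ('b, 'k) object \<Rightarrow> (('b, 'k) vec \<Rightarrow> ('b, 'k) vec) \<Rightarrow> (('b, 'k) vec \<Rightarrow> ('b, 'k) vec) \<Rightarrow>
      (('b, 'k) vec \<Rightarrow> ('b, 'k) vec) \<Rightarrow>
    ('b, 'k) object \<Rightarrow> (('b, 'k) vec \<Rightarrow> ('b, 'k) vec) \<Rightarrow> (('b, 'k) vec \<Rightarrow> ('b, 'k) vec) \<Rightarrow>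
      (('b, 'k) vec \<Rightarrow> ('b, 'k) vec) \<Rightarrow>
    (('b, 'k) vec \<Rightarrow> ('b, 'k) vec) \<Rightarrow> bool" where
  "braided_Lie_hom V L \<Delta> \<epsilon> br L' \<Delta>' \<epsilon>' br' f \<longleftrightarrow>
     f \<in> Hom V L L' \<and>
     (\<forall>x\<in>space L. \<Delta>' (f x) = (f \<otimes>\<^sub>m f) (\<Delta> x)) \<and>
     (\<forall>x\<in>space L. \<epsilon>' (f x) = \<epsilon> x) \<and>
     (\<forall>x\<in>space L \<otimes>\<^sub>S space L. f (br x) = br' ((f \<otimes>\<^sub>m f) x))"

text \<open>
  \<open>\<eta>\<close> is a unit: a morphism from the trivial braided Lie algebra on the unit object, with
  \<open>\<Delta>(1) = 1 \<otimes> 1\<close>, \<open>\<epsilon>(1) = 1\<close> and \<open>[1,1] = 1\<close>.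
\<close>

definition braided_Lie_unit :: "('b, 'k::field) category \<Rightarrow> ('b, 'k) object \<Rightarrow>
    (('b, 'k) vec \<Rightarrow> ('b, 'k) vec) \<Rightarrow> (('b, 'k) vec \<Rightarrow> ('b, 'k) vec) \<Rightarrow>
    (('b, 'k) vec \<Rightarrow> ('b, 'k) vec) \<Rightarrow> (('b, 'k) vec \<Rightarrow> ('b, 'k) vec) \<Rightarrow> bool" where
  "braided_Lie_unit V L \<Delta> \<epsilon> br \<eta> \<longleftrightarrow>
     braided_Lie_hom V \<I>\<^bsub>V\<^esub> (\<lambda>c. one \<otimes> c) id unitl L \<Delta> \<epsilon> br \<eta> \<and>
     (\<forall>z\<in>space L. br (\<eta> one \<otimes> z) = z) \<and>
     (\<forall>z\<in>space L. br (z \<otimes> \<eta> one) = scale (scalar (\<epsilon> z)) (\<eta> one))"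

text \<open>
  The map \<open>\<sigma>\<close> on \<open>ker \<epsilon> \<otimes> ker \<epsilon>\<close> determined by
  \<open>\<Upsilon>(x \<otimes> y) = \<sigma>(x \<otimes> y) + [x,y] \<otimes> \<gamma>\<close>, where \<open>\<gamma> = \<eta>(1)\<close>.
\<close>

definition reduced_braiding :: "('b, 'k::field) category \<Rightarrow> ('b, 'k) object \<Rightarrow>
    (('b, 'k) vec \<Rightarrow> ('b, 'k) vec) \<Rightarrow> (('b, 'k) vec \<Rightarrow> ('b, 'k) vec) \<Rightarrow>
    (('b, 'k) vec \<Rightarrow> ('b, 'k) vec) \<Rightarrow> ('b, 'k) vec \<Rightarrow> ('b, 'k) vec" where
  "reduced_braiding V L \<Delta> br \<eta> x = canonical_braiding V L \<Delta> br x - br x \<otimes> \<eta> one"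

definition good_braided_Lie_algebra :: "('b, 'k::field) category \<Rightarrow> ('b, 'k) object \<Rightarrow>
    (('b, 'k) vec \<Rightarrow> ('b, 'k) vec) \<Rightarrow> (('b, 'k) vec \<Rightarrow> ('b, 'k) vec) \<Rightarrow>
    (('b, 'k) vec \<Rightarrow> ('b, 'k) vec) \<Rightarrow> (('b, 'k) vec \<Rightarrow> ('b, 'k) vec) \<Rightarrow> bool" where
  "good_braided_Lie_algebra V L \<Delta> \<epsilon> br \<eta> \<longleftrightarrow>
     (let K = kernel_on (space L) \<epsilon> in
     braided_Lie_algebra V L \<Delta> \<epsilon> br \<and>
     braided_Lie_unit V L \<Delta> \<epsilon> br \<eta> \<and>
     kernel_on (K \<otimes>\<^sub>S K) (\<lambda>x. x - reduced_braiding V L \<Delta> br \<eta> x) \<subseteq> kernel_on (K \<otimes>\<^sub>S K) br)"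


section \<open>The extension\<close>

text \<open>
  The summand \<open>k\<gamma>\<close> of the extension is the image of the unit object under \<open>inl\<close>, the summand
  \<open>g\<close> the image under \<open>inr\<close>.  The defining equations on elements are the lemmas
  \<open>ext_braiding_simps\<close>, \<open>ext_comult_simps\<close> and \<open>ext_counit_simps\<close>.
\<close>

definition ext_object :: "('b, 'k::field) category \<Rightarrow> ('b, 'k) object \<Rightarrow> ('b, 'k) object" where
  "ext_object V g = \<I>\<^bsub>V\<^esub> \<oplus>\<^bsub>V\<^esub> g"

definition gam :: "('b, 'k::field) vec" ("\<gamma>") where
  "\<gamma> = inl one"

definition ext_braiding :: "(('b, 'k::field) vec \<Rightarrow> ('b, 'k) vec) \<Rightarrow>
    (('b, 'k) vec \<Rightarrow> ('b, 'k) vec) \<Rightarrow> ('b, 'k) vec \<Rightarrow> ('b, 'k) vec" where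
  "ext_braiding \<sigma> br = lin2 (\<lambda>u v.
     scale (scalar (prl u)) (v \<otimes> \<gamma>) + scale (scalar (prl v)) (\<gamma> \<otimes> inr (prr u)) +
     (inr \<otimes>\<^sub>m inr) (\<sigma> (prr u \<otimes> prr v)) + inr (br (prr u \<otimes> prr v)) \<otimes> \<gamma>)"

definition ext_comult :: "(('b, 'k::field) vec \<Rightarrow> ('b, 'k) vec) \<Rightarrow> ('b, 'k) vec \<Rightarrow> ('b, 'k) vec"
  where
  "ext_comult \<delta> u =
     scale (scalar (prl u)) (\<gamma> \<otimes> \<gamma>) + inr (prr u) \<otimes> \<gamma> + \<gamma> \<otimes> inr (prr u) +
     (inr \<otimes>\<^sub>m inr) (\<delta> (prr u))"

definition ext_counit :: "('b, 'k::field) vec \<Rightarrow> ('b, 'k) vec" where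
  "ext_counit u = scale (scalar (prl u)) one"

definition ext_bracket :: "(('b, 'k::field) vec \<Rightarrow> ('b, 'k) vec) \<Rightarrow>
    (('b, 'k) vec \<Rightarrow> ('b, 'k) vec) \<Rightarrow> ('b, 'k) vec \<Rightarrow> ('b, 'k) vec" where
  "ext_bracket \<sigma> br = unitr \<circ> (id \<otimes>\<^sub>m ext_counit) \<circ> ext_braiding \<sigma> br"

lemma ext_counit_simps:
  "ext_counit \<gamma> = one" "ext_counit (inr x) = 0"
  by (simp_all add: ext_counit_def gam_def)

lemma ext_comult_simps:
  assumes "linear_map \<delta>"
  shows "ext_comult \<delta> \<gamma> = \<gamma> \<otimes> \<gamma>"
    and "ext_comult \<delta> (inr x) = inr x \<otimes> \<gamma> + \<gamma> \<otimes> inr x + (inr \<otimes>\<^sub>m inr) (\<delta> x)"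
  using assms
  by (simp_all add: ext_comult_def gam_def linear_zero' linear_maps)

lemma ext_braiding_tensor:
  assumes "linear_map \<sigma>" "linear_map br"
  shows "ext_braiding \<sigma> br (u \<otimes> v) =
     scale (scalar (prl u)) (v \<otimes> \<gamma>) + scale (scalar (prl v)) (\<gamma> \<otimes> inr (prr u)) +
     (inr \<otimes>\<^sub>m inr) (\<sigma> (prr u \<otimes> prr v)) + inr (br (prr u \<otimes> prr v)) \<otimes> \<gamma>"
  unfolding ext_braiding_def
  by (rule lin2_tensor)
    (auto intro!: linear_mapI simp: linear_add'[OF linear_maps(1)] linear_scale'[OF linear_maps(1)]
      linear_add'[OF linear_maps(8)] linear_scale'[OF linear_maps(8)]
      linear_add'[OF linear_maps(9)] linear_scale'[OF linear_maps(9)]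
      linear_add'[OF linear_maps(10)] linear_scale'[OF linear_maps(10)]
      linear_add'[OF assms(1)] linear_scale'[OF assms(1)]
      linear_add'[OF assms(2)] linear_scale'[OF assms(2)]
      tensor_simps vec.scale_left_distrib vec.scale_right_distrib algebra_simps)

lemma ext_braiding_simps:
  assumes "linear_map \<sigma>" "linear_map br" "z \<in> sum_space unit_space A"
  shows "ext_braiding \<sigma> br (\<gamma> \<otimes> z) = z \<otimes> \<gamma>"
    and "ext_braiding \<sigma> br (z \<otimes> \<gamma>) = \<gamma> \<otimes> z"
    and "ext_braiding \<sigma> br (inr x \<otimes> inr y) =
      (inr \<otimes>\<^sub>m inr) (\<sigma> (x \<otimes> y)) + inr (br (x \<otimes> y)) \<otimes> \<gamma>"
proof -
  obtain c a where "c \<in> unit_space" and z: "z = inl c + inr a"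
    using assms(3) by (auto simp: sum_space_def)
  then obtain k where c: "c = scale k one"
    by (auto simp: unit_space_def vec.span_singleton)
  show "ext_braiding \<sigma> br (\<gamma> \<otimes> z) = z \<otimes> \<gamma>"
    "ext_braiding \<sigma> br (z \<otimes> \<gamma>) = \<gamma> \<otimes> z"
    "ext_braiding \<sigma> br (inr x \<otimes> inr y) =
      (inr \<otimes>\<^sub>m inr) (\<sigma> (x \<otimes> y)) + inr (br (x \<otimes> y)) \<otimes> \<gamma>"
    unfolding ext_braiding_tensor[OF assms(1,2)]
    by (simp_all add: z c gam_def tensor_simps linear_add' linear_scale' linear_zero' linear_maps
        assms)
qed

end

theory Submission
  imports Defs
begin

text \<open>
  Naturality with respect to the two inclusions into \<open>L = k\<gamma> \<oplus> g\<close>, together with the fact that the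
  braiding with the unit object is the flip, determines the braiding of \<open>L \<otimes> L\<close>: it exchanges \<open>\<gamma>\<close>
  with everything and restricts to the braiding of \<open>g \<otimes> g\<close>.  The bracket of \<open>L\<close> satisfies
  \<open>[\<gamma>,z] = z\<close>, \<open>[x,\<gamma>] = 0\<close> and extends the one of \<open>g\<close>.  Hence every axiom of a good braided Lie
  algebra holds automatically on tensors with a factor \<open>\<gamma>\<close>, and on \<open>g\<close> it becomes, after cancelling
  the terms containing \<open>\<gamma>\<close>, one axiom of a good quantum Lie algebra: the equation of the canonical
  braiding with the extended one is (L2'-a), and given this (L1), (L2), (L3) and coassociativity
  correspond to (L1'), (L2'-b), (L3') and coassociativity.
\<close>

section \<open>Linear maps on tensor products\<close>

text \<open>Two points shape the proof. First, the braiding is given only by invertibility,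
  naturality and the hexagon identities, so that its form on the unit object has to be derived.
  Secondly, bracket, comultiplication and counit of \<open>L\<close> are given by formulas on
  elements but have to be morphisms. Each is therefore matched with a sum of composites of known
  morphisms, and (co)actions are computed only for a few building blocks: tensor products of maps,
  unit isomorphisms, inclusions and projections.

  (L1) turns into (L1') because its right side equals [,](id \<otimes> [,])(\<Upsilon> \<otimes>
  id): the comultiplication enters only through the canonical braiding \<Upsilon>, where the
  extended braiding can be substituted.

  Equations are tested on pure tensors, but values such as \<open>\<delta> x\<close> and
  \<open>\<Psi> (x \<otimes> y)\<close> are not pure. Formulas that are applied to such values are
  first proved for an arbitrary element of the tensor space. The inclusion of g \<otimes> g into L
  \<otimes> L has a left inverse, which brings equations back from \<open>L\<close> to
  \<open>g\<close>.\<close>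

named_theorems lin

lemma linear_map_add: "linear_map f \<Longrightarrow> linear_map g \<Longrightarrow> linear_map (\<lambda>u. f u + g u)"
  by (rule linear_mapI) (simp_all add: linear_add' linear_scale' vec.scale_right_distrib)

lemma linear_map_scale: "linear_map f \<Longrightarrow> linear_map (\<lambda>u. scale c (f u))"
  by (rule linear_mapI) (simp_all add: linear_add' linear_scale' vec.scale_right_distrib mult.commute)

lemma linear_map_scalar: "linear_map f \<Longrightarrow> linear_map (\<lambda>u. scale (scalar (f u)) w)"
  by (rule linear_mapI) (simp_all add: linear_add' linear_scale' vec.scale_left_distrib)

lemma linear_map_o: "linear_map f \<Longrightarrow> linear_map g \<Longrightarrow> linear_map (f \<circ> g)"
  unfolding comp_def by (rule linear_map_comp)

lemma linear_ext_comult: "linear_map \<delta> \<Longrightarrow> linear_map (ext_comult \<delta>)"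
  unfolding ext_comult_def
  by (intro linear_map_add linear_map_scalar linear_map_comp[OF linear_tensor(1)]
      linear_map_comp[OF linear_tensor(2)] linear_map_comp[OF linear_maps(8)] linear_maps
      linear_map_comp[OF linear_maps(1)] linear_map_comp[of \<delta> prr])

lemma linear_ext_counit: "linear_map ext_counit"
  unfolding ext_counit_def by (intro linear_map_scalar linear_maps)

lemma linear_ext_braiding: "linear_map (ext_braiding \<sigma> br)"
  unfolding ext_braiding_def by (rule linear_lin2)

lemma linear_middle: "linear_map (middle f)"
  unfolding middle_def by (intro linear_map_o linear_maps)

lemma linear_ext_bracket: "linear_map (ext_bracket \<sigma> br)"
  unfolding ext_bracket_def by (intro linear_map_o linear_maps linear_ext_braiding)

lemma linear_on_side: "linear_map (on_side s f)"
  by (cases s) (simp_all add: linear_maps)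

declare linear_map_add [lin] linear_map_scale [lin] linear_map_scalar [lin] linear_zero_map [lin]
  linear_map_id [lin] linear_maps [lin] linear_map_o [lin] linear_middle [lin]
  linear_ext_counit [lin] linear_ext_braiding [lin] linear_ext_bracket [lin] linear_on_side [lin]
  linear_map_comp[OF linear_tensor(1), lin] linear_map_comp[OF linear_tensor(2), lin]
  linear_map_comp[OF linear_maps(1), lin] linear_map_comp[OF linear_maps(3), lin]
  linear_map_comp[OF linear_maps(4), lin] linear_map_comp[OF linear_maps(5), lin]
  linear_map_comp[OF linear_maps(6), lin] linear_map_comp[OF linear_maps(7), lin]
  linear_map_comp[OF linear_maps(8), lin] linear_map_comp[OF linear_maps(9), lin]
  linear_map_comp[OF linear_maps(10), lin] linear_map_comp[OF linear_middle, lin]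
  linear_map_comp[OF linear_ext_counit, lin] linear_map_comp[OF linear_ext_braiding, lin]
  linear_map_comp[OF linear_ext_bracket, lin] linear_map_comp[OF linear_on_side, lin]

lemmas linear_structure_maps = linear_maps linear_map_id linear_zero_map linear_ext_counit
  linear_ext_braiding linear_ext_bracket linear_on_side linear_middle

lemmas tensor_eval = tensor_map_tensor linear_structure_maps assocr_tensor assocl_tensor flip_tensor
  unit_tensor

section \<open>Reduction of identities and memberships to pure tensors\<close>

lemma eq_on_span:
  assumes "linear_map f" "linear_map g" "\<And>x. x \<in> S \<Longrightarrow> f x = g x" "x \<in> vec.span S"
  shows "f x = g x"
  using assms(4)
proof (induction rule: vec.span_induct_alt)
  case base then show ?case by (simp add: linear_zero' assms(1,2))
next
  case (step c x y) then show ?case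
    by (simp add: linear_add'[OF assms(1)] linear_add'[OF assms(2)] linear_scale'[OF assms(1)]
        linear_scale'[OF assms(2)] assms(3))
qed

text \<open>The tensor product of two subspaces is by definition a span of pure tensors. Almost
  every identity below is reduced by this rule, often with a composite value such as
  \<open>comult H h\<close> in the role of \<open>x\<close>.\<close>

lemma tensor_eqI:
  assumes "x \<in> A \<otimes>\<^sub>S B" "linear_map f" "linear_map g"
    "\<And>a b. a \<in> A \<Longrightarrow> b \<in> B \<Longrightarrow> f (a \<otimes> b) = g (a \<otimes> b)"
  shows "f x = g x"
  by (rule eq_on_span[OF assms(2,3) _ assms(1)[unfolded tensor_space_def]]) (use assms(4) in auto)

lemma tensor_in: "a \<in> A \<Longrightarrow> b \<in> B \<Longrightarrow> a \<otimes> b \<in> A \<otimes>\<^sub>S B"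
  unfolding tensor_space_def by (rule vec.span_base) blast

lemma subspace_tensor: "vec.subspace (A \<otimes>\<^sub>S B)"
  unfolding tensor_space_def by simp

lemma tensor_memI:
  assumes "x \<in> A \<otimes>\<^sub>S B" "linear_map f" "vec.subspace C"
    "\<And>a b. a \<in> A \<Longrightarrow> b \<in> B \<Longrightarrow> f (a \<otimes> b) \<in> C"
  shows "f x \<in> C"
  using assms(1) unfolding tensor_space_def
proof (induction rule: vec.span_induct_alt)
  case base then show ?case by (simp add: linear_zero' assms(2) vec.subspace_0 assms(3))
next
  case (step c x y) then show ?case
    using assms(4)
    by (auto simp: linear_add'[OF assms(2)] linear_scale'[OF assms(2)] intro!: vec.subspace_add
        vec.subspace_scale assms(3))
qed

lemma tensor_map_in:
  assumes "linear_map f" "linear_map g" "f ` A \<subseteq> C" "g ` B \<subseteq> D" "x \<in> A \<otimes>\<^sub>S B"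
  shows "(f \<otimes>\<^sub>m g) x \<in> C \<otimes>\<^sub>S D"
  by (rule tensor_memI[OF assms(5) linear_maps(1) subspace_tensor])
    (use assms in \<open>auto simp: tensor_eval intro!: tensor_in\<close>)

lemma tensor_map_tensor_map:
  assumes "linear_map f" "linear_map g" "linear_map f'" "linear_map g'" "x \<in> A \<otimes>\<^sub>S B"
  shows "(f \<otimes>\<^sub>m g) ((f' \<otimes>\<^sub>m g') x) = ((\<lambda>u. f (f' u)) \<otimes>\<^sub>m (\<lambda>u. g (g' u))) x"
  by (rule tensor_eqI[OF assms(5)])
    (use assms in \<open>auto simp: tensor_eval linear_map_comp intro!: lin\<close>)

lemma tensor_map_id: "x \<in> A \<otimes>\<^sub>S B \<Longrightarrow> (id \<otimes>\<^sub>m id) x = x"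
  by (rule tensor_eqI[where g = "\<lambda>u. u"]) (auto simp: tensor_eval intro!: lin)

lemma tensor_map_cong:
  assumes "linear_map f" "linear_map g" "linear_map f'" "linear_map g'" "x \<in> A \<otimes>\<^sub>S B"
    "\<And>a. a \<in> A \<Longrightarrow> f a = f' a" "\<And>b. b \<in> B \<Longrightarrow> g b = g' b"
  shows "(f \<otimes>\<^sub>m g) x = (f' \<otimes>\<^sub>m g') x"
  by (rule tensor_eqI[OF assms(5)]) (use assms in \<open>auto simp: tensor_eval intro!: lin\<close>)

text \<open>Since \<open>unit_space\<close> is a line, every tensor with a leg in it is pure;
  \<open>unitr\<close> recovers the other leg.\<close>

lemma tensor_unit_right:
  fixes x :: "('b, 'k::field) vec"
  assumes "vec.subspace A" "x \<in> A \<otimes>\<^sub>S unit_space"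
  shows "unitr x \<in> A" "x = unitr x \<otimes> one"
proof -
  have *: "\<exists>k. c = scale k one" if "c \<in> unit_space" for c :: "('b, 'k) vec"
    using that by (auto simp: unit_space_def vec.span_singleton)
  show "unitr x \<in> A"
    by (rule tensor_memI[OF assms(2)])
      (use assms(1) in \<open>auto simp: tensor_eval vec.subspace_scale intro!: lin\<close>)
  show "x = unitr x \<otimes> one"
    by (rule tensor_eqI[OF assms(2), where f = "\<lambda>u. u"])
      (auto simp: tensor_eval tensor_simps dest!: * intro!: lin)
qed

text \<open>\<open>f (b \<otimes> c)\<close> need not be a pure tensor, so the reassociations around
  it stay unevaluated.\<close>

lemma middle_tensor:
  "linear_map f \<Longrightarrow> middle f ((a \<otimes> b) \<otimes> (c \<otimes> d)) = assocl (a \<otimes> assocr (f (b \<otimes> c) \<otimes> d))"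
  unfolding middle_def by (simp add: tensor_eval linear_map_o)

lemma middle_flip: "middle flip ((a \<otimes> b) \<otimes> (c \<otimes> d)) = (a \<otimes> c) \<otimes> (b \<otimes> d)"
  by (simp add: middle_tensor tensor_eval)

lemma tensor3_eqI:
  assumes "x \<in> A \<otimes>\<^sub>S (B \<otimes>\<^sub>S C)" "linear_map f" "linear_map g"
    "\<And>a b c. a \<in> A \<Longrightarrow> b \<in> B \<Longrightarrow> c \<in> C \<Longrightarrow> f (a \<otimes> (b \<otimes> c)) = g (a \<otimes> (b \<otimes> c))"
  shows "f x = g x"
proof (rule tensor_eqI[OF assms(1-3)])
  fix a y assume a: "a \<in> A" and y: "y \<in> B \<otimes>\<^sub>S C"
  show "f (a \<otimes> y) = g (a \<otimes> y)"
    by (rule tensor_eqI[OF y linear_map_comp[OF assms(2) linear_tensor(2)]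
          linear_map_comp[OF assms(3) linear_tensor(2)]]) (rule assms(4)[OF a])
qed

lemma tensor3_eqI':
  assumes "x \<in> (A \<otimes>\<^sub>S B) \<otimes>\<^sub>S C" "linear_map f" "linear_map g"
    "\<And>a b c. a \<in> A \<Longrightarrow> b \<in> B \<Longrightarrow> c \<in> C \<Longrightarrow> f ((a \<otimes> b) \<otimes> c) = g ((a \<otimes> b) \<otimes> c)"
  shows "f x = g x"
proof (rule tensor_eqI[OF assms(1-3)])
  fix a y assume a: "a \<in> C" and y: "y \<in> A \<otimes>\<^sub>S B"
  show "f (y \<otimes> a) = g (y \<otimes> a)"
    by (rule tensor_eqI[OF y linear_map_comp[OF assms(2) linear_tensor(1)]
          linear_map_comp[OF assms(3) linear_tensor(1)]]) (rule assms(4)[OF _ _ a])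
qed

lemma assoc_in:
  "w \<in> A \<otimes>\<^sub>S (B \<otimes>\<^sub>S C) \<Longrightarrow> assocl w \<in> (A \<otimes>\<^sub>S B) \<otimes>\<^sub>S C"
  "w \<in> (A \<otimes>\<^sub>S B) \<otimes>\<^sub>S C \<Longrightarrow> assocr w \<in> A \<otimes>\<^sub>S (B \<otimes>\<^sub>S C)"
proof -
  show "assocl w \<in> (A \<otimes>\<^sub>S B) \<otimes>\<^sub>S C" if w: "w \<in> A \<otimes>\<^sub>S (B \<otimes>\<^sub>S C)"
  proof (rule tensor_memI[OF w linear_maps(4) subspace_tensor])
    fix a y assume a: "a \<in> A" and y: "y \<in> B \<otimes>\<^sub>S C"
    show "assocl (a \<otimes> y) \<in> (A \<otimes>\<^sub>S B) \<otimes>\<^sub>S C"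
      by (rule tensor_memI[OF y _ subspace_tensor]) (use a in \<open>auto simp: tensor_eval intro!: lin tensor_in\<close>)
  qed
  show "assocr w \<in> A \<otimes>\<^sub>S (B \<otimes>\<^sub>S C)" if w: "w \<in> (A \<otimes>\<^sub>S B) \<otimes>\<^sub>S C"
  proof (rule tensor_memI[OF w linear_maps(3) subspace_tensor])
    fix a y assume a: "a \<in> C" and y: "y \<in> A \<otimes>\<^sub>S B"
    show "assocr (y \<otimes> a) \<in> A \<otimes>\<^sub>S (B \<otimes>\<^sub>S C)"
      by (rule tensor_memI[OF y _ subspace_tensor]) (use a in \<open>auto simp: tensor_eval intro!: lin tensor_in\<close>)
  qed
qed

lemma unit_spaceD: "c \<in> unit_space \<Longrightarrow> scale (scalar c) one = c"
  by (auto simp: unit_space_def vec.span_singleton)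

lemma one_in: "one \<in> unit_space"
  by (simp add: unit_space_def vec.span_base)

lemma inr_inj: "inr x = inr y \<longleftrightarrow> x = y"
  using prr_inr by metis

section \<open>Actions and coactions\<close>

lemma on_side_in:
  "linear_map f \<Longrightarrow> f ` A \<subseteq> B \<Longrightarrow> x \<in> with_H s H A \<Longrightarrow> on_side s f x \<in> with_H s H B"
  by (cases s) (auto elim!: tensor_map_in[rotated -1] simp: linear_map_id)

lemma on_side_comp:
  "linear_map f \<Longrightarrow> linear_map g \<Longrightarrow> x \<in> with_H s H A \<Longrightarrow>
    on_side s f (on_side s g x) = on_side s (\<lambda>u. f (g u)) x"
  by (cases s) (auto simp: tensor_map_tensor_map linear_map_id id_def)

lemma on_side_cong:
  "linear_map f \<Longrightarrow> linear_map g \<Longrightarrow> x \<in> with_H s H A \<Longrightarrow> (\<And>a. a \<in> A \<Longrightarrow> f a = g a) \<Longrightarrow>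
    on_side s f x = on_side s g x"
  by (cases s) (auto intro!: tensor_map_cong simp: linear_map_id)

lemma on_side_id: "x \<in> with_H s H A \<Longrightarrow> on_side s (\<lambda>u. u) x = x"
  by (cases s) (auto simp: tensor_map_id simp flip: id_def)

lemma on_side_add:
  assumes "linear_map f" "linear_map g" "x \<in> with_H s H A"
  shows "on_side s (\<lambda>u. f u + g u) x = on_side s f x + on_side s g x"
proof (cases s)
  case Left
  then have "x \<in> hspace H \<otimes>\<^sub>S A" using assms by simp
  then have "(id \<otimes>\<^sub>m (\<lambda>u. f u + g u)) x = (id \<otimes>\<^sub>m f) x + (id \<otimes>\<^sub>m g) x"
    by (rule tensor_eqI) (use assms in \<open>auto simp: tensor_eval tensor_simps linear_map_add intro!: lin\<close>)
  then show ?thesis by (simp add: Left)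
next
  case Right
  then have "x \<in> A \<otimes>\<^sub>S hspace H" using assms by simp
  then have "((\<lambda>u. f u + g u) \<otimes>\<^sub>m id) x = (f \<otimes>\<^sub>m id) x + (g \<otimes>\<^sub>m id) x"
    by (rule tensor_eqI) (use assms in \<open>auto simp: tensor_eval tensor_simps linear_map_add intro!: lin\<close>)
  then show ?thesis by (simp add: Right)
qed

lemma on_side_zero:
  assumes "x \<in> with_H s H A"
  shows "on_side s (\<lambda>u. 0) x = 0"
proof (cases s)
  case Left
  then have "x \<in> hspace H \<otimes>\<^sub>S A" using assms by simp
  then have "(id \<otimes>\<^sub>m (\<lambda>u. 0)) x = 0"
    by (rule tensor_eqI) (use assms in \<open>auto simp: tensor_eval intro!: lin\<close>)
  then show ?thesis by (simp add: Left)
next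
  case Right
  then have "x \<in> A \<otimes>\<^sub>S hspace H" using assms by simp
  then have "((\<lambda>u. 0) \<otimes>\<^sub>m id) x = 0"
    by (rule tensor_eqI) (use assms in \<open>auto simp: tensor_eval intro!: lin\<close>)
  then show ?thesis by (simp add: Right)
qed

lemma is_module_D:
  assumes "is_module s H A"
  shows "vec.subspace (space A)" "linear_map (act A)"
    "x \<in> with_H s H (space A) \<Longrightarrow> act A x \<in> space A"
  using assms by (cases s; auto)+

lemma is_comodule_D:
  assumes "is_comodule s H A"
  shows "vec.subspace (space A)" "linear_map (coact A)"
    "x \<in> space A \<Longrightarrow> coact A x \<in> with_H s H (space A)"
  using assms by (cases s; auto)+

lemma bialgebra_D:
  assumes "bialgebra H"
  shows "linear_map (comult H)" "linear_map (mult H)" "linear_map (counit H)"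
    "x \<in> hspace H \<Longrightarrow> comult H x \<in> hspace H \<otimes>\<^sub>S hspace H"
    "x \<in> hspace H \<Longrightarrow> unitl ((counit H \<otimes>\<^sub>m id) (comult H x)) = x"
    "x \<in> hspace H \<Longrightarrow> unitr ((id \<otimes>\<^sub>m counit H) (comult H x)) = x"
    "x \<in> hspace H \<Longrightarrow> mult H (unit H \<otimes> x) = x"
    "x \<in> hspace H \<Longrightarrow> mult H (x \<otimes> unit H) = x"
  using assms unfolding bialgebra_def algebra_def coalgebra_def by auto

lemma tensor_object_space: "space (tensor_object s H A B) = space A \<otimes>\<^sub>S space B"
  by (cases s) auto

lemma unit_object_space: "space (unit_object s H) = unit_space"
  by (cases s) auto

lemma sum_object_space: "space (sum_object s A B) = sum_space (space A) (space B)"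
  by (auto simp: sum_object_def)

text \<open>On \<open>h \<otimes> (a \<otimes> b)\<close> both sides are linear in
  \<open>comult H h\<close>. Replacing it by a pure tensor of two bialgebra elements splits the
  claim into the equivariance of \<open>f\<close> at the first and of \<open>g\<close> at the
  second.\<close>

lemma commutes_act_tensor:
  assumes H: "bialgebra H"
    and m: "is_module s H A" "is_module s H A'" "is_module s H B" "is_module s H B'"
    and f: "linear_map f" "commutes_act s H A A' f"
    and g: "linear_map g" "commutes_act s H B B' g"
  shows "commutes_act s H (tensor_object s H A B) (tensor_object s H A' B') (f \<otimes>\<^sub>m g)"
  unfolding commutes_act_def
proof
  fix x assume x: "x \<in> with_H s H (space (tensor_object s H A B))"
  note l [lin] = m[THEN is_module_D(2)] bialgebra_D(1,2,3)[OF H]  f(1) g(1)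
  note lc [lin] = l[THEN linear_map_comp]
  note [simp] = l
  show "(f \<otimes>\<^sub>m g) (act (tensor_object s H A B) x) =
      act (tensor_object s H A' B') (on_side s (f \<otimes>\<^sub>m g) x)"
  proof (cases s)
    case Left
    note s = Left
    let ?l = "\<lambda>u. (f \<otimes>\<^sub>m g) (act (tensor_object s H A B) u)"
    let ?r = "\<lambda>u. act (tensor_object s H A' B') (on_side s (f \<otimes>\<^sub>m g) u)"
    have lf: "linear_map ?l" "linear_map ?r"
      by (auto simp: s intro!: lin)
    have **: "?l (h \<otimes> (a \<otimes> b)) = ?r (h \<otimes> (a \<otimes> b))" if "h \<in> hspace H" "a \<in> space A" "b \<in> space B" for h a b
    proof -
      have "comult H h \<in> hspace H \<otimes>\<^sub>S hspace H" using bialgebra_D(4)[OF H that(1)] .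
      then have "(f \<otimes>\<^sub>m g) ((act A \<otimes>\<^sub>m act B) (middle flip (comult H h \<otimes> (a \<otimes> b)))) =
          (act A' \<otimes>\<^sub>m act B') (middle flip (comult H h \<otimes> (f a \<otimes> g b)))"
        by (rule tensor_eqI)
          (use f(2) g(2) that in \<open>auto simp: tensor_eval middle_flip commutes_act_def s tensor_in intro!: lin\<close>)
      then show ?thesis by (simp add: s tensor_eval)
    qed
    have *: "?l (h \<otimes> v) = ?r (h \<otimes> v)" if "h \<in> hspace H" "v \<in> space A \<otimes>\<^sub>S space B" for h v
      by (rule tensor_eqI[OF that(2) linear_map_comp[OF lf(1) linear_tensor(2)]
            linear_map_comp[OF lf(2) linear_tensor(2)]]) (rule **[OF that(1)])
    have "x \<in> hspace H \<otimes>\<^sub>S (space A \<otimes>\<^sub>S space B)"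
      using x by (simp add: s)
    from this lf * show ?thesis by (rule tensor_eqI)
  next
    case Right
    note s = Right
    let ?l = "\<lambda>u. (f \<otimes>\<^sub>m g) (act (tensor_object s H A B) u)"
    let ?r = "\<lambda>u. act (tensor_object s H A' B') (on_side s (f \<otimes>\<^sub>m g) u)"
    have lf: "linear_map ?l" "linear_map ?r"
      by (auto simp: s intro!: lin)
    have **: "?l ((a \<otimes> b) \<otimes> h) = ?r ((a \<otimes> b) \<otimes> h)" if "h \<in> hspace H" "a \<in> space A" "b \<in> space B" for h a b
    proof -
      have "comult H h \<in> hspace H \<otimes>\<^sub>S hspace H" using bialgebra_D(4)[OF H that(1)] .
      then have "(f \<otimes>\<^sub>m g) ((act A \<otimes>\<^sub>m act B) (middle flip ((a \<otimes> b) \<otimes> comult H h))) =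
          (act A' \<otimes>\<^sub>m act B') (middle flip ((f a \<otimes> g b) \<otimes> comult H h))"
        by (rule tensor_eqI)
          (use f(2) g(2) that in \<open>auto simp: tensor_eval middle_flip commutes_act_def s tensor_in intro!: lin\<close>)
      then show ?thesis by (simp add: s tensor_eval)
    qed
    have *: "?l (v \<otimes> h) = ?r (v \<otimes> h)" if "v \<in> space A \<otimes>\<^sub>S space B" "h \<in> hspace H" for h v
      by (rule tensor_eqI[OF that(1) linear_map_comp[OF lf(1) linear_tensor(1)]
            linear_map_comp[OF lf(2) linear_tensor(1)]]) (rule **[OF that(2)])
    have "x \<in> (space A \<otimes>\<^sub>S space B) \<otimes>\<^sub>S hspace H"
      using x by (simp add: s)
    from this lf * show ?thesis by (rule tensor_eqI)
  qed
qed

text \<open>Once the coactions at \<open>f a\<close> and \<open>g b\<close> are expressed through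
  those at \<open>a\<close> and \<open>b\<close>, the claim is that \<open>f\<close> and
  \<open>g\<close> act on the object legs while \<open>mult H\<close> acts on the bialgebra legs.
  This is shown for arbitrary tensors \<open>p\<close>, \<open>q\<close> in place of the two
  coactions.\<close>

lemma commutes_coact_tensor:
  assumes H: "bialgebra H"
    and m: "is_comodule s H A" "is_comodule s H A'" "is_comodule s H B" "is_comodule s H B'"
    and f: "linear_map f" "commutes_coact s A A' f"
    and g: "linear_map g" "commutes_coact s B B' g"
  shows "commutes_coact s (tensor_object s H A B) (tensor_object s H A' B') (f \<otimes>\<^sub>m g)"
  unfolding commutes_coact_def
proof
  fix x assume x: "x \<in> space (tensor_object s H A B)"
  note l [lin] = m[THEN is_comodule_D(2)] bialgebra_D(1,2,3)[OF H]  f(1) g(1)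
  note lc [lin] = l[THEN linear_map_comp]
  note [simp] = l
  let ?l = "\<lambda>u. on_side s (f \<otimes>\<^sub>m g) (coact (tensor_object s H A B) u)"
  let ?r = "\<lambda>u. coact (tensor_object s H A' B') ((f \<otimes>\<^sub>m g) u)"
  have x: "x \<in> space A \<otimes>\<^sub>S space B"
    using x by (simp add: tensor_object_space)
  then show "?l x = ?r x"
  proof (rule tensor_eqI)
    show lf: "linear_map ?l" "linear_map ?r"
      by (cases s; auto intro!: lin)+
    fix a b assume ab: "a \<in> space A" "b \<in> space B"
    have co: "coact A' (f a) = on_side s f (coact A a)" "coact B' (g b) = on_side s g (coact B b)"
      using f(2) g(2) ab by (auto simp: commutes_coact_def)
    have mem: "coact A a \<in> with_H s H (space A)" "coact B b \<in> with_H s H (space B)"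
      using m ab by (auto dest: is_comodule_D(3))
    show "?l (a \<otimes> b) = ?r (a \<otimes> b)"
    proof (cases s)
      case Left
      have "(id \<otimes>\<^sub>m (f \<otimes>\<^sub>m g)) ((mult H \<otimes>\<^sub>m id) (middle flip (p \<otimes> q))) =
        (mult H \<otimes>\<^sub>m id) (middle flip ((id \<otimes>\<^sub>m f) p \<otimes> (id \<otimes>\<^sub>m g) q))"
        if "p \<in> hspace H \<otimes>\<^sub>S space A" "q \<in> hspace H \<otimes>\<^sub>S space B" for p q
      proof (rule tensor_eqI[OF that(1)])
        fix h a
        show "(id \<otimes>\<^sub>m (f \<otimes>\<^sub>m g)) ((mult H \<otimes>\<^sub>m id) (middle flip ((h \<otimes> a) \<otimes> q))) =
        (mult H \<otimes>\<^sub>m id) (middle flip ((id \<otimes>\<^sub>m f) (h \<otimes> a) \<otimes> (id \<otimes>\<^sub>m g) q))"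
          by (rule tensor_eqI[OF that(2)]) (auto simp: tensor_eval middle_flip intro!: lin)
      qed (auto intro!: lin)
      then show ?thesis using mem by (simp add: Left tensor_eval co)
    next
      case Right
      have "((f \<otimes>\<^sub>m g) \<otimes>\<^sub>m id) ((id \<otimes>\<^sub>m mult H) (middle flip (p \<otimes> q))) =
        (id \<otimes>\<^sub>m mult H) (middle flip ((f \<otimes>\<^sub>m id) p \<otimes> (g \<otimes>\<^sub>m id) q))"
        if "p \<in> space A \<otimes>\<^sub>S hspace H" "q \<in> space B \<otimes>\<^sub>S hspace H" for p q
      proof (rule tensor_eqI[OF that(1)])
        fix a h
        show "((f \<otimes>\<^sub>m g) \<otimes>\<^sub>m id) ((id \<otimes>\<^sub>m mult H) (middle flip ((a \<otimes> h) \<otimes> q))) =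
        (id \<otimes>\<^sub>m mult H) (middle flip ((f \<otimes>\<^sub>m id) (a \<otimes> h) \<otimes> (g \<otimes>\<^sub>m id) q))"
          by (rule tensor_eqI[OF that(2)]) (auto simp: tensor_eval middle_flip intro!: lin)
      qed (auto intro!: lin)
      then show ?thesis using mem by (simp add: Right tensor_eval co)
    qed
  qed
qed

text \<open>The bialgebra acts on the unit object through the counit. The diagonal action on
  \<open>c \<otimes> v\<close> therefore becomes the action of one leg of \<open>comult H h\<close>
  weighted by the counit of the other, which is the action of \<open>h\<close> itself: by the left
  counit law for \<open>unitl\<close>, by the right one for \<open>unitr\<close>.\<close>

lemma commutes_act_unitors:
  assumes H: "bialgebra H" and m: "is_module s H A"
  shows "commutes_act s H (tensor_object s H (unit_object s H) A) A unitl"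
    and "commutes_act s H (tensor_object s H A (unit_object s H)) A unitr"
proof -
  note l [lin, simp] = is_module_D(2)[OF m] bialgebra_D(1,2,3)[OF H]
  note lc [lin] = l[THEN linear_map_comp]
  note ev = tensor_eval lin middle_flip tensor_simps linear_map_o linear_scale'[OF is_module_D(2)[OF m]]
    linear_scale'[OF linear_maps(5)] linear_scale'[OF linear_maps(6)] mult.commute
  have mem: "comult H h \<in> hspace H \<otimes>\<^sub>S hspace H" if "h \<in> hspace H" for h
    using bialgebra_D(4)[OF H that] .
  show "commutes_act s H (tensor_object s H (unit_object s H) A) A unitl"
  proof (cases s)
    case Left
    have "unitl (act (tensor_object s H (unit_object s H) A) x) = act A (on_side s unitl x)"
      if x: "x \<in> hspace H \<otimes>\<^sub>S (unit_space \<otimes>\<^sub>S space A)" for x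
    proof (rule tensor3_eqI[OF x])
      fix h c v assume h: "h \<in> hspace H"
      have "unitl (((unitl \<circ> (counit H \<otimes>\<^sub>m id)) \<otimes>\<^sub>m act A) (middle flip (comult H h \<otimes> (c \<otimes> v)))) =
          act A (unitl ((counit H \<otimes>\<^sub>m id) (comult H h)) \<otimes> scale (scalar c) v)"
        by (rule tensor_eqI[OF mem[OF h]]; (intro lin | simp add: ev))
      then show "unitl (act (tensor_object s H (unit_object s H) A) (h \<otimes> c \<otimes> v)) =
          act A (on_side s unitl (h \<otimes> c \<otimes> v))"
        using bialgebra_D(5)[OF H h] by (simp add: Left ev)
    qed (auto simp: Left intro!: lin)
    then show ?thesis by (simp add: commutes_act_def Left)
  next
    case Right
    have "unitl (act (tensor_object s H (unit_object s H) A) x) = act A (on_side s unitl x)"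
      if x: "x \<in> (unit_space \<otimes>\<^sub>S space A) \<otimes>\<^sub>S hspace H" for x
    proof (rule tensor3_eqI'[OF x])
      fix h c v assume h: "h \<in> hspace H"
      have "unitl (((unitr \<circ> (id \<otimes>\<^sub>m counit H)) \<otimes>\<^sub>m act A) (middle flip ((c \<otimes> v) \<otimes> comult H h))) =
          act A (scale (scalar c) v \<otimes> unitl ((counit H \<otimes>\<^sub>m id) (comult H h)))"
        by (rule tensor_eqI[OF mem[OF h]]; (intro lin | simp add: ev))
      then show "unitl (act (tensor_object s H (unit_object s H) A) ((c \<otimes> v) \<otimes> h)) =
          act A (on_side s unitl ((c \<otimes> v) \<otimes> h))"
        using bialgebra_D(5)[OF H h] by (simp add: Right ev)
    qed (auto simp: Right intro!: lin)
    then show ?thesis by (simp add: commutes_act_def Right)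
  qed
  show "commutes_act s H (tensor_object s H A (unit_object s H)) A unitr"
  proof (cases s)
    case Left
    have "unitr (act (tensor_object s H A (unit_object s H)) x) = act A (on_side s unitr x)"
      if x: "x \<in> hspace H \<otimes>\<^sub>S (space A \<otimes>\<^sub>S unit_space)" for x
    proof (rule tensor3_eqI[OF x])
      fix h c v assume h: "h \<in> hspace H"
      have "unitr ((act A \<otimes>\<^sub>m (unitl \<circ> (counit H \<otimes>\<^sub>m id))) (middle flip (comult H h \<otimes> (v \<otimes> c)))) =
          act A (unitr ((id \<otimes>\<^sub>m counit H) (comult H h)) \<otimes> scale (scalar c) v)"
        by (rule tensor_eqI[OF mem[OF h]]; (intro lin | simp add: ev))
      then show "unitr (act (tensor_object s H A (unit_object s H)) (h \<otimes> v \<otimes> c)) =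
          act A (on_side s unitr (h \<otimes> v \<otimes> c))"
        using bialgebra_D(6)[OF H h] by (simp add: Left ev)
    qed (auto simp: Left intro!: lin)
    then show ?thesis by (simp add: commutes_act_def Left)
  next
    case Right
    have "unitr (act (tensor_object s H A (unit_object s H)) x) = act A (on_side s unitr x)"
      if x: "x \<in> (space A \<otimes>\<^sub>S unit_space) \<otimes>\<^sub>S hspace H" for x
    proof (rule tensor3_eqI'[OF x])
      fix h c v assume h: "h \<in> hspace H"
      have "unitr ((act A \<otimes>\<^sub>m (unitr \<circ> (id \<otimes>\<^sub>m counit H))) (middle flip ((v \<otimes> c) \<otimes> comult H h))) =
          act A (scale (scalar c) v \<otimes> unitr ((id \<otimes>\<^sub>m counit H) (comult H h)))"
        by (rule tensor_eqI[OF mem[OF h]]; (intro lin | simp add: ev))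
      then show "unitr (act (tensor_object s H A (unit_object s H)) ((v \<otimes> c) \<otimes> h)) =
          act A (on_side s unitr ((v \<otimes> c) \<otimes> h))"
        using bialgebra_D(6)[OF H h] by (simp add: Right ev)
    qed (auto simp: Right intro!: lin)
    then show ?thesis by (simp add: commutes_act_def Right)
  qed
qed

text \<open>The unit object coacts by \<open>unit H\<close>, so the product formed in the coaction
  of the tensor product is a product with the unit element: from the left for \<open>unitl\<close>,
  from the right for \<open>unitr\<close>.\<close>

lemma commutes_coact_unitors:
  assumes H: "bialgebra H" and m: "is_comodule s H A"
  shows "commutes_coact s (tensor_object s H (unit_object s H) A) A unitl"
    and "commutes_coact s (tensor_object s H A (unit_object s H)) A unitr"
proof -
  note l [lin, simp] = is_comodule_D(2)[OF m] bialgebra_D(2)[OF H]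
  note lc [lin] = l[THEN linear_map_comp]
  have u: "linear_map (\<lambda>c. scale (scalar c) w)" for w :: "('a, 'b) vec"
    by (intro lin)
  note ev = tensor_eval lin middle_flip tensor_simps linear_map_o u linear_scale'[OF is_comodule_D(2)[OF m]]
    linear_scale'[OF linear_maps(1)] linear_scale'[OF linear_middle]
    bialgebra_D(7,8)[OF H]
  have mem: "coact A v \<in> with_H s H (space A)" if "v \<in> space A" for v
    using is_comodule_D(3)[OF m that] .
  show "commutes_coact s (tensor_object s H (unit_object s H) A) A unitl"
    unfolding commutes_coact_def tensor_object_space unit_object_space
  proof
    fix x :: "('a, 'b) vec"
    assume x: "x \<in> unit_space \<otimes>\<^sub>S space A"
    show "on_side s unitl (coact (tensor_object s H (unit_object s H) A) x) = coact A (unitl x)"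
    proof (rule tensor_eqI[OF x])
      fix c v assume v: "v \<in> space A"
      show "on_side s unitl (coact (tensor_object s H (unit_object s H) A) (c \<otimes> v)) =
          coact A (unitl (c \<otimes> v))"
      proof (cases s)
        case Left
        have "coact A v \<in> hspace H \<otimes>\<^sub>S space A" using mem[OF v] by (simp add: Left)
        then have "(id \<otimes>\<^sub>m unitl) ((mult H \<otimes>\<^sub>m id) (middle flip
            ((scale (scalar c) (unit H \<otimes> one)) \<otimes> coact A v))) = scale (scalar c) (coact A v)"
          by (rule tensor_eqI) (auto simp: ev intro!: lin)
        then show ?thesis by (simp add: Left ev)
      next
        case Right
        have "coact A v \<in> space A \<otimes>\<^sub>S hspace H" using mem[OF v] by (simp add: Right)
        then have "(unitl \<otimes>\<^sub>m id) ((id \<otimes>\<^sub>m mult H) (middle flip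
            ((scale (scalar c) (one \<otimes> unit H)) \<otimes> coact A v))) = scale (scalar c) (coact A v)"
          by (rule tensor_eqI) (auto simp: ev intro!: lin)
        then show ?thesis by (simp add: Right ev)
      qed
    qed (cases s; auto intro!: lin)+
  qed
  show "commutes_coact s (tensor_object s H A (unit_object s H)) A unitr"
    unfolding commutes_coact_def tensor_object_space unit_object_space
  proof
    fix x :: "('a, 'b) vec"
    assume x: "x \<in> space A \<otimes>\<^sub>S unit_space"
    show "on_side s unitr (coact (tensor_object s H A (unit_object s H)) x) = coact A (unitr x)"
    proof (rule tensor_eqI[OF x])
      fix c v assume v: "v \<in> space A"
      show "on_side s unitr (coact (tensor_object s H A (unit_object s H)) (v \<otimes> c)) =
          coact A (unitr (v \<otimes> c))"
      proof (cases s)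
        case Left
        have "coact A v \<in> hspace H \<otimes>\<^sub>S space A" using mem[OF v] by (simp add: Left)
        then have "(id \<otimes>\<^sub>m unitr) ((mult H \<otimes>\<^sub>m id) (middle flip
            (coact A v \<otimes> (scale (scalar c) (unit H \<otimes> one))))) = scale (scalar c) (coact A v)"
          by (rule tensor_eqI) (auto simp: ev intro!: lin)
        then show ?thesis by (simp add: Left ev)
      next
        case Right
        have "coact A v \<in> space A \<otimes>\<^sub>S hspace H" using mem[OF v] by (simp add: Right)
        then have "(unitr \<otimes>\<^sub>m id) ((id \<otimes>\<^sub>m mult H) (middle flip
            (coact A v \<otimes> (scale (scalar c) (one \<otimes> unit H))))) = scale (scalar c) (coact A v)"
          by (rule tensor_eqI) (auto simp: ev intro!: lin)
        then show ?thesis by (simp add: Right ev)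
      qed
    qed (cases s; auto intro!: lin)+
  qed
qed

section \<open>Morphisms\<close>

locale braided_category =
  fixes V :: "('b, 'k::field) category"
  assumes braided: "braided_monoidal_category V"
begin

abbreviation H where "H \<equiv> over V"
abbreviation s where "s \<equiv> side_of V"

lemma bialg: "bialgebra H"
  using braided unfolding braided_monoidal_category_def by blast

lemma Obj_closed:
  "\<I>\<^bsub>V\<^esub> \<in> Obj V"
  "A \<in> Obj V \<Longrightarrow> B \<in> Obj V \<Longrightarrow> A \<odot>\<^bsub>V\<^esub> B \<in> Obj V"
  "A \<in> Obj V \<Longrightarrow> B \<in> Obj V \<Longrightarrow> A \<oplus>\<^bsub>V\<^esub> B \<in> Obj V"
  using braided unfolding braided_monoidal_category_def closed_class_def by auto

lemma Obj_is_object: "A \<in> Obj V \<Longrightarrow> is_object (sort_of V) s H A"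
  using braided unfolding braided_monoidal_category_def closed_class_def by auto

lemma Obj_D:
  assumes "A \<in> Obj V"
  shows "sort_of V \<in> {Module, Crossed} \<Longrightarrow> is_module s H A"
    "sort_of V \<in> {Comodule, Crossed} \<Longrightarrow> is_comodule s H A"
    "vec.subspace (space A)"
  using Obj_is_object[OF assms]
  by (cases "sort_of V"; auto dest: is_module_D(1) is_comodule_D(1))+

lemma HomD:
  assumes "f \<in> Hom V A B"
  shows "linear_map f" "x \<in> space A \<Longrightarrow> f x \<in> space B"
  using assms by (auto simp: Hom_def)

lemma Hom_act:
  "f \<in> Hom V A B \<Longrightarrow> sort_of V \<in> {Module, Crossed} \<Longrightarrow> x \<in> with_H s H (space A) \<Longrightarrow>
    f (act A x) = act B (on_side s f x)"
  by (auto simp: Hom_def commutes_act_def)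

lemma Hom_coact:
  "f \<in> Hom V A B \<Longrightarrow> sort_of V \<in> {Comodule, Crossed} \<Longrightarrow> v \<in> space A \<Longrightarrow>
    on_side s f (coact A v) = coact B (f v)"
  by (auto simp: Hom_def commutes_coact_def)

text \<open>For plain modules the coaction field is arbitrary, and for plain comodules the action
  field is. The laws of a field are thus supplied to a compatibility goal only under the sorts that
  use this field.\<close>

lemma HomI:
  assumes "A \<in> Obj V" "B \<in> Obj V" "linear_map f" "\<And>x. x \<in> space A \<Longrightarrow> f x \<in> space B"
    "is_module s H A \<Longrightarrow> is_module s H B \<Longrightarrow> sort_of V \<in> {Module, Crossed} \<Longrightarrow> commutes_act s H A B f"
    "is_comodule s H A \<Longrightarrow> is_comodule s H B \<Longrightarrow> sort_of V \<in> {Comodule, Crossed} \<Longrightarrow> commutes_coact s A B f"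
  shows "f \<in> Hom V A B"
  using assms(3-6) Obj_D(1,2)[OF assms(1)] Obj_D(1,2)[OF assms(2)] unfolding Hom_def by blast

lemma Hom_comp:
  assumes ob: "A \<in> Obj V" "B \<in> Obj V" "C \<in> Obj V" and f: "f \<in> Hom V A B" and g: "g \<in> Hom V B C"
  shows "(\<lambda>x. g (f x)) \<in> Hom V A C"
proof (rule HomI[OF ob(1,3)])
  note lin = HomD(1)[OF f] HomD(1)[OF g]
  show "linear_map (\<lambda>x. g (f x))" using lin by (simp add: linear_map_comp)
  show "g (f x) \<in> space C" if "x \<in> space A" for x using HomD(2)[OF g] HomD(2)[OF f] that by blast
  have sub: "f ` space A \<subseteq> space B" using HomD(2)[OF f] by blast
  show "commutes_act s H A C (\<lambda>x. g (f x))" if "sort_of V \<in> {Module, Crossed}"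
    using Hom_act[OF f that] Hom_act[OF g that] on_side_in[OF lin(1) sub] on_side_comp[OF lin(2,1)]
    unfolding commutes_act_def by metis
  show "commutes_coact s A C (\<lambda>x. g (f x))" if m: "is_comodule s H A" and
    "sort_of V \<in> {Comodule, Crossed}"
    using Hom_coact[OF f that(2)] Hom_coact[OF g that(2)] HomD(2)[OF f]
      on_side_comp[OF lin(2,1) is_comodule_D(3)[OF m]]
    unfolding commutes_coact_def by metis
qed

text \<open>Maps are endomaps of the whole universe of which only the values on the source count.
  The (co)action does not leave the source, so agreement there preserves the compatibilities. This
  is how maps given by formulas on elements are recognised as morphisms.\<close>

lemma Hom_cong:
  assumes ob: "A \<in> Obj V" "B \<in> Obj V" and f: "f \<in> Hom V A B" and g: "linear_map g"
    "\<And>x. x \<in> space A \<Longrightarrow> f x = g x"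
  shows "g \<in> Hom V A B"
proof (rule HomI[OF ob])
  note lin = HomD(1)[OF f] g(1)
  show "g x \<in> space B" if "x \<in> space A" for x using HomD(2)[OF f] that g(2) by force
  show "commutes_act s H A B g" if m: "is_module s H A" and "sort_of V \<in> {Module, Crossed}"
    using Hom_act[OF f that(2)] g(2) on_side_cong[OF lin _ g(2)] is_module_D(3)[OF m]
    unfolding commutes_act_def by metis
  show "commutes_coact s A B g" if m: "is_comodule s H A" and "sort_of V \<in> {Comodule, Crossed}"
    using Hom_coact[OF f that(2)] g(2) on_side_cong[OF lin _ g(2)] is_comodule_D(3)[OF m]
    unfolding commutes_coact_def by metis
qed (rule g(1))

lemma Hom_add:
  assumes ob: "A \<in> Obj V" "B \<in> Obj V" and f: "f \<in> Hom V A B" and g: "g \<in> Hom V A B"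
  shows "(\<lambda>x. f x + g x) \<in> Hom V A B"
proof (rule HomI[OF ob])
  note lin = HomD(1)[OF f] HomD(1)[OF g]
  show "linear_map (\<lambda>x. f x + g x)" using lin by (rule linear_map_add)
  show "f x + g x \<in> space B" if "x \<in> space A" for x
    using HomD(2)[OF f] HomD(2)[OF g] that vec.subspace_add[OF Obj_D(3)[OF ob(2)]] by blast
  show "commutes_act s H A B (\<lambda>x. f x + g x)" if m: "is_module s H B" and "sort_of V \<in> {Module, Crossed}"
    unfolding commutes_act_def
    by (auto simp: Hom_act[OF f that(2)] Hom_act[OF g that(2)] on_side_add[OF lin]
      linear_add'[OF is_module_D(2)[OF m]])
  show "commutes_coact s A B (\<lambda>x. f x + g x)" if m: "is_comodule s H A" "is_comodule s H B"
      and "sort_of V \<in> {Comodule, Crossed}"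
    unfolding commutes_coact_def
    by (auto simp: Hom_coact[OF f that(3)] Hom_coact[OF g that(3)]
      on_side_add[OF lin is_comodule_D(3)[OF m(1)]] linear_add'[OF is_comodule_D(2)[OF m(2)]])
qed

text \<open>Yields \<open>\<lambda>v. one \<otimes> v\<close> and
  \<open>\<lambda>v. v \<otimes> one\<close> as morphisms from the unit isomorphisms, with no second
  computation of (co)actions.\<close>

lemma Hom_inverse:
  assumes ob: "A \<in> Obj V" "B \<in> Obj V" and f: "f \<in> Hom V A B" and g: "linear_map g"
    "\<And>y. y \<in> space B \<Longrightarrow> g y \<in> space A"
    "\<And>x. x \<in> space A \<Longrightarrow> g (f x) = x" "\<And>y. y \<in> space B \<Longrightarrow> f (g y) = y"
  shows "g \<in> Hom V B A"
proof (rule HomI[OF ob(2,1)])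
  note lin = HomD(1)[OF f] g(1)
  have sub: "f ` space A \<subseteq> space B" "g ` space B \<subseteq> space A" using HomD(2)[OF f] g(2) by auto
  have fg: "on_side s f (on_side s g y) = y" if "y \<in> with_H s H (space B)" for y
    using on_side_comp[OF lin that] on_side_cong[OF linear_map_comp[OF lin] linear_map_id(2) that g(4)]
      on_side_id[OF that] by simp
  have gf: "on_side s g (on_side s f y) = y" if "y \<in> with_H s H (space A)" for y
    using on_side_comp[OF lin(2,1) that]
      on_side_cong[OF linear_map_comp[OF lin(2,1)] linear_map_id(2) that g(3)]
      on_side_id[OF that] by simp
  show "commutes_act s H B A g" if m: "is_module s H A" and "sort_of V \<in> {Module, Crossed}"
    unfolding commutes_act_def
  proof
    fix y assume y: "y \<in> with_H s H (space B)"
    have *: "on_side s g y \<in> with_H s H (space A)" by (rule on_side_in[OF lin(2) sub(2) y])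
    have "f (act A (on_side s g y)) = act B (on_side s f (on_side s g y))"
      using Hom_act[OF f that(2) *] .
    then have "act B y = f (act A (on_side s g y))" by (simp add: fg[OF y])
    then show "g (act B y) = act A (on_side s g y)"
      using g(3)[OF is_module_D(3)[OF m *]] by simp
  qed
  show "commutes_coact s B A g" if m: "is_comodule s H A" and "sort_of V \<in> {Comodule, Crossed}"
    unfolding commutes_coact_def
  proof
    fix y assume y: "y \<in> space B"
    have "on_side s f (coact A (g y)) = coact B (f (g y))"
      using Hom_coact[OF f that(2) g(2)[OF y]] .
    then show "on_side s g (coact B y) = coact A (g y)"
      using gf[OF is_comodule_D(3)[OF m g(2)[OF y]]] g(4)[OF y] by simp
  qed
qed (use g in auto)

lemma Hom_tensor:
  assumes ob: "A \<in> Obj V" "A' \<in> Obj V" "B \<in> Obj V" "B' \<in> Obj V"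
    and f: "f \<in> Hom V A A'" and g: "g \<in> Hom V B B'"
  shows "f \<otimes>\<^sub>m g \<in> Hom V (A \<odot>\<^bsub>V\<^esub> B) (A' \<odot>\<^bsub>V\<^esub> B')"
proof (rule HomI)
  note lin = HomD(1)[OF f] HomD(1)[OF g]
  show "(f \<otimes>\<^sub>m g) x \<in> space (A' \<odot>\<^bsub>V\<^esub> B')" if "x \<in> space (A \<odot>\<^bsub>V\<^esub> B)" for x
    using that unfolding tensor_object_space
    by (rule tensor_map_in[OF lin, rotated -1]) (use HomD(2)[OF f] HomD(2)[OF g] in auto)
  show "commutes_act s H (A \<odot>\<^bsub>V\<^esub> B) (A' \<odot>\<^bsub>V\<^esub> B') (f \<otimes>\<^sub>m g)"
    if "sort_of V \<in> {Module, Crossed}"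
    using f g that ob[THEN Obj_D(1)[OF _ that]]
    by (intro commutes_act_tensor[OF bialg] lin) (auto simp: Hom_def)
  show "commutes_coact s (A \<odot>\<^bsub>V\<^esub> B) (A' \<odot>\<^bsub>V\<^esub> B') (f \<otimes>\<^sub>m g)"
    if "sort_of V \<in> {Comodule, Crossed}"
    using f g that ob[THEN Obj_D(2)[OF _ that]]
    by (intro commutes_coact_tensor[OF bialg] lin) (auto simp: Hom_def)
qed (use ob in \<open>auto simp: Obj_closed linear_maps\<close>)

lemma Hom_unitors:
  assumes A: "A \<in> Obj V"
  shows "unitl \<in> Hom V (\<I>\<^bsub>V\<^esub> \<odot>\<^bsub>V\<^esub> A) A" "unitr \<in> Hom V (A \<odot>\<^bsub>V\<^esub> \<I>\<^bsub>V\<^esub>) A"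
proof -
  show "unitl \<in> Hom V (\<I>\<^bsub>V\<^esub> \<odot>\<^bsub>V\<^esub> A) A"
  proof (rule HomI)
    show "unitl x \<in> space A" if "x \<in> space (\<I>\<^bsub>V\<^esub> \<odot>\<^bsub>V\<^esub> A)" for x
      using that unfolding tensor_object_space
      by (rule tensor_memI[OF _ _ Obj_D(3)[OF A]])
        (auto simp: unit_tensor linear_maps vec.subspace_scale[OF Obj_D(3)[OF A]])
  qed (auto simp: A Obj_closed commutes_act_unitors[OF bialg] commutes_coact_unitors[OF bialg])
  show "unitr \<in> Hom V (A \<odot>\<^bsub>V\<^esub> \<I>\<^bsub>V\<^esub>) A"
  proof (rule HomI)
    show "unitr x \<in> space A" if "x \<in> space (A \<odot>\<^bsub>V\<^esub> \<I>\<^bsub>V\<^esub>)" for x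
      using that unfolding tensor_object_space
      by (rule tensor_memI[OF _ _ Obj_D(3)[OF A]])
        (auto simp: unit_tensor linear_maps vec.subspace_scale[OF Obj_D(3)[OF A]])
  qed (auto simp: A Obj_closed commutes_act_unitors[OF bialg] commutes_coact_unitors[OF bialg])
qed

lemma Hom_unitors_inverse:
  assumes A: "A \<in> Obj V"
  shows "(\<lambda>v. one \<otimes> v) \<in> Hom V A (\<I>\<^bsub>V\<^esub> \<odot>\<^bsub>V\<^esub> A)" "(\<lambda>v. v \<otimes> one) \<in> Hom V A (A \<odot>\<^bsub>V\<^esub> \<I>\<^bsub>V\<^esub>)"
proof -
  show "(\<lambda>v. one \<otimes> v) \<in> Hom V A (\<I>\<^bsub>V\<^esub> \<odot>\<^bsub>V\<^esub> A)"
  proof (rule Hom_inverse[OF _ _ Hom_unitors(1)[OF A]])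
    show "one \<otimes> unitl x = x" if "x \<in> space (\<I>\<^bsub>V\<^esub> \<odot>\<^bsub>V\<^esub> A)" for x
      using that unfolding tensor_object_space unit_object_space
      by (rule tensor_eqI[where g = "\<lambda>u. u"])
        (auto simp: unit_tensor tensor_simps unit_spaceD simp flip: tensor_scale_left intro!: lin)
  qed (auto simp: A Obj_closed unit_tensor linear_tensor tensor_object_space unit_object_space
      intro!: tensor_in one_in)
  show "(\<lambda>v. v \<otimes> one) \<in> Hom V A (A \<odot>\<^bsub>V\<^esub> \<I>\<^bsub>V\<^esub>)"
  proof (rule Hom_inverse[OF _ _ Hom_unitors(2)[OF A]])
    show "unitr x \<otimes> one = x" if "x \<in> space (A \<odot>\<^bsub>V\<^esub> \<I>\<^bsub>V\<^esub>)" for x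
      using tensor_unit_right(2)[OF Obj_D(3)[OF A]] that
      unfolding tensor_object_space unit_object_space by metis
  qed (auto simp: A Obj_closed unit_tensor linear_tensor tensor_object_space unit_object_space
      intro!: tensor_in one_in)
qed

text \<open>The (co)action of a direct sum has one term for each summand. Composites of a projection
  with an inclusion are the identity or zero, so only the expected term survives.\<close>

lemma Hom_sum:
  assumes ob: "A \<in> Obj V" "B \<in> Obj V"
  shows "inl \<in> Hom V A (A \<oplus>\<^bsub>V\<^esub> B)" "inr \<in> Hom V B (A \<oplus>\<^bsub>V\<^esub> B)"
    "prl \<in> Hom V (A \<oplus>\<^bsub>V\<^esub> B) A" "prr \<in> Hom V (A \<oplus>\<^bsub>V\<^esub> B) B"
proof -
  note l = linear_maps(7,8,9,10)
  note ob' = ob Obj_closed(3)[OF ob]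
  note z = vec.subspace_0[OF Obj_D(3)[OF ob(1)]] vec.subspace_0[OF Obj_D(3)[OF ob(2)]]
  note lz = linear_zero'[OF l(1)] linear_zero'[OF l(2)]
  have in_sum: "inl x \<in> sum_space (space A) (space B)" if "x \<in> space A" for x
    unfolding sum_space_def using that z lz by (intro CollectI exI[of _ x] exI[of _ 0]) simp
  have in_sum': "inr x \<in> sum_space (space A) (space B)" if "x \<in> space B" for x
    unfolding sum_space_def using that z lz by (intro CollectI exI[of _ 0] exI[of _ x]) simp
  have pr_in: "prl x \<in> space A" "prr x \<in> space B" if "x \<in> sum_space (space A) (space B)" for x
    using that by (auto simp: sum_space_def linear_add' l)
  have om: "on_side s f 0 = 0" for f :: "('b, 'k) vec \<Rightarrow> ('b, 'k) vec"
    by (rule linear_zero') (rule linear_on_side)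
  note os = on_side_comp[OF l(3) l(1)] on_side_comp[OF l(4) l(2)] on_side_comp[OF l(4) l(1)]
    on_side_comp[OF l(3) l(2)] on_side_id on_side_zero
  have oadd: "on_side s f (x + y) = on_side s f x + on_side s f y"
    for f x and y :: "('b, 'k) vec" by (rule linear_add'[OF linear_on_side])
  have bz: "act X 0 = 0" if "sort_of V \<in> {Module, Crossed}" "X \<in> Obj V" for X
    using linear_zero'[OF is_module_D(2)[OF Obj_D(1)[OF that(2,1)]]] .
  have cz: "coact X 0 = 0" if "sort_of V \<in> {Comodule, Crossed}" "X \<in> Obj V" for X
    using linear_zero'[OF is_comodule_D(2)[OF Obj_D(2)[OF that(2,1)]]] .
  have cmem: "coact X v \<in> with_H s H (space X)"
    if "sort_of V \<in> {Comodule, Crossed}" "X \<in> Obj V" "v \<in> space X" for X v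
    using is_comodule_D(3)[OF Obj_D(2)[OF that(2,1)] that(3)] .
  show "inl \<in> Hom V A (A \<oplus>\<^bsub>V\<^esub> B)"
    by (rule HomI[OF ob'(1,3) l(1)])
      (auto simp: sum_object_def in_sum commutes_act_def commutes_coact_def os lz om
        bz cz ob os[OF cmem])
  show "inr \<in> Hom V B (A \<oplus>\<^bsub>V\<^esub> B)"
    by (rule HomI[OF ob'(2,3) l(2)])
      (auto simp: sum_object_def in_sum' commutes_act_def commutes_coact_def os lz om
        bz cz ob os[OF cmem])
  show "prl \<in> Hom V (A \<oplus>\<^bsub>V\<^esub> B) A"
    by (rule HomI[OF ob'(3,1) l(3)])
      (auto simp: sum_object_def pr_in commutes_act_def commutes_coact_def linear_add'[OF l(3)]
       oadd os[OF cmem] ob)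
  show "prr \<in> Hom V (A \<oplus>\<^bsub>V\<^esub> B) B"
    by (rule HomI[OF ob'(3,2) l(4)])
      (auto simp: sum_object_def pr_in commutes_act_def commutes_coact_def linear_add'[OF l(4)]
       oadd os[OF cmem] ob)
qed

section \<open>The braiding with the unit object\<close>

lemma Hom_id: "A \<in> Obj V \<Longrightarrow> id \<in> Hom V A A"
  by (rule HomI)
    (auto simp: linear_map_id commutes_act_def commutes_coact_def id_def on_side_id
      on_side_id[OF is_comodule_D(3)])

lemma Psi_Hom: "A \<in> Obj V \<Longrightarrow> B \<in> Obj V \<Longrightarrow> Psi V A B \<in> Hom V (A \<odot>\<^bsub>V\<^esub> B) (B \<odot>\<^bsub>V\<^esub> A)"
  using braided unfolding braided_monoidal_category_def by blast

lemma Psi_linear: "A \<in> Obj V \<Longrightarrow> B \<in> Obj V \<Longrightarrow> linear_map (Psi V A B)"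
  by (rule HomD(1)[OF Psi_Hom])

lemma Psi_in:
  "A \<in> Obj V \<Longrightarrow> B \<in> Obj V \<Longrightarrow> x \<in> space A \<otimes>\<^sub>S space B \<Longrightarrow> Psi V A B x \<in> space B \<otimes>\<^sub>S space A"
  using HomD(2)[OF Psi_Hom] by (simp add: tensor_object_space)

lemma Psi_bij:
  assumes "A \<in> Obj V" "B \<in> Obj V"
  shows "bij_betw (Psi V A B) (space A \<otimes>\<^sub>S space B) (space B \<otimes>\<^sub>S space A)"
proof -
  obtain \<Phi> where \<Phi>: "\<Phi> \<in> Hom V (B \<odot>\<^bsub>V\<^esub> A) (A \<odot>\<^bsub>V\<^esub> B)"
    "\<forall>x\<in>space (A \<odot>\<^bsub>V\<^esub> B). \<Phi> (Psi V A B x) = x" "\<forall>y\<in>space (B \<odot>\<^bsub>V\<^esub> A). Psi V A B (\<Phi> y) = y"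
    using braided assms unfolding braided_monoidal_category_def by blast
  show ?thesis
    by (rule bij_betw_byWitness[where f' = \<Phi>])
      (use \<Phi> HomD(2)[OF \<Phi>(1)] Psi_in[OF assms] in \<open>auto simp: tensor_object_space\<close>)
qed

lemma Psi_natural:
  assumes "A \<in> Obj V" "A' \<in> Obj V" "B \<in> Obj V" "B' \<in> Obj V" "f \<in> Hom V A A'" "h \<in> Hom V B B'"
    "x \<in> space A \<otimes>\<^sub>S space B"
  shows "Psi V A' B' ((f \<otimes>\<^sub>m h) x) = (h \<otimes>\<^sub>m f) (Psi V A B x)"
  using braided assms unfolding braided_monoidal_category_def
  by (simp add: tensor_object_space)

lemma Psi_hexagon:
  assumes "A \<in> Obj V" "B \<in> Obj V" "C \<in> Obj V"
  shows "x \<in> (space A \<otimes>\<^sub>S space B) \<otimes>\<^sub>S space C \<Longrightarrow> Psi V (A \<odot>\<^bsub>V\<^esub> B) C x =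
      (assocr \<circ> (Psi V A C \<otimes>\<^sub>m id) \<circ> assocl \<circ> (id \<otimes>\<^sub>m Psi V B C) \<circ> assocr) x"
    and "x \<in> space A \<otimes>\<^sub>S (space B \<otimes>\<^sub>S space C) \<Longrightarrow> Psi V A (B \<odot>\<^bsub>V\<^esub> C) x =
      (assocl \<circ> (id \<otimes>\<^sub>m Psi V A C) \<circ> assocr \<circ> (Psi V A B \<otimes>\<^sub>m id) \<circ> assocl) x"
  using braided assms unfolding braided_monoidal_category_def
  by (simp_all add: tensor_object_space)

text \<open>
  Identifying \<open>I \<otimes> A\<close> and \<open>A \<otimes> I\<close> with \<open>A\<close>, the braiding with the unit object is an injective map
  \<open>P\<close>; the hexagon identity for \<open>I \<otimes> I\<close> and naturality with respect to \<open>I \<otimes> I \<cong> I\<close> give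
  \<open>P \<circ> P = P\<close>, hence \<open>P = id\<close>.
\<close>

lemma Psi_unit_left:
  assumes A: "A \<in> Obj V" and a: "a \<in> space A"
  shows "Psi V \<I>\<^bsub>V\<^esub> A (one \<otimes> a) = a \<otimes> one"
proof -
  note I = Obj_closed(1)
  note sp = unit_object_space tensor_object_space
  define P where "P a = unitr (Psi V \<I>\<^bsub>V\<^esub> A (one \<otimes> a))" for a
  have mem: "Psi V \<I>\<^bsub>V\<^esub> A (one \<otimes> a) \<in> space A \<otimes>\<^sub>S unit_space" if "a \<in> space A" for a
    using Psi_in[OF I A, of "one \<otimes> a"] that by (simp add: sp tensor_in one_in)
  have P: "Psi V \<I>\<^bsub>V\<^esub> A (one \<otimes> a) = P a \<otimes> one" "P a \<in> space A" if "a \<in> space A" for a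
    using tensor_unit_right[OF Obj_D(3)[OF A] mem[OF that]] by (simp_all add: P_def)
  have l: "linear_map (Psi V \<I>\<^bsub>V\<^esub> A)" by (rule Psi_linear[OF I A])
  have "Psi V \<I>\<^bsub>V\<^esub> A (one \<otimes> a) = Psi V \<I>\<^bsub>V\<^esub> A ((unitl \<otimes>\<^sub>m id) ((one \<otimes> one) \<otimes> a))"
    by (simp add: tensor_eval)
  also have "\<dots> = (id \<otimes>\<^sub>m unitl) (Psi V (\<I>\<^bsub>V\<^esub> \<odot>\<^bsub>V\<^esub> \<I>\<^bsub>V\<^esub>) A ((one \<otimes> one) \<otimes> a))"
    by (rule Psi_natural[OF _ _ _ _ Hom_unitors(1)[OF I] Hom_id[OF A]])
      (auto simp: Obj_closed A sp a intro!: tensor_in one_in)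
  also have "Psi V (\<I>\<^bsub>V\<^esub> \<odot>\<^bsub>V\<^esub> \<I>\<^bsub>V\<^esub>) A ((one \<otimes> one) \<otimes> a) = P (P a) \<otimes> (one \<otimes> one)"
    using P a by (subst Psi_hexagon(1)[OF I I A])
      (auto simp: sp tensor_eval l intro!: tensor_in one_in)
  finally have "P a \<otimes> one = P (P a) \<otimes> one"
    using P(1)[OF a] by (simp add: tensor_eval)
  then have "Psi V \<I>\<^bsub>V\<^esub> A (one \<otimes> a) = Psi V \<I>\<^bsub>V\<^esub> A (one \<otimes> P a)"
    using P a by simp
  then have "one \<otimes> a = one \<otimes> P a"
    using Psi_bij[OF I A] P(2)[OF a] a
    by (auto simp: bij_betw_def sp inj_on_eq_iff tensor_in one_in)
  then have "unitl (one \<otimes> a) = unitl (one \<otimes> P a)" by simp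
  then show ?thesis using P(1)[OF a] by (simp add: tensor_eval)
qed

lemma tensor_unit_left:
  assumes "A \<in> Obj V" "x \<in> unit_space \<otimes>\<^sub>S space A"
  shows "unitl x \<in> space A" "x = one \<otimes> unitl x"
proof -
  show "unitl x \<in> space A"
    using HomD(2)[OF Hom_unitors(1)[OF assms(1)]] assms(2)
    by (simp add: tensor_object_space unit_object_space)
  show "x = one \<otimes> unitl x"
    by (rule tensor_eqI[OF assms(2), where f = "\<lambda>u. u"])
      (auto simp: unit_tensor tensor_simps unit_spaceD simp flip: tensor_scale_left intro!: lin)
qed

text \<open>A priori this component is not the inverse of the preceding one, so the argument is run
  again with the second hexagon identity.\<close>

lemma Psi_unit_right:
  assumes A: "A \<in> Obj V" and a: "a \<in> space A"
  shows "Psi V A \<I>\<^bsub>V\<^esub> (a \<otimes> one) = one \<otimes> a"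
proof -
  note I = Obj_closed(1)
  note sp = unit_object_space tensor_object_space
  define P where "P a = unitl (Psi V A \<I>\<^bsub>V\<^esub> (a \<otimes> one))" for a
  have mem: "Psi V A \<I>\<^bsub>V\<^esub> (a \<otimes> one) \<in> unit_space \<otimes>\<^sub>S space A" if "a \<in> space A" for a
    using Psi_in[OF A I, of "a \<otimes> one"] that by (simp add: sp tensor_in one_in)
  have P: "Psi V A \<I>\<^bsub>V\<^esub> (a \<otimes> one) = one \<otimes> P a" "P a \<in> space A" if "a \<in> space A" for a
    using tensor_unit_left[OF A mem[OF that]] by (simp_all add: P_def)
  have l: "linear_map (Psi V A \<I>\<^bsub>V\<^esub>)" by (rule Psi_linear[OF A I])
  have "Psi V A \<I>\<^bsub>V\<^esub> (a \<otimes> one) = Psi V A \<I>\<^bsub>V\<^esub> ((id \<otimes>\<^sub>m unitl) (a \<otimes> (one \<otimes> one)))"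
    by (simp add: tensor_eval)
  also have "\<dots> = (unitl \<otimes>\<^sub>m id) (Psi V A (\<I>\<^bsub>V\<^esub> \<odot>\<^bsub>V\<^esub> \<I>\<^bsub>V\<^esub>) (a \<otimes> (one \<otimes> one)))"
    by (rule Psi_natural[OF _ _ _ _ Hom_id[OF A] Hom_unitors(1)[OF I]])
      (auto simp: Obj_closed A sp a intro!: tensor_in one_in)
  also have "Psi V A (\<I>\<^bsub>V\<^esub> \<odot>\<^bsub>V\<^esub> \<I>\<^bsub>V\<^esub>) (a \<otimes> (one \<otimes> one)) = (one \<otimes> one) \<otimes> P (P a)"
    using P a by (subst Psi_hexagon(2)[OF A I I])
      (auto simp: sp tensor_eval l intro!: tensor_in one_in)
  finally have "one \<otimes> P a = one \<otimes> P (P a)"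
    using P(1)[OF a] by (simp add: tensor_eval)
  then have "Psi V A \<I>\<^bsub>V\<^esub> (a \<otimes> one) = Psi V A \<I>\<^bsub>V\<^esub> (P a \<otimes> one)"
    using P a by simp
  then have "a \<otimes> one = P a \<otimes> one"
    using Psi_bij[OF A I] P(2)[OF a] a
    by (auto simp: bij_betw_def sp inj_on_eq_iff tensor_in one_in)
  then have "unitr (a \<otimes> one) = unitr (P a \<otimes> one)" by simp
  then show ?thesis using P(1)[OF a] by (simp add: tensor_eval)
qed

end

section \<open>The structure maps of the extension\<close>

locale extension = braided_category V for V :: "('b, 'k::field) category" +
  fixes g :: "('b, 'k) object" and \<sigma> br \<delta> :: "('b, 'k) vec \<Rightarrow> ('b, 'k) vec"
  assumes g: "g \<in> Obj V"
    and \<sigma>_Hom: "\<sigma> \<in> Hom V (g \<odot>\<^bsub>V\<^esub> g) (g \<odot>\<^bsub>V\<^esub> g)"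
    and br_Hom: "br \<in> Hom V (g \<odot>\<^bsub>V\<^esub> g) g"
    and \<delta>_Hom: "\<delta> \<in> Hom V g (g \<odot>\<^bsub>V\<^esub> g)"
begin

abbreviation "L \<equiv> ext_object V g"
abbreviation "X \<equiv> space g"
abbreviation "Y \<equiv> space L"
abbreviation "\<Psi> \<equiv> Psi V g g"
abbreviation "\<Theta> \<equiv> Psi V L L"
abbreviation "\<Delta> \<equiv> ext_comult \<delta>"
abbreviation "\<beta> \<equiv> ext_bracket \<sigma> br"
abbreviation "\<iota> \<equiv> inr \<otimes>\<^sub>m inr"

lemma L: "L \<in> Obj V"
  unfolding ext_object_def by (intro Obj_closed g)

lemma Y_eq: "Y = sum_space unit_space X"
  by (simp add: ext_object_def sum_object_space unit_object_space)

lemma inclusion_Hom: "inl \<in> Hom V \<I>\<^bsub>V\<^esub> L" "inr \<in> Hom V g L"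
  and projection_Hom: "prl \<in> Hom V L \<I>\<^bsub>V\<^esub>" "prr \<in> Hom V L g"
  unfolding ext_object_def using Hom_sum[OF Obj_closed(1) g] by auto

lemma linear_facts [lin, simp]:
  "linear_map \<sigma>" "linear_map br" "linear_map \<delta>" "linear_map \<Psi>" "linear_map \<Theta>" "linear_map \<Delta>"
  using HomD(1)[OF \<sigma>_Hom] HomD(1)[OF br_Hom] HomD(1)[OF \<delta>_Hom] Psi_linear[OF g g] Psi_linear[OF L L]
    linear_ext_comult by auto

lemmas linear_facts_comp [lin] = linear_facts[THEN linear_map_comp]

lemma mem [intro, simp]:
  "x \<in> X \<otimes>\<^sub>S X \<Longrightarrow> \<sigma> x \<in> X \<otimes>\<^sub>S X" "x \<in> X \<otimes>\<^sub>S X \<Longrightarrow> br x \<in> X" "y \<in> X \<Longrightarrow> \<delta> y \<in> X \<otimes>\<^sub>S X"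
  "x \<in> X \<otimes>\<^sub>S X \<Longrightarrow> \<Psi> x \<in> X \<otimes>\<^sub>S X" "z \<in> Y \<otimes>\<^sub>S Y \<Longrightarrow> \<Theta> z \<in> Y \<otimes>\<^sub>S Y"
  "\<gamma> \<in> Y" "y \<in> X \<Longrightarrow> inr y \<in> Y"
  using HomD(2)[OF \<sigma>_Hom] HomD(2)[OF br_Hom] HomD(2)[OF \<delta>_Hom] Psi_in[OF g g] Psi_in[OF L L]
    HomD(2)[OF inclusion_Hom(1)] HomD(2)[OF inclusion_Hom(2)] one_in
  by (auto simp: tensor_object_space unit_object_space gam_def)

declare tensor_in [intro, simp] assoc_in [simp]

lemma \<iota>_in [simp]: "x \<in> X \<otimes>\<^sub>S X \<Longrightarrow> \<iota> x \<in> Y \<otimes>\<^sub>S Y"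
  by (rule tensor_map_in) (auto simp: linear_maps)

lemma Y_sub: "vec.subspace Y"
  by (rule Obj_D(3)[OF L])

lemma Y_eqI:
  assumes "z \<in> Y" "linear_map f" "linear_map h" "f \<gamma> = h \<gamma>" "\<And>x. x \<in> X \<Longrightarrow> f (inr x) = h (inr x)"
  shows "f z = h z"
proof -
  obtain c x where z: "z = inl c + inr x" "c \<in> unit_space" "x \<in> X"
    using assms(1) unfolding Y_eq sum_space_def by auto
  have "inl c = scale (scalar c) \<gamma>"
    using linear_scale'[OF linear_maps(7), of "scalar c" "one :: ('b, 'k) vec"] unfolding unit_spaceD[OF z(2)] gam_def .
  then show ?thesis
    using z assms(4,5) by (simp add: linear_add'[OF assms(2)] linear_add'[OF assms(3)]
        linear_scale'[OF assms(2)] linear_scale'[OF assms(3)])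
qed

text \<open>The case \<open>\<gamma> \<otimes> z\<close> is not split further:
  \<open>\<gamma>\<close> in the left position is neutral for the bracket and is exchanged with
  every \<open>z\<close>, so a single computation covers all \<open>z\<close>.\<close>

lemma Y2_eqI:
  assumes "w \<in> Y \<otimes>\<^sub>S Y" "linear_map f" "linear_map h"
    "\<And>z. z \<in> Y \<Longrightarrow> f (\<gamma> \<otimes> z) = h (\<gamma> \<otimes> z)"
    "\<And>x. x \<in> X \<Longrightarrow> f (inr x \<otimes> \<gamma>) = h (inr x \<otimes> \<gamma>)"
    "\<And>x y. x \<in> X \<Longrightarrow> y \<in> X \<Longrightarrow> f (inr x \<otimes> inr y) = h (inr x \<otimes> inr y)"
  shows "f w = h w"
proof (rule tensor_eqI[OF assms(1-3)])
  fix u v assume uv: "u \<in> Y" "v \<in> Y"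
  show "f (u \<otimes> v) = h (u \<otimes> v)"
  proof (rule Y_eqI[OF uv(1) linear_map_comp[OF assms(2) linear_tensor(1)]
          linear_map_comp[OF assms(3) linear_tensor(1)]])
    fix x assume x: "x \<in> X"
    show "f (inr x \<otimes> v) = h (inr x \<otimes> v)"
      by (rule Y_eqI[OF uv(2) linear_map_comp[OF assms(2) linear_tensor(2)]
          linear_map_comp[OF assms(3) linear_tensor(2)]]) (use assms x in auto)
  qed (use assms uv in auto)
qed

lemma \<Theta>_simps:
  "z \<in> Y \<Longrightarrow> \<Theta> (\<gamma> \<otimes> z) = z \<otimes> \<gamma>"
  "z \<in> Y \<Longrightarrow> \<Theta> (z \<otimes> \<gamma>) = \<gamma> \<otimes> z"
  "x \<in> X \<otimes>\<^sub>S X \<Longrightarrow> \<Theta> (\<iota> x) = \<iota> (\<Psi> x)"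
  "x \<in> X \<Longrightarrow> y \<in> X \<Longrightarrow> \<Theta> (inr x \<otimes> inr y) = \<iota> (\<Psi> (x \<otimes> y))"
proof -
  note I = Obj_closed(1)
  show "\<Theta> (\<gamma> \<otimes> z) = z \<otimes> \<gamma>" if "z \<in> Y"
    using Psi_natural[OF I L L L inclusion_Hom(1) Hom_id[OF L], of "one \<otimes> z"] Psi_unit_left[OF L that]
      that by (simp add: tensor_eval gam_def unit_object_space one_in)
  show "\<Theta> (z \<otimes> \<gamma>) = \<gamma> \<otimes> z" if "z \<in> Y"
    using Psi_natural[OF L L I L Hom_id[OF L] inclusion_Hom(1), of "z \<otimes> one"] Psi_unit_right[OF L that]
      that by (simp add: tensor_eval gam_def unit_object_space one_in)
  show *: "\<Theta> (\<iota> x) = \<iota> (\<Psi> x)" if "x \<in> X \<otimes>\<^sub>S X" for x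
    using Psi_natural[OF g L g L inclusion_Hom(2) inclusion_Hom(2) that] .
  show "\<Theta> (inr x \<otimes> inr y) = \<iota> (\<Psi> (x \<otimes> y))" if "x \<in> X" "y \<in> X"
    using *[of "x \<otimes> y"] that by (simp add: tensor_eval)
qed

lemmas linear_distrib = linear_add'[OF linear_maps(1)] linear_add'[OF linear_maps(3)]
  linear_add'[OF linear_maps(4)] linear_add'[OF linear_maps(5)] linear_add'[OF linear_maps(6)]
  linear_add'[OF linear_maps(7)] linear_add'[OF linear_maps(8)] linear_add'[OF linear_ext_bracket]
  linear_add'[OF linear_middle] tensor_add_left tensor_add_right
  linear_zero'[OF linear_maps(1)] linear_zero'[OF linear_maps(3)]
  linear_zero'[OF linear_maps(4)] linear_zero'[OF linear_maps(5)] linear_zero'[OF linear_maps(6)]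
  linear_zero'[OF linear_maps(7)] linear_zero'[OF linear_maps(8)] linear_zero'[OF linear_ext_bracket]
  linear_zero'[OF linear_middle]

lemma counit_\<iota>: "x \<in> X \<otimes>\<^sub>S X \<Longrightarrow> (id \<otimes>\<^sub>m ext_counit) (\<iota> x) = 0"
  by (rule tensor_eqI[where g = "\<lambda>u. 0"])
    (auto simp: tensor_eval ext_counit_simps intro!: lin)

text \<open>The counit on the second leg of \<open>ext_braiding\<close> keeps only the terms that
  end in \<open>\<gamma>\<close>. Hence \<open>\<sigma>\<close> leaves no trace in the bracket,
  although it occurs in its definition.\<close>

lemma \<beta>_simps:
  "z \<in> Y \<Longrightarrow> \<beta> (\<gamma> \<otimes> z) = z"
  "x \<in> X \<Longrightarrow> \<beta> (inr x \<otimes> \<gamma>) = 0"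
  "x \<in> X \<Longrightarrow> y \<in> X \<Longrightarrow> \<beta> (inr x \<otimes> inr y) = inr (br (x \<otimes> y))"
  "x \<in> X \<otimes>\<^sub>S X \<Longrightarrow> \<beta> (\<iota> x) = inr (br x)"
proof -
  note ev = ext_bracket_def ext_braiding_simps[OF linear_facts(1,2), of _ X] ext_counit_simps
    tensor_eval linear_distrib counit_\<iota>
  show "\<beta> (\<gamma> \<otimes> z) = z" if "z \<in> Y"
    using that by (simp add: ev flip: Y_eq)
  show "\<beta> (inr x \<otimes> \<gamma>) = 0" if "x \<in> X"
    using that by (simp add: ev flip: Y_eq)
  show *: "\<beta> (inr x \<otimes> inr y) = inr (br (x \<otimes> y))" if "x \<in> X" "y \<in> X" for x y
    using that by (simp add: ev ext_braiding_simps(3)[OF linear_facts(1,2) mem(6)[unfolded Y_eq]])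
  show "\<beta> (\<iota> x) = inr (br x)" if "x \<in> X \<otimes>\<^sub>S X" for x
    by (rule tensor_eqI[OF that]) (auto simp: * tensor_eval intro!: lin)
qed

section \<open>Bracket, counit and comultiplication of the extension as morphisms\<close>

lemma pr_\<gamma> [simp]: "prl \<gamma> = one" "prr \<gamma> = 0"
  by (simp_all add: gam_def)

text \<open>In the composite that replaces \<open>\<beta>\<close>, the first summand accounts for
  \<gamma> on the left: \<open>prl\<close> sends \<open>\<gamma>\<close> to \<open>one\<close> and
  kills \<open>g\<close>. The second carries the bracket of \<open>g\<close>, since
  \<open>prr\<close> kills \<open>\<gamma>\<close>.\<close>

lemma \<beta>_Hom: "\<beta> \<in> Hom V (L \<odot>\<^bsub>V\<^esub> L) L"
proof (rule Hom_cong)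
  note ob = L g Obj_closed(1) Obj_closed(2)
  show "(\<lambda>w. unitl ((prl \<otimes>\<^sub>m id) w) + inr (br ((prr \<otimes>\<^sub>m prr) w))) \<in> Hom V (L \<odot>\<^bsub>V\<^esub> L) L"
    by (intro Hom_add Hom_comp[OF _ _ _ Hom_tensor Hom_unitors(1)]
        Hom_comp[OF _ _ _ Hom_comp[OF _ _ _ Hom_tensor br_Hom] inclusion_Hom(2)]
        projection_Hom Hom_id ob)
  show "unitl ((prl \<otimes>\<^sub>m id) w) + inr (br ((prr \<otimes>\<^sub>m prr) w)) = \<beta> w"
    if "w \<in> space (L \<odot>\<^bsub>V\<^esub> L)" for w
    by (rule Y2_eqI[OF that[unfolded tensor_object_space]])
      (auto simp: \<beta>_simps tensor_eval linear_distrib linear_zero'[OF linear_facts(2)] intro!: lin)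
qed (auto simp: L Obj_closed linear_ext_bracket)

lemma \<beta>_in [simp]: "w \<in> Y \<otimes>\<^sub>S Y \<Longrightarrow> \<beta> w \<in> Y"
  using HomD(2)[OF \<beta>_Hom] by (simp add: tensor_object_space)

text \<open>On \<open>Y\<close> the counit is simply the projection \<open>prl\<close>.\<close>

lemma counit_Hom: "ext_counit \<in> Hom V L \<I>\<^bsub>V\<^esub>"
  by (rule Hom_cong[OF L Obj_closed(1) projection_Hom(1) linear_ext_counit], erule Y_eqI)
    (auto simp: ext_counit_simps intro!: lin)

lemmas \<Delta>_simps = ext_comult_simps[OF linear_facts(3)]

text \<open>Inserting \<open>\<gamma>\<close> as a tensor factor is a morphism because it passes
  through the inverse unit isomorphism: \<open>\<gamma> \<otimes> inr x\<close> is
  \<open>inl \<otimes>\<^sub>m inr\<close> applied to \<open>one \<otimes> x\<close>. The other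
  terms with \<open>\<gamma>\<close> are treated in the same way.\<close>

lemma \<Delta>_Hom: "\<Delta> \<in> Hom V L (L \<odot>\<^bsub>V\<^esub> L)"
proof (rule Hom_cong)
  note ob = L g Obj_closed(1) Obj_closed(2)
  note inc = Hom_tensor[OF _ _ _ _ inclusion_Hom(1) inclusion_Hom(1)]
    Hom_tensor[OF _ _ _ _ inclusion_Hom(1) inclusion_Hom(2)]
    Hom_tensor[OF _ _ _ _ inclusion_Hom(2) inclusion_Hom(1)]
    Hom_tensor[OF _ _ _ _ inclusion_Hom(2) inclusion_Hom(2)]
  show "(\<lambda>z. (inl \<otimes>\<^sub>m inl) (one \<otimes> prl z) + (inr \<otimes>\<^sub>m inl) (prr z \<otimes> one) + (inl \<otimes>\<^sub>m inr) (one \<otimes> prr z)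
      + \<iota> (\<delta> (prr z))) \<in> Hom V L (L \<odot>\<^bsub>V\<^esub> L)"
    by (intro Hom_add Hom_comp[OF _ _ _ Hom_comp[OF _ _ _ projection_Hom(1) Hom_unitors_inverse(1)] inc(1)]
        Hom_comp[OF _ _ _ Hom_comp[OF _ _ _ projection_Hom(2) Hom_unitors_inverse(2)] inc(3)]
        Hom_comp[OF _ _ _ Hom_comp[OF _ _ _ projection_Hom(2) Hom_unitors_inverse(1)] inc(2)]
        Hom_comp[OF _ _ _ Hom_comp[OF _ _ _ projection_Hom(2) \<delta>_Hom] inc(4)] ob)
  show "(inl \<otimes>\<^sub>m inl) (one \<otimes> prl z) + (inr \<otimes>\<^sub>m inl) (prr z \<otimes> one) + (inl \<otimes>\<^sub>m inr) (one \<otimes> prr z)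
      + \<iota> (\<delta> (prr z)) = \<Delta> z" if "z \<in> Y" for z
    by (rule Y_eqI[OF that])
      (auto simp: \<Delta>_simps tensor_eval linear_distrib linear_zero'[OF linear_facts(3)] simp flip: gam_def intro!: lin)
qed (auto simp: L Obj_closed)

lemma \<Delta>_in [simp]: "z \<in> Y \<Longrightarrow> \<Delta> z \<in> Y \<otimes>\<^sub>S Y"
  using HomD(2)[OF \<Delta>_Hom] by (simp add: tensor_object_space)

section \<open>The canonical braiding of the extension\<close>

abbreviation "\<Upsilon> \<equiv> canonical_braiding V L \<Delta> \<beta>"

lemma linear_\<Upsilon>: "linear_map \<Upsilon>"
  unfolding canonical_braiding_def by (intro lin)

declare linear_\<Upsilon> [lin] linear_map_comp[OF linear_\<Upsilon>, lin]

text \<open>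
  Higher-order unification in \<open>tensor_eqI\<close> eta-expands \<open>id\<close>, which then simplifies to \<open>\<lambda>u. u\<close>;
  the last rule undoes this.
\<close>

lemmas ext_eval = tensor_eval id_def[symmetric]

lemma map_in [simp]:
  "w \<in> (X \<otimes>\<^sub>S X) \<otimes>\<^sub>S A \<Longrightarrow> (br \<otimes>\<^sub>m id) w \<in> X \<otimes>\<^sub>S A"
  "w \<in> A \<otimes>\<^sub>S (X \<otimes>\<^sub>S X) \<Longrightarrow> (id \<otimes>\<^sub>m br) w \<in> A \<otimes>\<^sub>S X"
  "w \<in> (X \<otimes>\<^sub>S X) \<otimes>\<^sub>S (X \<otimes>\<^sub>S X) \<Longrightarrow> (br \<otimes>\<^sub>m br) w \<in> X \<otimes>\<^sub>S X"
  "w \<in> (X \<otimes>\<^sub>S X) \<otimes>\<^sub>S A \<Longrightarrow> (\<Psi> \<otimes>\<^sub>m id) w \<in> (X \<otimes>\<^sub>S X) \<otimes>\<^sub>S A"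
  "w \<in> A \<otimes>\<^sub>S (X \<otimes>\<^sub>S X) \<Longrightarrow> (id \<otimes>\<^sub>m \<Psi>) w \<in> A \<otimes>\<^sub>S (X \<otimes>\<^sub>S X)"
  "w \<in> X \<otimes>\<^sub>S A \<Longrightarrow> (\<delta> \<otimes>\<^sub>m id) w \<in> (X \<otimes>\<^sub>S X) \<otimes>\<^sub>S A"
  "w \<in> A \<otimes>\<^sub>S X \<Longrightarrow> (id \<otimes>\<^sub>m \<delta>) w \<in> A \<otimes>\<^sub>S (X \<otimes>\<^sub>S X)"
  "w \<in> X \<otimes>\<^sub>S X \<Longrightarrow> (\<delta> \<otimes>\<^sub>m \<delta>) w \<in> (X \<otimes>\<^sub>S X) \<otimes>\<^sub>S (X \<otimes>\<^sub>S X)"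
  by (erule tensor_map_in[rotated -1]; auto simp: linear_map_id)+

lemma middle_in [simp]:
  "w \<in> (X \<otimes>\<^sub>S X) \<otimes>\<^sub>S (X \<otimes>\<^sub>S X) \<Longrightarrow> middle \<Psi> w \<in> (X \<otimes>\<^sub>S X) \<otimes>\<^sub>S (X \<otimes>\<^sub>S X)"
proof -
  assume w: "w \<in> (X \<otimes>\<^sub>S X) \<otimes>\<^sub>S (X \<otimes>\<^sub>S X)"
  have "(assocr \<circ> (\<Psi> \<otimes>\<^sub>m id) \<circ> assocl) ` (X \<otimes>\<^sub>S (X \<otimes>\<^sub>S X)) \<subseteq> X \<otimes>\<^sub>S (X \<otimes>\<^sub>S X)"
    by auto
  then have "(id \<otimes>\<^sub>m (assocr \<circ> (\<Psi> \<otimes>\<^sub>m id) \<circ> assocl)) (assocr w) \<in> X \<otimes>\<^sub>S (X \<otimes>\<^sub>S (X \<otimes>\<^sub>S X))"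
    using w by (intro tensor_map_in[rotated -1, of _ X "X \<otimes>\<^sub>S (X \<otimes>\<^sub>S X)"] lin) auto
  then show ?thesis by (simp add: middle_def)
qed

text \<open>\<open>prr \<otimes>\<^sub>m prr\<close> is a left inverse.\<close>

lemma \<iota>_inj: "x \<in> X \<otimes>\<^sub>S X \<Longrightarrow> y \<in> X \<otimes>\<^sub>S X \<Longrightarrow> \<iota> x = \<iota> y \<longleftrightarrow> x = y"
proof -
  have "(prr \<otimes>\<^sub>m prr) (\<iota> x) = x" if "x \<in> X \<otimes>\<^sub>S X" for x
    by (rule tensor_eqI[OF that, where g = "\<lambda>u. u"]) (auto simp: ext_eval intro!: lin)
  then show "x \<in> X \<otimes>\<^sub>S X \<Longrightarrow> y \<in> X \<otimes>\<^sub>S X \<Longrightarrow> \<iota> x = \<iota> y \<longleftrightarrow> x = y" by metis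
qed

text \<open>The common pattern behind (L2'-a), (L2'-b) and (L3'). On tensors from \<open>g\<close>
  both sides consist of the same terms with \<open>\<gamma>\<close>, collected in
  \<open>c x y\<close>, and of a part in the image of \<open>\<iota>\<close>. Cancelling
  \<open>c x y\<close> and using injectivity of \<open>\<iota>\<close> leaves the equation on
  \<open>g\<close>. As \<open>c\<close> is compared on pure tensors only, it may be any function of
  \<open>x\<close> and \<open>y\<close>.\<close>

lemma Y2_iff:
  assumes "linear_map F" "linear_map G" "linear_map f" "linear_map h"
    "\<And>z. z \<in> Y \<Longrightarrow> F (\<gamma> \<otimes> z) = G (\<gamma> \<otimes> z)"
    "\<And>x. x \<in> X \<Longrightarrow> F (inr x \<otimes> \<gamma>) = G (inr x \<otimes> \<gamma>)"
    "\<And>x y. x \<in> X \<Longrightarrow> y \<in> X \<Longrightarrow> F (inr x \<otimes> inr y) = c x y + \<iota> (f (x \<otimes> y))"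
    "\<And>x y. x \<in> X \<Longrightarrow> y \<in> X \<Longrightarrow> G (inr x \<otimes> inr y) = c x y + \<iota> (h (x \<otimes> y))"
    "\<And>w. w \<in> X \<otimes>\<^sub>S X \<Longrightarrow> f w \<in> X \<otimes>\<^sub>S X" "\<And>w. w \<in> X \<otimes>\<^sub>S X \<Longrightarrow> h w \<in> X \<otimes>\<^sub>S X"
  shows "(\<forall>w\<in>Y \<otimes>\<^sub>S Y. F w = G w) \<longleftrightarrow> (\<forall>w\<in>X \<otimes>\<^sub>S X. f w = h w)"
proof
  assume L: "\<forall>w\<in>Y \<otimes>\<^sub>S Y. F w = G w"
  show "\<forall>w\<in>X \<otimes>\<^sub>S X. f w = h w"
  proof
    fix w assume "w \<in> X \<otimes>\<^sub>S X"
    then show "f w = h w"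
    proof (rule tensor_eqI[OF _ assms(3,4)])
      fix x y assume xy: "x \<in> X" "y \<in> X"
      then have "inr x \<otimes> inr y \<in> Y \<otimes>\<^sub>S Y" by simp
      then show "f (x \<otimes> y) = h (x \<otimes> y)"
        using L assms(7,8)[OF xy] \<iota>_inj[of "f (x \<otimes> y)" "h (x \<otimes> y)"] assms(9,10)[of "x \<otimes> y"] xy by auto
    qed
  qed
next
  assume R: "\<forall>w\<in>X \<otimes>\<^sub>S X. f w = h w"
  show "\<forall>w\<in>Y \<otimes>\<^sub>S Y. F w = G w"
  proof
    fix w assume "w \<in> Y \<otimes>\<^sub>S Y"
    then show "F w = G w"
      by (rule Y2_eqI[OF _ assms(1,2)]) (use assms(5-8) R in auto)
  qed
qed

text \<open>The building blocks of the canonical braiding. The argument \<open>\<iota> w\<close>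
  stands for the part \<open>\<iota> (\<delta> x)\<close> of the comultiplication, or for a value of
  the braiding.\<close>

lemma \<beta>_left:
  "w \<in> Y \<otimes>\<^sub>S Y \<Longrightarrow> (\<beta> \<otimes>\<^sub>m id) (assocl (\<gamma> \<otimes> w)) = w"
  "a \<in> X \<Longrightarrow> w \<in> X \<otimes>\<^sub>S X \<Longrightarrow> (\<beta> \<otimes>\<^sub>m id) (assocl (inr a \<otimes> \<iota> w)) = \<iota> ((br \<otimes>\<^sub>m id) (assocl (a \<otimes> w)))"
  "w \<in> X \<otimes>\<^sub>S X \<Longrightarrow> y \<in> X \<Longrightarrow> (\<beta> \<otimes>\<^sub>m id) (assocl ((id \<otimes>\<^sub>m \<Theta>) (assocr (\<iota> w \<otimes> inr y)))) =
    \<iota> ((br \<otimes>\<^sub>m id) (assocl ((id \<otimes>\<^sub>m \<Psi>) (assocr (w \<otimes> y)))))"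
  "w \<in> X \<otimes>\<^sub>S X \<Longrightarrow> (\<beta> \<otimes>\<^sub>m id) (assocl ((id \<otimes>\<^sub>m \<Theta>) (assocr (\<iota> w \<otimes> \<gamma>)))) = 0"
proof -
  show "(\<beta> \<otimes>\<^sub>m id) (assocl (\<gamma> \<otimes> w)) = w" if "w \<in> Y \<otimes>\<^sub>S Y"
    by (rule tensor_eqI[OF that]) (auto simp: ext_eval \<beta>_simps intro!: lin)
  show *: "(\<beta> \<otimes>\<^sub>m id) (assocl (inr a \<otimes> \<iota> w)) = \<iota> ((br \<otimes>\<^sub>m id) (assocl (a \<otimes> w)))"
    if "a \<in> X" "w \<in> X \<otimes>\<^sub>S X" for a w
    by (rule tensor_eqI[OF that(2)]) (use that(1) in \<open>auto simp: ext_eval \<beta>_simps intro!: lin\<close>)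
  show "(\<beta> \<otimes>\<^sub>m id) (assocl ((id \<otimes>\<^sub>m \<Theta>) (assocr (\<iota> w \<otimes> inr y)))) =
    \<iota> ((br \<otimes>\<^sub>m id) (assocl ((id \<otimes>\<^sub>m \<Psi>) (assocr (w \<otimes> y)))))" if "w \<in> X \<otimes>\<^sub>S X" "y \<in> X"
    by (rule tensor_eqI[OF that(1)]) (use that(2) in \<open>auto simp: ext_eval \<Theta>_simps * intro!: lin\<close>)
  show "(\<beta> \<otimes>\<^sub>m id) (assocl ((id \<otimes>\<^sub>m \<Theta>) (assocr (\<iota> w \<otimes> \<gamma>)))) = 0" if "w \<in> X \<otimes>\<^sub>S X"
    by (rule tensor_eqI[OF that]) (auto simp: ext_eval \<Theta>_simps \<beta>_simps intro!: lin)
qed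

lemma \<beta>_right:
  "w \<in> X \<otimes>\<^sub>S X \<Longrightarrow> y \<in> X \<Longrightarrow> (id \<otimes>\<^sub>m \<beta>) (assocr (\<iota> w \<otimes> inr y)) = \<iota> ((id \<otimes>\<^sub>m br) (assocr (w \<otimes> y)))"
  "w \<in> X \<otimes>\<^sub>S X \<Longrightarrow> (id \<otimes>\<^sub>m \<beta>) (assocr (\<iota> w \<otimes> \<gamma>)) = 0"
proof -
  show "(id \<otimes>\<^sub>m \<beta>) (assocr (\<iota> w \<otimes> inr y)) = \<iota> ((id \<otimes>\<^sub>m br) (assocr (w \<otimes> y)))"
    if "w \<in> X \<otimes>\<^sub>S X" "y \<in> X"
    by (rule tensor_eqI[OF that(1)]) (use that(2) in \<open>auto simp: ext_eval \<beta>_simps intro!: lin\<close>)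
  show "(id \<otimes>\<^sub>m \<beta>) (assocr (\<iota> w \<otimes> \<gamma>)) = 0" if "w \<in> X \<otimes>\<^sub>S X"
    by (rule tensor_eqI[OF that(1)]) (auto simp: ext_eval \<beta>_simps intro!: lin)
qed

text \<open>Each term of \<open>\<Delta> (inr x)\<close> contributes one term. From
  \<open>inr x \<otimes> \<gamma>\<close> the braiding moves \<open>\<gamma>\<close> past
  \<open>y\<close> and leaves the bracket; from \<open>\<gamma> \<otimes> inr x\<close> the neutral
  \<open>\<gamma>\<close> disappears and leaves \<open>\<Psi>\<close>; the part
  \<open>\<delta> x\<close> gives the rest.\<close>

lemma \<Upsilon>_simps:
  "z \<in> Y \<Longrightarrow> \<Upsilon> (\<gamma> \<otimes> z) = z \<otimes> \<gamma>"
  "x \<in> X \<Longrightarrow> \<Upsilon> (inr x \<otimes> \<gamma>) = \<gamma> \<otimes> inr x"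
  "x \<in> X \<Longrightarrow> y \<in> X \<Longrightarrow> \<Upsilon> (inr x \<otimes> inr y) = inr (br (x \<otimes> y)) \<otimes> \<gamma> +
     \<iota> (\<Psi> (x \<otimes> y) + (br \<otimes>\<^sub>m id) (assocl ((id \<otimes>\<^sub>m \<Psi>) (assocr (\<delta> x \<otimes> y)))))"
  by (simp_all add: canonical_braiding_def ext_eval \<Delta>_simps linear_distrib \<Theta>_simps \<beta>_left \<beta>_simps)

lemma ext_braiding_eval:
  "z \<in> Y \<Longrightarrow> ext_braiding \<sigma> br (\<gamma> \<otimes> z) = z \<otimes> \<gamma>"
  "z \<in> Y \<Longrightarrow> ext_braiding \<sigma> br (z \<otimes> \<gamma>) = \<gamma> \<otimes> z"
  "ext_braiding \<sigma> br (inr x \<otimes> inr y) = inr (br (x \<otimes> y)) \<otimes> \<gamma> + \<iota> (\<sigma> (x \<otimes> y))"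
  using ext_braiding_simps[OF linear_facts(1,2), of _ X] mem(6) unfolding Y_eq
  by (auto simp: add.commute)

section \<open>The two expressions for \<sigma>: (L2'-a) and (L2'-b)\<close>

lemma canonical_iff:
  "(\<forall>w\<in>Y \<otimes>\<^sub>S Y. \<Upsilon> w = ext_braiding \<sigma> br w) \<longleftrightarrow>
   (\<forall>w\<in>X \<otimes>\<^sub>S X. \<Psi> w + (br \<otimes>\<^sub>m id) (assocl ((id \<otimes>\<^sub>m \<Psi>) (assocr ((\<delta> \<otimes>\<^sub>m id) w)))) = \<sigma> w)"
  by (rule Y2_iff[where c = "\<lambda>x y. inr (br (x \<otimes> y)) \<otimes> \<gamma>"])
    (auto simp: \<Upsilon>_simps ext_braiding_eval ext_eval vec.subspace_add[OF subspace_tensor] intro!: lin)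

text \<open>The right side is (L2'-b) after application of \<open>\<Psi>\<close>. Its term
  \<open>w\<close> stems from \<open>inr x \<otimes> \<gamma>\<close> in
  \<open>\<Delta> (inr x)\<close>, because [\<gamma>,y] = y. The bracket term of the extended
  braiding is turned by \<open>\<Theta>\<close> into
  \<open>\<gamma> \<otimes> inr (br (x \<otimes> y))\<close>, which also arises on the other side
  and cancels.\<close>

lemma L2_iff:
  assumes "\<forall>w\<in>Y \<otimes>\<^sub>S Y. \<Upsilon> w = ext_braiding \<sigma> br w"
  shows "(\<forall>w\<in>Y \<otimes>\<^sub>S Y. \<Theta> (\<Upsilon> w) = (id \<otimes>\<^sub>m \<beta>) (assocr ((\<Delta> \<otimes>\<^sub>m id) w))) \<longleftrightarrow>
   (\<forall>w\<in>X \<otimes>\<^sub>S X. \<Psi> (\<sigma> w) = w + (id \<otimes>\<^sub>m br) (assocr ((\<delta> \<otimes>\<^sub>m id) w)))"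
  by (rule Y2_iff[where c = "\<lambda>x y. \<gamma> \<otimes> inr (br (x \<otimes> y))"])
    (auto simp: assms ext_braiding_eval ext_eval \<Delta>_simps linear_distrib \<Theta>_simps \<beta>_right \<beta>_simps
     linear_add'[OF linear_facts(5)] vec.subspace_add[OF subspace_tensor] intro!: lin)

text \<open>Injectivity of \<open>\<Psi>\<close> allows it to be applied to both sides of (L2'-b) at
  each \<open>w\<close>. In this way linearity is invoked for \<open>\<Psi>\<close> and never for
  the set-theoretic inverse \<open>\<Psi>'\<close>.\<close>

lemma L2b_iff:
  defines "\<Psi>' \<equiv> inv_into (X \<otimes>\<^sub>S X) \<Psi>"
  shows "(\<forall>w\<in>X \<otimes>\<^sub>S X. \<Psi> (\<sigma> w) = w + (id \<otimes>\<^sub>m br) (assocr ((\<delta> \<otimes>\<^sub>m id) w))) \<longleftrightarrow>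
    (\<forall>w\<in>X \<otimes>\<^sub>S X. \<sigma> w = \<Psi>' w + \<Psi>' ((id \<otimes>\<^sub>m br) (assocr ((\<delta> \<otimes>\<^sub>m id) w))))"
proof (rule ball_cong[OF refl])
  fix w assume w: "w \<in> X \<otimes>\<^sub>S X"
  let ?r = "(id \<otimes>\<^sub>m br) (assocr ((\<delta> \<otimes>\<^sub>m id) w))"
  have r: "?r \<in> X \<otimes>\<^sub>S X" using w by simp
  have bij: "inj_on \<Psi> (X \<otimes>\<^sub>S X)" "\<Psi> ` (X \<otimes>\<^sub>S X) = X \<otimes>\<^sub>S X"
    using Psi_bij[OF g g] by (auto simp: bij_betw_def)
  have inv: "\<Psi> (\<Psi>' v) = v" "\<Psi>' v \<in> X \<otimes>\<^sub>S X" if "v \<in> X \<otimes>\<^sub>S X" for v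
    using f_inv_into_f[of v \<Psi> "X \<otimes>\<^sub>S X"] inv_into_into[of v \<Psi> "X \<otimes>\<^sub>S X"] that
    unfolding bij(2) \<Psi>'_def by blast+
  have "\<Psi>' w + \<Psi>' ?r \<in> X \<otimes>\<^sub>S X"
    by (intro vec.subspace_add subspace_tensor inv w r)
  then have "\<sigma> w = \<Psi>' w + \<Psi>' ?r \<longleftrightarrow> \<Psi> (\<sigma> w) = \<Psi> (\<Psi>' w + \<Psi>' ?r)"
    using inj_on_eq_iff[OF bij(1)] w by auto
  then show "\<Psi> (\<sigma> w) = w + ?r \<longleftrightarrow> \<sigma> w = \<Psi>' w + \<Psi>' ?r"
    by (simp add: linear_add'[OF linear_facts(4)] inv w r)
qed

section \<open>Compatibility of bracket and comultiplication: (L3) and (L3')\<close>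

lemma \<beta>\<beta>_insert:
  assumes "w \<in> X \<otimes>\<^sub>S X"
  shows "(\<beta> \<otimes>\<^sub>m \<beta>) (assocl (\<gamma> \<otimes> assocr (\<iota> w \<otimes> \<gamma>))) = 0"
    "d \<in> X \<Longrightarrow> (\<beta> \<otimes>\<^sub>m \<beta>) (assocl (\<gamma> \<otimes> assocr (\<iota> w \<otimes> inr d))) = \<iota> ((id \<otimes>\<^sub>m br) (assocr (w \<otimes> d)))"
    "a \<in> X \<Longrightarrow> (\<beta> \<otimes>\<^sub>m \<beta>) (assocl (inr a \<otimes> assocr (\<iota> w \<otimes> \<gamma>))) = 0"
    "a \<in> X \<Longrightarrow> d \<in> X \<Longrightarrow> (\<beta> \<otimes>\<^sub>m \<beta>) (assocl (inr a \<otimes> assocr (\<iota> w \<otimes> inr d))) =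
      \<iota> ((br \<otimes>\<^sub>m br) (assocl (a \<otimes> assocr (w \<otimes> d))))"
  by (rule tensor_eqI[OF assms]; (intro lin | simp add: ext_eval \<beta>_simps))+

text \<open>\<open>\<Delta> (inr x)\<close> and \<open>\<Delta> (inr y)\<close> have three terms
  each, which makes nine products. Four vanish because an element of \<open>g\<close> is bracketed
  with \<open>\<gamma>\<close> on its right. Two reduce to the bracket of \<open>x\<close> and
  \<open>y\<close> next to a \<open>\<gamma>\<close>. The other three, those containing
  \<open>\<delta> y\<close> or both \<open>\<delta> x\<close> and \<open>\<delta> y\<close>, are the
  right side of (L3'). The preceding lemma evaluates the products in which the two middle legs have
  become a value \<open>\<iota> w\<close> of the braiding.\<close>

lemma \<beta>\<beta>_middle:
  "w \<in> Y \<otimes>\<^sub>S Y \<Longrightarrow> (\<beta> \<otimes>\<^sub>m \<beta>) (middle \<Theta> ((\<gamma> \<otimes> \<gamma>) \<otimes> w)) = w"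
  "x \<in> X \<Longrightarrow> u \<in> Y \<Longrightarrow> v \<in> Y \<Longrightarrow> (\<beta> \<otimes>\<^sub>m \<beta>) (middle \<Theta> ((inr x \<otimes> \<gamma>) \<otimes> (u \<otimes> v))) = \<beta> (inr x \<otimes> u) \<otimes> v"
  "x \<in> X \<Longrightarrow> d \<in> X \<otimes>\<^sub>S X \<Longrightarrow> (\<beta> \<otimes>\<^sub>m \<beta>) (middle \<Theta> ((inr x \<otimes> \<gamma>) \<otimes> \<iota> d)) =
    \<iota> ((br \<otimes>\<^sub>m id) (assocl (x \<otimes> d)))"
  "x \<in> X \<Longrightarrow> y \<in> X \<Longrightarrow> (\<beta> \<otimes>\<^sub>m \<beta>) (middle \<Theta> ((\<gamma> \<otimes> inr x) \<otimes> (inr y \<otimes> \<gamma>))) = 0"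
  "x \<in> X \<Longrightarrow> v \<in> Y \<Longrightarrow> (\<beta> \<otimes>\<^sub>m \<beta>) (middle \<Theta> ((\<gamma> \<otimes> inr x) \<otimes> (\<gamma> \<otimes> v))) = \<gamma> \<otimes> \<beta> (inr x \<otimes> v)"
  "x \<in> X \<Longrightarrow> d \<in> X \<otimes>\<^sub>S X \<Longrightarrow> (\<beta> \<otimes>\<^sub>m \<beta>) (middle \<Theta> ((\<gamma> \<otimes> inr x) \<otimes> \<iota> d)) =
    \<iota> ((id \<otimes>\<^sub>m br) (assocr ((\<Psi> \<otimes>\<^sub>m id) (assocl (x \<otimes> d)))))"
  "d \<in> X \<otimes>\<^sub>S X \<Longrightarrow> y \<in> X \<Longrightarrow> (\<beta> \<otimes>\<^sub>m \<beta>) (middle \<Theta> (\<iota> d \<otimes> (inr y \<otimes> \<gamma>))) = 0"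
  "d \<in> X \<otimes>\<^sub>S X \<Longrightarrow> v \<in> Y \<Longrightarrow> (\<beta> \<otimes>\<^sub>m \<beta>) (middle \<Theta> (\<iota> d \<otimes> (\<gamma> \<otimes> v))) = 0"
  "d \<in> X \<otimes>\<^sub>S X \<Longrightarrow> e \<in> X \<otimes>\<^sub>S X \<Longrightarrow> (\<beta> \<otimes>\<^sub>m \<beta>) (middle \<Theta> (\<iota> d \<otimes> \<iota> e)) =
    \<iota> ((br \<otimes>\<^sub>m br) (middle \<Psi> (d \<otimes> e)))"
proof -
  note ev = ext_eval \<beta>_simps \<Theta>_simps middle_tensor \<beta>\<beta>_insert
  show "(\<beta> \<otimes>\<^sub>m \<beta>) (middle \<Theta> ((\<gamma> \<otimes> \<gamma>) \<otimes> w)) = w" if "w \<in> Y \<otimes>\<^sub>S Y"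
    by (rule tensor_eqI[OF that]; (intro lin | simp add: ev))
  show "(\<beta> \<otimes>\<^sub>m \<beta>) (middle \<Theta> ((inr x \<otimes> \<gamma>) \<otimes> (u \<otimes> v))) = \<beta> (inr x \<otimes> u) \<otimes> v"
    if "x \<in> X" "u \<in> Y" "v \<in> Y" using that by (simp add: ev)
  show "(\<beta> \<otimes>\<^sub>m \<beta>) (middle \<Theta> ((inr x \<otimes> \<gamma>) \<otimes> \<iota> d)) = \<iota> ((br \<otimes>\<^sub>m id) (assocl (x \<otimes> d)))"
    if "x \<in> X" "d \<in> X \<otimes>\<^sub>S X"
    by (rule tensor_eqI[OF that(2)]; (intro lin | simp add: ev that))
  show "(\<beta> \<otimes>\<^sub>m \<beta>) (middle \<Theta> ((\<gamma> \<otimes> inr x) \<otimes> (inr y \<otimes> \<gamma>))) = 0" if "x \<in> X" "y \<in> X"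
    using that by (simp add: ev)
  show "(\<beta> \<otimes>\<^sub>m \<beta>) (middle \<Theta> ((\<gamma> \<otimes> inr x) \<otimes> (\<gamma> \<otimes> v))) = \<gamma> \<otimes> \<beta> (inr x \<otimes> v)"
    if "x \<in> X" "v \<in> Y" using that by (simp add: ev)
  show "(\<beta> \<otimes>\<^sub>m \<beta>) (middle \<Theta> ((\<gamma> \<otimes> inr x) \<otimes> \<iota> d)) =
      \<iota> ((id \<otimes>\<^sub>m br) (assocr ((\<Psi> \<otimes>\<^sub>m id) (assocl (x \<otimes> d)))))" if "x \<in> X" "d \<in> X \<otimes>\<^sub>S X"
    by (rule tensor_eqI[OF that(2)]; (intro lin | simp add: ev that))
  show "(\<beta> \<otimes>\<^sub>m \<beta>) (middle \<Theta> (\<iota> d \<otimes> (inr y \<otimes> \<gamma>))) = 0" if "d \<in> X \<otimes>\<^sub>S X" "y \<in> X"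
    by (rule tensor_eqI[OF that(1)]; (intro lin | simp add: ev that))
  show "(\<beta> \<otimes>\<^sub>m \<beta>) (middle \<Theta> (\<iota> d \<otimes> (\<gamma> \<otimes> v))) = 0" if "d \<in> X \<otimes>\<^sub>S X" "v \<in> Y"
    by (rule tensor_eqI[OF that(1)]; (intro lin | simp add: ev that))
  show "(\<beta> \<otimes>\<^sub>m \<beta>) (middle \<Theta> (\<iota> d \<otimes> \<iota> e)) = \<iota> ((br \<otimes>\<^sub>m br) (middle \<Psi> (d \<otimes> e)))"
    if d: "d \<in> X \<otimes>\<^sub>S X" and e: "e \<in> X \<otimes>\<^sub>S X"
  proof (rule tensor_eqI[OF d])
    fix a b assume ab: "a \<in> X" "b \<in> X"
    show "(\<beta> \<otimes>\<^sub>m \<beta>) (middle \<Theta> (\<iota> (a \<otimes> b) \<otimes> \<iota> e)) = \<iota> ((br \<otimes>\<^sub>m br) (middle \<Psi> ((a \<otimes> b) \<otimes> e)))"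
      by (rule tensor_eqI[OF e]; (intro lin | simp add: ev ab))
  qed (intro lin)+
qed

text \<open>The two surviving products with a factor \<open>\<gamma>\<close> are exactly the two
  terms with \<open>\<gamma>\<close> in \<open>\<Delta>\<close> of the bracket, hence this choice of
  \<open>c\<close>.\<close>

lemma L3_iff:
  "(\<forall>w\<in>Y \<otimes>\<^sub>S Y. \<Delta> (\<beta> w) = (\<beta> \<otimes>\<^sub>m \<beta>) (middle \<Theta> ((\<Delta> \<otimes>\<^sub>m \<Delta>) w))) \<longleftrightarrow>
   (\<forall>w\<in>X \<otimes>\<^sub>S X. \<delta> (br w) = (br \<otimes>\<^sub>m id) (assocl ((id \<otimes>\<^sub>m \<delta>) w)) +
     (id \<otimes>\<^sub>m br) (assocr ((\<Psi> \<otimes>\<^sub>m id) (assocl ((id \<otimes>\<^sub>m \<delta>) w)))) +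
     (br \<otimes>\<^sub>m br) (middle \<Psi> ((\<delta> \<otimes>\<^sub>m \<delta>) w)))"
  by (rule Y2_iff[where c = "\<lambda>x y. inr (br (x \<otimes> y)) \<otimes> \<gamma> + \<gamma> \<otimes> inr (br (x \<otimes> y))"];
    (intro lin | simp add: ext_eval \<Delta>_simps linear_distrib \<beta>\<beta>_middle \<beta>_simps
     linear_zero'[OF linear_facts(6)] vec.subspace_add[OF subspace_tensor] add_ac))

section \<open>The Jacobi identities (L1) and (L1')\<close>

lemma Y3_eqI:
  assumes "w \<in> Y \<otimes>\<^sub>S (Y \<otimes>\<^sub>S Y)" "linear_map f" "linear_map h"
    "\<And>u v. u \<in> Y \<Longrightarrow> v \<in> Y \<Longrightarrow> f (\<gamma> \<otimes> (u \<otimes> v)) = h (\<gamma> \<otimes> (u \<otimes> v))"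
    "\<And>x v. x \<in> X \<Longrightarrow> v \<in> Y \<Longrightarrow> f (inr x \<otimes> (\<gamma> \<otimes> v)) = h (inr x \<otimes> (\<gamma> \<otimes> v))"
    "\<And>x y. x \<in> X \<Longrightarrow> y \<in> X \<Longrightarrow> f (inr x \<otimes> (inr y \<otimes> \<gamma>)) = h (inr x \<otimes> (inr y \<otimes> \<gamma>))"
    "\<And>x y z. x \<in> X \<Longrightarrow> y \<in> X \<Longrightarrow> z \<in> X \<Longrightarrow>
      f (inr x \<otimes> (inr y \<otimes> inr z)) = h (inr x \<otimes> (inr y \<otimes> inr z))"
  shows "f w = h w"
proof (rule tensor_eqI[OF assms(1-3)])
  fix u p assume u: "u \<in> Y" and p: "p \<in> Y \<otimes>\<^sub>S Y"
  show "f (u \<otimes> p) = h (u \<otimes> p)"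
  proof (rule Y_eqI[OF u linear_map_comp[OF assms(2) linear_tensor(1)]
          linear_map_comp[OF assms(3) linear_tensor(1)]])
    show "f (\<gamma> \<otimes> p) = h (\<gamma> \<otimes> p)"
      by (rule tensor_eqI[OF p linear_map_comp[OF assms(2) linear_tensor(2)]
          linear_map_comp[OF assms(3) linear_tensor(2)]]) (use assms in auto)
    fix x assume x: "x \<in> X"
    show "f (inr x \<otimes> p) = h (inr x \<otimes> p)"
      by (rule Y2_eqI[OF p linear_map_comp[OF assms(2) linear_tensor(2)]
          linear_map_comp[OF assms(3) linear_tensor(2)]]) (use assms x in auto)
  qed
qed

text \<open>For \<open>p = \<Delta> u\<close> the first argument of the inner \<open>assocr\<close>
  is \<open>\<Upsilon> (u \<otimes> v) \<otimes> w\<close>, so the right side of (L1) depends on the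
  comultiplication only through the canonical braiding. A general \<open>p\<close> is needed since
  \<open>\<Delta> u\<close> is not pure.\<close>

lemma L1_rhs:
  assumes "p \<in> Y \<otimes>\<^sub>S Y" "v \<in> Y" "w \<in> Y"
  shows "(\<beta> \<otimes>\<^sub>m \<beta>) (middle \<Theta> (p \<otimes> (v \<otimes> w))) =
    (id \<otimes>\<^sub>m \<beta>) (assocr ((\<beta> \<otimes>\<^sub>m id) (assocl ((id \<otimes>\<^sub>m \<Theta>) (assocr (p \<otimes> v)))) \<otimes> w))"
proof (rule tensor_eqI[OF assms(1)])
  fix a b assume ab: "a \<in> Y" "b \<in> Y"
  \<comment> \<open>\<open>q\<close> stands for \<open>\<Theta> (b \<otimes> v)\<close>, which is
    again not pure.\<close>
  have "(\<beta> \<otimes>\<^sub>m \<beta>) (assocl (a \<otimes> assocr (q \<otimes> w))) =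
      (id \<otimes>\<^sub>m \<beta>) (assocr ((\<beta> \<otimes>\<^sub>m id) (assocl (a \<otimes> q)) \<otimes> w))" if q: "q \<in> Y \<otimes>\<^sub>S Y" for q
    by (rule tensor_eqI[OF q]; (intro lin | simp add: ext_eval))
  then show "(\<beta> \<otimes>\<^sub>m \<beta>) (middle \<Theta> ((a \<otimes> b) \<otimes> (v \<otimes> w))) =
    (id \<otimes>\<^sub>m \<beta>) (assocr ((\<beta> \<otimes>\<^sub>m id) (assocl ((id \<otimes>\<^sub>m \<Theta>) (assocr ((a \<otimes> b) \<otimes> v)))) \<otimes> w))"
    using ab assms by (simp add: middle_tensor ext_eval)
qed (intro lin)+

lemma \<beta>_\<iota>_right:
  "w \<in> X \<otimes>\<^sub>S X \<Longrightarrow> y \<in> X \<Longrightarrow> \<beta> ((id \<otimes>\<^sub>m \<beta>) (assocr (\<iota> w \<otimes> inr y))) =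
    inr (br ((id \<otimes>\<^sub>m br) (assocr (w \<otimes> y))))"
  by (simp add: \<beta>_right \<beta>_simps)

text \<open>With \<Upsilon> replaced by the extended braiding, the right side of (L1) on elements of
  \<open>g\<close> has two parts. The term
  \<open>inr (br (x \<otimes> y)) \<otimes> \<gamma>\<close> gives [[x,y],z] because [\<gamma>,z] =
  z, and the term with \<open>\<sigma>\<close> gives the last term of (L1').\<close>

lemma L1_iff:
  assumes "\<forall>w\<in>Y \<otimes>\<^sub>S Y. \<Upsilon> w = ext_braiding \<sigma> br w"
  shows "(\<forall>w\<in>Y \<otimes>\<^sub>S (Y \<otimes>\<^sub>S Y). \<beta> ((id \<otimes>\<^sub>m \<beta>) w) =
      \<beta> ((\<beta> \<otimes>\<^sub>m \<beta>) (middle \<Theta> ((\<Delta> \<otimes>\<^sub>m id) w)))) \<longleftrightarrow>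
    (\<forall>w\<in>X \<otimes>\<^sub>S (X \<otimes>\<^sub>S X). br ((id \<otimes>\<^sub>m br) w) =
      br ((br \<otimes>\<^sub>m id) (assocl w)) + br ((id \<otimes>\<^sub>m br) (assocr ((\<sigma> \<otimes>\<^sub>m id) (assocl w)))))"
    (is "?l \<longleftrightarrow> ?r")
proof -
  define F where "F = (\<lambda>w. \<beta> ((id \<otimes>\<^sub>m \<beta>) w))"
  define G where "G = (\<lambda>w. \<beta> ((\<beta> \<otimes>\<^sub>m \<beta>) (middle \<Theta> ((\<Delta> \<otimes>\<^sub>m id) w))))"
  have F: "F (u \<otimes> (v \<otimes> w)) = \<beta> (u \<otimes> \<beta> (v \<otimes> w))" for u v w
    by (simp add: F_def ext_eval)
  have G: "G (u \<otimes> (v \<otimes> w)) = \<beta> ((id \<otimes>\<^sub>m \<beta>) (assocr (ext_braiding \<sigma> br (u \<otimes> v) \<otimes> w)))"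
    if "u \<in> Y" "v \<in> Y" "w \<in> Y" for u v w
    using L1_rhs[of "\<Delta> u" v w] that assms[rule_format, of "u \<otimes> v"]
    by (simp add: G_def ext_eval canonical_braiding_def)
  note ev = F G ext_eval ext_braiding_eval \<beta>_simps linear_distrib \<beta>_\<iota>_right \<beta>_right
  have lFG: "linear_map F" "linear_map G" unfolding F_def G_def by (intro lin)+
  have pure: "F (inr x \<otimes> (inr y \<otimes> inr z)) = G (inr x \<otimes> (inr y \<otimes> inr z)) \<longleftrightarrow>
      br ((id \<otimes>\<^sub>m br) (x \<otimes> (y \<otimes> z))) = br ((br \<otimes>\<^sub>m id) (assocl (x \<otimes> (y \<otimes> z)))) +
        br ((id \<otimes>\<^sub>m br) (assocr ((\<sigma> \<otimes>\<^sub>m id) (assocl (x \<otimes> (y \<otimes> z))))))"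
    if "x \<in> X" "y \<in> X" "z \<in> X" for x y z
    using that by (simp add: ev inr_inj flip: linear_add'[OF linear_maps(8)])
  show ?thesis
  proof
    assume l: ?l
    show ?r
    proof
      fix w assume "w \<in> X \<otimes>\<^sub>S (X \<otimes>\<^sub>S X)"
      then show "br ((id \<otimes>\<^sub>m br) w) =
        br ((br \<otimes>\<^sub>m id) (assocl w)) + br ((id \<otimes>\<^sub>m br) (assocr ((\<sigma> \<otimes>\<^sub>m id) (assocl w))))"
      proof (rule tensor3_eqI)
        fix x y z assume xyz: "x \<in> X" "y \<in> X" "z \<in> X"
        then have "inr x \<otimes> (inr y \<otimes> inr z) \<in> Y \<otimes>\<^sub>S (Y \<otimes>\<^sub>S Y)" by simp
        then have "F (inr x \<otimes> (inr y \<otimes> inr z)) = G (inr x \<otimes> (inr y \<otimes> inr z))"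
          using l unfolding F_def G_def by blast
        then show "br ((id \<otimes>\<^sub>m br) (x \<otimes> (y \<otimes> z))) = br ((br \<otimes>\<^sub>m id) (assocl (x \<otimes> (y \<otimes> z)))) +
          br ((id \<otimes>\<^sub>m br) (assocr ((\<sigma> \<otimes>\<^sub>m id) (assocl (x \<otimes> (y \<otimes> z))))))"
          using pure[OF xyz] by blast
      qed (intro lin)+
    qed
  next
    assume r: ?r
    have "F w = G w" if w: "w \<in> Y \<otimes>\<^sub>S (Y \<otimes>\<^sub>S Y)" for w
    \<comment> \<open>The cases are sorted by the position of the leftmost \<open>\<gamma>\<close>.
      Those with a \<open>\<gamma>\<close> hold without any axiom; only the case of three elements
      of \<open>g\<close> uses (L1').\<close>
    proof (rule Y3_eqI[OF w lFG])
      fix x y z assume xyz: "x \<in> X" "y \<in> X" "z \<in> X"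
      then have "x \<otimes> (y \<otimes> z) \<in> X \<otimes>\<^sub>S (X \<otimes>\<^sub>S X)" by simp
      then show "F (inr x \<otimes> (inr y \<otimes> inr z)) = G (inr x \<otimes> (inr y \<otimes> inr z))"
        using pure[OF xyz] r by blast
    qed (auto simp: ev)
    then show ?l by (simp add: F_def G_def)
  qed
qed

section \<open>The coalgebra axioms\<close>

lemma coassoc_iff:
  "(\<forall>z\<in>Y. assocr ((\<Delta> \<otimes>\<^sub>m id) (\<Delta> z)) = (id \<otimes>\<^sub>m \<Delta>) (\<Delta> z)) \<longleftrightarrow>
   (\<forall>x\<in>X. assocr ((\<delta> \<otimes>\<^sub>m id) (\<delta> x)) = (id \<otimes>\<^sub>m \<delta>) (\<delta> x))" (is "?l \<longleftrightarrow> ?r")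
proof -
  let ?\<iota>3 = "inr \<otimes>\<^sub>m \<iota>"
  \<comment> \<open>Inserts \<open>\<gamma>\<close> between the two legs of a tensor. Such terms
    arise on both sides: on the left from splitting the first leg of \<open>\<delta> x\<close>, on
    the right from splitting the second.\<close>
  let ?mid = "inr \<otimes>\<^sub>m (\<lambda>b. \<gamma> \<otimes> inr b)"
  have l\<gamma>: "linear_map (\<lambda>b. \<gamma> \<otimes> inr b)" by (intro lin)
  have assocr_\<iota>: "assocr (\<iota> d \<otimes> inr b) = ?\<iota>3 (assocr (d \<otimes> b))" if d: "d \<in> X \<otimes>\<^sub>S X" for d b
    by (rule tensor_eqI[OF d]; (intro lin | simp add: ext_eval))
  have left: "assocr ((\<Delta> \<otimes>\<^sub>m id) (\<iota> d)) = ?mid d + \<gamma> \<otimes> \<iota> d + ?\<iota>3 (assocr ((\<delta> \<otimes>\<^sub>m id) d))"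
    if d: "d \<in> X \<otimes>\<^sub>S X" for d
    by (rule tensor_eqI[OF d];
        (intro lin | simp add: ext_eval \<Delta>_simps linear_distrib assocr_\<iota> l\<gamma>))
  have right: "(id \<otimes>\<^sub>m \<Delta>) (\<iota> d) = ?mid d + assocr (\<iota> d \<otimes> \<gamma>) + ?\<iota>3 ((id \<otimes>\<^sub>m \<delta>) d)"
    if d: "d \<in> X \<otimes>\<^sub>S X" for d
    by (rule tensor_eqI[OF d];
        (intro lin | simp add: ext_eval \<Delta>_simps linear_distrib l\<gamma> add_ac))
  have "(prr \<otimes>\<^sub>m (prr \<otimes>\<^sub>m prr)) (?\<iota>3 w) = w" if w: "w \<in> X \<otimes>\<^sub>S (X \<otimes>\<^sub>S X)" for w
    by (rule tensor3_eqI[OF w]; (intro lin | simp add: ext_eval))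
  then have inj: "?\<iota>3 v = ?\<iota>3 w \<longleftrightarrow> v = w"
    if "v \<in> X \<otimes>\<^sub>S (X \<otimes>\<^sub>S X)" "w \<in> X \<otimes>\<^sub>S (X \<otimes>\<^sub>S X)" for v w
    using that by metis
  have pure: "assocr ((\<Delta> \<otimes>\<^sub>m id) (\<Delta> (inr x))) = (id \<otimes>\<^sub>m \<Delta>) (\<Delta> (inr x)) \<longleftrightarrow>
      assocr ((\<delta> \<otimes>\<^sub>m id) (\<delta> x)) = (id \<otimes>\<^sub>m \<delta>) (\<delta> x)" if x: "x \<in> X" for x
  proof -
    \<comment> \<open>The terms common to both sides: the three positions of \<open>x\<close> among
      two factors \<open>\<gamma>\<close>, and the three positions of one \<open>\<gamma>\<close>
      relative to the legs of \<open>\<delta> x\<close>.\<close>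
    let ?c = "inr x \<otimes> (\<gamma> \<otimes> \<gamma>) + \<gamma> \<otimes> (inr x \<otimes> \<gamma>) + \<gamma> \<otimes> (\<gamma> \<otimes> inr x) + ?mid (\<delta> x) + \<gamma> \<otimes> \<iota> (\<delta> x)
      + assocr (\<iota> (\<delta> x) \<otimes> \<gamma>)"
    have "assocr ((\<Delta> \<otimes>\<^sub>m id) (\<Delta> (inr x))) = ?c + ?\<iota>3 (assocr ((\<delta> \<otimes>\<^sub>m id) (\<delta> x)))"
      using x by (simp add: ext_eval \<Delta>_simps linear_distrib left add_ac)
    moreover have "(id \<otimes>\<^sub>m \<Delta>) (\<Delta> (inr x)) = ?c + ?\<iota>3 ((id \<otimes>\<^sub>m \<delta>) (\<delta> x))"
      using x by (simp add: ext_eval \<Delta>_simps linear_distrib right add_ac)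
    ultimately show ?thesis using x by (simp add: inj)
  qed
  show ?thesis
  proof
    assume ?l then show ?r using pure mem(7) by blast
  next
    assume r: ?r
    show ?l
    proof
      fix z assume "z \<in> Y"
      then show "assocr ((\<Delta> \<otimes>\<^sub>m id) (\<Delta> z)) = (id \<otimes>\<^sub>m \<Delta>) (\<Delta> z)"
      proof (rule Y_eqI)
        show "assocr ((\<Delta> \<otimes>\<^sub>m id) (\<Delta> \<gamma>)) = (id \<otimes>\<^sub>m \<Delta>) (\<Delta> \<gamma>)"
          by (simp add: ext_eval \<Delta>_simps)
        show "assocr ((\<Delta> \<otimes>\<^sub>m id) (\<Delta> (inr x))) = (id \<otimes>\<^sub>m \<Delta>) (\<Delta> (inr x))" if "x \<in> X" for x
          using pure[OF that] r that by blast
      qed (intro lin)+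
    qed
  qed
qed

lemma counit_\<iota>_left: "x \<in> X \<otimes>\<^sub>S X \<Longrightarrow> (ext_counit \<otimes>\<^sub>m id) (\<iota> x) = 0"
  by (rule tensor_eqI[where g = "\<lambda>u. 0"])
    (auto simp: tensor_eval ext_counit_simps intro!: lin)

text \<open>The counit kills both legs of \<open>\<iota> (\<delta> x)\<close>, so the counit laws
  hold for every \<open>\<delta>\<close> and coassociativity is the only condition left.\<close>

lemma coalgebra_iff:
  "coalgebra Y \<Delta> ext_counit \<longleftrightarrow> (\<forall>x\<in>X. assocr ((\<delta> \<otimes>\<^sub>m id) (\<delta> x)) = (id \<otimes>\<^sub>m \<delta>) (\<delta> x))"
proof -
  have "unitl ((ext_counit \<otimes>\<^sub>m id) (\<Delta> z)) = z" if "z \<in> Y" for z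
    by (rule Y_eqI[OF that, where h = "\<lambda>u. u"];
        (intro lin | simp add: ext_eval \<Delta>_simps linear_distrib ext_counit_simps counit_\<iota>_left))
  moreover have "unitr ((id \<otimes>\<^sub>m ext_counit) (\<Delta> z)) = z" if "z \<in> Y" for z
    by (rule Y_eqI[OF that, where h = "\<lambda>u. u"];
        (intro lin | simp add: ext_eval \<Delta>_simps linear_distrib ext_counit_simps counit_\<iota>))
  moreover have "ext_counit ` Y \<subseteq> unit_space"
    using HomD(2)[OF counit_Hom] by (auto simp: unit_object_space)
  ultimately show ?thesis
    unfolding coalgebra_def coassoc_iff[symmetric]
    by (auto simp: Y_sub linear_ext_counit)
qed

section \<open>Counit, unit and goodness\<close>

lemma counit_\<beta>: "w \<in> Y \<otimes>\<^sub>S Y \<Longrightarrow> ext_counit (\<beta> w) = unitl ((ext_counit \<otimes>\<^sub>m ext_counit) w)"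
  by (erule Y2_eqI; (intro lin | simp add: ext_eval \<beta>_simps ext_counit_simps linear_distrib
      linear_zero'[OF linear_ext_counit]))

text \<open>Only values on \<open>\<gamma>\<close> and on tensors with a factor
  \<open>\<gamma>\<close> enter, so no axiom of a quantum Lie algebra is involved.\<close>

lemma braided_Lie_unit: "braided_Lie_unit V L \<Delta> ext_counit \<beta> inl"
  unfolding braided_Lie_unit_def braided_Lie_hom_def
proof (intro conjI ballI)
  fix c :: "('b, 'k) vec" assume "c \<in> space \<I>\<^bsub>V\<^esub>"
  then obtain k where c: "c = scale k one"
    by (auto simp: unit_object_space unit_space_def vec.span_singleton)
  have [simp]: "inl one = \<gamma>" by (simp add: gam_def)
  show "\<Delta> (inl c) = (inl \<otimes>\<^sub>m inl) (one \<otimes> c)" "ext_counit (inl c) = id c"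
    by (simp_all add: c ext_eval linear_scale'[OF linear_maps(7)] linear_scale'[OF linear_facts(6)]
        linear_scale'[OF linear_ext_counit] linear_scale'[OF linear_maps(1)] \<Delta>_simps ext_counit_simps tensor_simps)
next
  fix w :: "('b, 'k) vec" assume "w \<in> space \<I>\<^bsub>V\<^esub> \<otimes>\<^sub>S space \<I>\<^bsub>V\<^esub>"
  then show "inl (unitl w) = \<beta> ((inl \<otimes>\<^sub>m inl) w)"
  proof (rule tensor_eqI)
    fix c d :: "('b, 'k) vec" assume "c \<in> space \<I>\<^bsub>V\<^esub>" "d \<in> space \<I>\<^bsub>V\<^esub>"
    then obtain k where "c = scale k one" "inl d \<in> Y"
      using HomD(2)[OF inclusion_Hom(1)]
      by (auto simp: unit_object_space unit_space_def vec.span_singleton)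
    then show "inl (unitl (c \<otimes> d)) = \<beta> ((inl \<otimes>\<^sub>m inl) (c \<otimes> d))"
      by (simp add: ext_eval linear_scale'[OF linear_maps(7)] tensor_simps
          linear_scale'[OF linear_maps(1)] linear_scale'[OF linear_maps(5)]
          linear_scale'[OF linear_ext_bracket] \<beta>_simps flip: gam_def)
  qed (intro lin)+
next
  fix z assume z: "z \<in> Y"
  then show "\<beta> (inl one \<otimes> z) = z" by (simp add: \<beta>_simps flip: gam_def)
  have "\<beta> (z \<otimes> \<gamma>) = scale (scalar (ext_counit z)) \<gamma>"
    by (rule Y_eqI[OF z]; (intro lin | simp add: \<beta>_simps ext_counit_simps))
  then show "\<beta> (z \<otimes> inl one) = scale (scalar (ext_counit z)) (inl one)"
    by (simp add: gam_def)
qed (rule inclusion_Hom)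

lemma kernel_counit: "kernel_on Y ext_counit = inr ` X"
proof
  show "inr ` X \<subseteq> kernel_on Y ext_counit"
    by (auto simp: kernel_on_def ext_counit_simps)
  show "kernel_on Y ext_counit \<subseteq> inr ` X"
  proof
    fix z assume "z \<in> kernel_on Y ext_counit"
    then obtain c x where z: "z = inl c + inr x" "c \<in> unit_space" "x \<in> X" "ext_counit z = 0"
      unfolding kernel_on_def Y_eq sum_space_def by auto
    have "prl z = c" by (simp add: z(1) linear_add'[OF linear_maps(9)])
    then have "c = ext_counit z" using unit_spaceD[OF z(2)] by (simp add: ext_counit_def)
    then show "z \<in> inr ` X" using z by (simp add: linear_distrib)
  qed
qed

lemma kernel_counit_tensor:
  "kernel_on Y ext_counit \<otimes>\<^sub>S kernel_on Y ext_counit = \<iota> ` (X \<otimes>\<^sub>S X)"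
proof -
  have "\<iota> x \<in> inr ` X \<otimes>\<^sub>S inr ` X" if "x \<in> X \<otimes>\<^sub>S X" for x
    by (rule tensor_map_in[OF _ _ _ _ that]) (auto simp: linear_maps)
  moreover have "w \<in> \<iota> ` (X \<otimes>\<^sub>S X)" if w: "w \<in> inr ` X \<otimes>\<^sub>S inr ` X" for w
  proof
    show "w = \<iota> ((prr \<otimes>\<^sub>m prr) w)"
      by (rule tensor_eqI[OF w, where f = "\<lambda>u. u"]) (auto simp: ext_eval intro!: lin)
    show "(prr \<otimes>\<^sub>m prr) w \<in> X \<otimes>\<^sub>S X"
      by (rule tensor_map_in[OF _ _ _ _ w]) (auto simp: linear_maps)
  qed
  ultimately show ?thesis unfolding kernel_counit by blast
qed

text \<open>Subtracting the bracket tensored with \<open>\<gamma>\<close> removes precisely the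
  extra term of the extended braiding. The reduced braiding of \<open>L\<close> is thus
  \<open>\<sigma>\<close> carried over by \<open>\<iota>\<close>, and injectivity of
  \<open>\<iota>\<close> and \<open>inr\<close> identifies the two inclusions of kernels.\<close>

lemma good_iff:
  assumes "\<forall>w\<in>Y \<otimes>\<^sub>S Y. \<Upsilon> w = ext_braiding \<sigma> br w"
  defines "K \<equiv> kernel_on Y ext_counit"
  shows "kernel_on (K \<otimes>\<^sub>S K) (\<lambda>w. w - reduced_braiding V L \<Delta> \<beta> inl w) \<subseteq> kernel_on (K \<otimes>\<^sub>S K) \<beta> \<longleftrightarrow>
    kernel_on (X \<otimes>\<^sub>S X) (\<lambda>x. x - \<sigma> x) \<subseteq> kernel_on (X \<otimes>\<^sub>S X) br"
proof -
  have "\<iota> x - reduced_braiding V L \<Delta> \<beta> inl (\<iota> x) = \<iota> x - \<iota> (\<sigma> x)" if x: "x \<in> X \<otimes>\<^sub>S X" for x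
  proof -
    have "ext_braiding \<sigma> br (\<iota> x) = inr (br x) \<otimes> \<gamma> + \<iota> (\<sigma> x)"
      by (rule tensor_eqI[OF x]; (intro lin | simp add: ext_eval ext_braiding_eval))
    then show ?thesis
      using assms(1) x by (simp add: reduced_braiding_def \<beta>_simps flip: gam_def)
  qed
  then have red: "\<iota> x - reduced_braiding V L \<Delta> \<beta> inl (\<iota> x) = 0 \<longleftrightarrow> x - \<sigma> x = 0"
    if "x \<in> X \<otimes>\<^sub>S X" for x
    using that \<iota>_inj[of x "\<sigma> x"] by auto
  have "\<beta> (\<iota> x) = 0 \<longleftrightarrow> br x = 0" if "x \<in> X \<otimes>\<^sub>S X" for x
    using that inr_inj[of "br x" 0] by (simp add: \<beta>_simps linear_distrib)
  with red show ?thesis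
    unfolding K_def kernel_counit_tensor unfolding kernel_on_def by auto
qed

text \<open>The comparisons of (L1), (L2) and goodness presuppose that the canonical braiding is the
  extended one, whence the case distinction. If it is not, the right side fails by its last
  conjunct, and the left side fails because \<open>canonical_iff\<close> refutes (L2'-a).\<close>

lemma good_quantum_Lie_algebra_iff:
  "good_quantum_Lie_algebra V g \<sigma> br \<delta> \<longleftrightarrow>
    good_braided_Lie_algebra V L \<Delta> ext_counit \<beta> inl \<and> (\<forall>w\<in>Y \<otimes>\<^sub>S Y. \<Upsilon> w = ext_braiding \<sigma> br w)"
proof (cases "\<forall>w\<in>Y \<otimes>\<^sub>S Y. \<Upsilon> w = ext_braiding \<sigma> br w")
  case True
  have L2a: "(\<forall>w\<in>X \<otimes>\<^sub>S X. \<sigma> w = \<Psi> w + (br \<otimes>\<^sub>m id) (assocl ((id \<otimes>\<^sub>m \<Psi>) (assocr ((\<delta> \<otimes>\<^sub>m id) w)))))"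
    using True unfolding canonical_iff by simp
  show ?thesis
    unfolding good_quantum_Lie_algebra_def good_braided_Lie_algebra_def braided_Lie_algebra_def Let_def
      comp_apply coalgebra_iff L1_iff[OF True] L2_iff[OF True] L2b_iff L3_iff good_iff[OF True]
    using True L2a g L \<sigma>_Hom br_Hom \<delta>_Hom \<Delta>_Hom counit_Hom \<beta>_Hom counit_\<beta> braided_Lie_unit by blast
next
  case False
  then have "\<not> (\<forall>w\<in>X \<otimes>\<^sub>S X. \<sigma> w = \<Psi> w + (br \<otimes>\<^sub>m id) (assocl ((id \<otimes>\<^sub>m \<Psi>) (assocr ((\<delta> \<otimes>\<^sub>m id) w)))))"
    unfolding canonical_iff by metis
  with False show ?thesis
    unfolding good_quantum_Lie_algebra_def Let_def comp_apply by blast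
qed

end

theorem lemma3p7:
  fixes V :: "('b, 'k::field) category" and g :: "('b, 'k) object"
    and \<sigma> br \<delta> :: "('b, 'k) vec \<Rightarrow> ('b, 'k) vec"
  assumes "braided_monoidal_category V"
    and "g \<in> Obj V"
    and "\<sigma> \<in> Hom V (g \<odot>\<^bsub>V\<^esub> g) (g \<odot>\<^bsub>V\<^esub> g)"
    and "br \<in> Hom V (g \<odot>\<^bsub>V\<^esub> g) g"
    and "\<delta> \<in> Hom V g (g \<odot>\<^bsub>V\<^esub> g)"
  shows "good_quantum_Lie_algebra V g \<sigma> br \<delta> \<longleftrightarrow>
    good_braided_Lie_algebra V (ext_object V g) (ext_comult \<delta>) ext_counit (ext_bracket \<sigma> br) inl \<and>
    (\<forall>x\<in>space (ext_object V g) \<otimes>\<^sub>S space (ext_object V g).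
       canonical_braiding V (ext_object V g) (ext_comult \<delta>) (ext_bracket \<sigma> br) x
         = ext_braiding \<sigma> br x)"
proof -
  interpret extension V g \<sigma> br \<delta>
    using assms by unfold_locales
  show ?thesis
    by (rule good_quantum_Lie_algebra_iff)
qed

end
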